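(* Let $N\ge 1$. Let $(a_1,\ldots,a_\ell)$ and $(b_1,\ldots,b_\ell)$ be sequences of nonnegative integers, and let $\mu$ and $\widetilde{\mu}$ be the partitions with exactly $a_j$ and $b_j$ parts of size $j$ ($1\le j\le\ell$), respectively. (1) The integral $$\int_{U(N)} \prod_{j=1}^{\ell} \mathrm{Sc}_j(U)^{a_j}\, \overline{\mathrm{Sc}_j(U)^{b_j}}\, dU$$ is equal to the number of $\ell(\mu)\times\ell(\widetilde{\mu})$ matrices $A$ with nonnegative integer entries such that $\mathrm{row}(A)=\mu$, $\mathrm{col}(A)=\widetilde{\mu}$ and the longest SE-chain in $A$ has length $\le N$. (2) The integral $$\int_{U(N)} \prod_{j=1}^{\ell} \big(\mathrm{Tr}\,\mathrm{Sym}^j(U)\big)^{a_j}\, \overline{\big(\mathrm{Tr}\,\mathrm{Sym}^j(U)\big)^{b_j}}\, dU$$ is equal to the number of $\ell(\mu)\times\ell(\widetilde{\mu})$ matrices $A$ with nonnegative integer entries such that $\mathrm{row}(A)=\mu$, $\mathrm{col}(A)=\widetilde{\mu}$ and the longest ne-chain in $A$ has length $\le N$.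
   Context: $U(N)$ is the group of $N\times N$ complex unitary matrices with Haar probability measure $dU$. The secular coefficients $\mathrm{Sc}_n(U)$ are defined by $\det(zI+U)=\sum_{n=0}^N z^{N-n}\mathrm{Sc}_n(U)$; that is, $\mathrm{Sc}_n(U)=e_n$ (elementary symmetric polynomial) evaluated at the $N$ eigenvalues of $U$, with $\mathrm{Sc}_n(U)=0$ for $n>N$. $\mathrm{Tr}\,\mathrm{Sym}^j(U)$ is the trace of the $j$th symmetric power of $U$, i.e. the complete homogeneous symmetric polynomial $h_j$ evaluated at the eigenvalues of $U$. $\ell(\lambda)$ denotes the number of parts of a partition $\lambda$. For a matrix $A=(a_{i,j})$, $\mathrm{row}(A)$ is the vector of row sums, $\mathrm{row}(A)_i=\sum_j a_{i,j}$, and $\mathrm{col}(A)$ is the vector of column sums, $\mathrm{col}(A)_j=\sum_i a_{i,j}$. For a matrix with nonnegative integer entries: an SE-chain is a sequence of entries (at distinct positions) in which each entry is located weakly to the right of and weakly below the preceding entry; its length is the sum of the entries in it. An ne-chain is a sequence of nonzero entries in which each entry is strictly to the right of and strictly above the preceding entry; its length is the number of entries in it. "Longest" means of maximal length. *)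

theory Defs
  imports "HOL-Analysis.Analysis" "HOL-Probability.Probability"
    "HOL-Computational_Algebra.Polynomial" "HOL-Combinatorics.Multiset_Permutations"
begin

section \<open>The unitary group and its Haar probability measure\<close>

definition adjoint_matrix :: "complex^'n^'n \<Rightarrow> complex^'n^'n" where
  "adjoint_matrix U = (\<chi> i j. cnj (U $ j $ i))"

definition unitary_group :: "(complex^'n^'n) set" where
  "unitary_group = {U. adjoint_matrix U ** U = mat 1 \<and> U ** adjoint_matrix U = mat 1}"

text \<open>
  The Haar probability measure is characterized as the (unique) Borel probability measure on the
  compact group \<open>U(N)\<close>, with \<open>N = CARD('n)\<close>, that is invariant under left translations.
\<close>

definition haar_prob_measure :: "(complex^'n^'n) measure \<Rightarrow> bool" where
  "haar_prob_measure M \<longleftrightarrow>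
     prob_space M \<and>
     sets M = sets (restrict_space borel unitary_group) \<and>
     (\<forall>V\<in>unitary_group. distr M M (\<lambda>U. V ** U) = M)"

section \<open>Secular coefficients and traces of symmetric powers\<close>

text \<open>
  The determinant is taken over the ring of polynomials in \<open>z\<close>, where \<open>[:0, 1:]\<close> is \<open>z\<close>.
\<close>

definition secular_coeff :: "nat \<Rightarrow> complex^'n^'n \<Rightarrow> complex" where
  "secular_coeff n U =
     (if n \<le> CARD('n)
      then coeff (det (mat [:0, 1:] + (\<chi> i j. [:U $ i $ j:]))) (CARD('n) - n)
      else 0)"

text \<open>
  The \<open>j\<close>th symmetric power of \<open>\<complex>\<^sup>N\<close> has as basis the monomials \<open>e\<^sub>\<alpha>\<close>, the commutative product of the
  standard basis vectors \<open>e\<^sub>x\<close> with \<open>x\<close> ranging over a multiset \<open>\<alpha>\<close> of size \<open>j\<close>, and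
  \<open>Sym\<^sup>j(U)\<close> maps \<open>e\<^sub>\<alpha>\<close>, with \<open>\<alpha> = {x\<^sub>1, \<dots>, x\<^sub>j}\<close>, to the product of the vectors
  \<open>U e\<^sub>x = (\<Sum>y. U\<^sub>y\<^sub>x e\<^sub>y)\<close> for \<open>x = x\<^sub>1, \<dots>, x\<^sub>j\<close>. Expanding this product, the coefficient of \<open>e\<^sub>\<beta>\<close>
  is the sum over all orderings \<open>(y\<^sub>1, \<dots>, y\<^sub>j)\<close> of \<open>\<beta>\<close> of the product of the entries of \<open>U\<close> at
  \<open>(y\<^sub>i, x\<^sub>i)\<close>. It does not depend on the chosen enumeration of \<open>\<alpha>\<close>.
\<close>

definition sym_power_entry :: "complex^'n^'n \<Rightarrow> 'n multiset \<Rightarrow> 'n multiset \<Rightarrow> complex" where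
  "sym_power_entry U \<beta> \<alpha> =
     (let xs = (SOME xs. mset xs = \<alpha>)
      in \<Sum>ys\<in>permutations_of_multiset \<beta>. \<Prod>i<size \<alpha>. U $ (ys ! i) $ (xs ! i))"

definition trace_sym_power :: "nat \<Rightarrow> complex^'n^'n \<Rightarrow> complex" where
  "trace_sym_power j U = (\<Sum>\<alpha> | size \<alpha> = j. sym_power_entry U \<alpha> \<alpha>)"

section \<open>Partitions, matrices and chains\<close>

text \<open>
  The partition, as a weakly decreasing list of positive integers, with exactly \<open>a j\<close> parts of size
  \<open>j\<close> for \<open>1 \<le> j \<le> l\<close> and no other parts.
\<close>

definition partition_of_mults :: "nat \<Rightarrow> (nat \<Rightarrow> nat) \<Rightarrow> nat list" where
  "partition_of_mults l a = concat (map (\<lambda>j. replicate (a j) j) (rev [1..<Suc l]))"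

text \<open>
  An \<open>m \<times> n\<close> matrix over \<open>\<nat>\<close> is a function on pairs of indices \<open>i < m\<close>, \<open>j < n\<close> (row index
  first, rows numbered from top to bottom), extended by zero so that equality of functions is
  equality of matrices.
\<close>

definition nat_matrices :: "nat \<Rightarrow> nat \<Rightarrow> (nat \<Rightarrow> nat \<Rightarrow> nat) set" where
  "nat_matrices m n = {A. \<forall>i j. A i j \<noteq> 0 \<longrightarrow> i < m \<and> j < n}"

definition row_sums :: "nat \<Rightarrow> nat \<Rightarrow> (nat \<Rightarrow> nat \<Rightarrow> nat) \<Rightarrow> nat list" where
  "row_sums m n A = map (\<lambda>i. \<Sum>j<n. A i j) [0..<m]"

definition col_sums :: "nat \<Rightarrow> nat \<Rightarrow> (nat \<Rightarrow> nat \<Rightarrow> nat) \<Rightarrow> nat list" where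
  "col_sums m n A = map (\<lambda>j. \<Sum>i<m. A i j) [0..<n]"

text \<open>Chains are represented by the lists of positions of their entries; the empty chain is allowed.\<close>

definition SE_chain :: "nat \<Rightarrow> nat \<Rightarrow> (nat \<times> nat) list \<Rightarrow> bool" where
  "SE_chain m n ps \<longleftrightarrow>
     set ps \<subseteq> {..<m} \<times> {..<n} \<and> distinct ps \<and>
     successively (\<lambda>(i, j) (i', j'). i \<le> i' \<and> j \<le> j') ps"

definition SE_length :: "(nat \<Rightarrow> nat \<Rightarrow> nat) \<Rightarrow> (nat \<times> nat) list \<Rightarrow> nat" where
  "SE_length A ps = (\<Sum>(i, j)\<leftarrow>ps. A i j)"

definition ne_chain :: "nat \<Rightarrow> nat \<Rightarrow> (nat \<Rightarrow> nat \<Rightarrow> nat) \<Rightarrow> (nat \<times> nat) list \<Rightarrow> bool" where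
  "ne_chain m n A ps \<longleftrightarrow>
     set ps \<subseteq> {..<m} \<times> {..<n} \<and> (\<forall>(i, j)\<in>set ps. A i j \<noteq> 0) \<and>
     successively (\<lambda>(i, j) (i', j'). i' < i \<and> j < j') ps"

text \<open>Both maxima are over finite nonempty sets.\<close>

definition longest_SE :: "nat \<Rightarrow> nat \<Rightarrow> (nat \<Rightarrow> nat \<Rightarrow> nat) \<Rightarrow> nat" where
  "longest_SE m n A = Max (SE_length A ` {ps. SE_chain m n ps})"

definition longest_ne :: "nat \<Rightarrow> nat \<Rightarrow> (nat \<Rightarrow> nat \<Rightarrow> nat) \<Rightarrow> nat" where
  "longest_ne m n A = Max (length ` {ps. ne_chain m n A ps})"

end

theory Submission
  imports Defs "HOL-Library.Poly_Mapping" "HOL-Library.Function_Algebras"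
    "HOL-Combinatorics.Permutations" "HOL-Computational_Algebra.Fundamental_Theorem_Algebra"
begin

text \<open>
  Differentiating the invariance of Haar measure under left translations gives, for \<open>p\<^sub>k = Tr U\<^sup>k\<close>, the loop equations, in
  particular \<open>\<integral> C f = 0\<close> for the Casimir operator \<open>C\<close> and every polynomial \<open>f\<close> in the \<open>p\<^sub>k\<close>, \<open>k \<in> \<int>\<close>.
  On Laurent polynomials in the \<open>N\<close> eigenvalues, multiplication by the Vandermonde product \<open>V\<close> conjugates
  \<open>C\<close> into a diagonal operator whose kernel, on antisymmetric polynomials, is spanned by \<open>V\<close>. Hence \<open>\<integral> f\<close> is
  the coefficient of \<open>V\<close> in \<open>f V\<close>, which is the Weyl integration formula for polynomials.
  By the Pieri rules the coefficients of \<open>h\<^sub>\<mu> V\<close> and \<open>e\<^sub>\<mu> V\<close> count chains of horizontal and vertical strips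
  inside partitions with at most \<open>N\<close> parts, and the integrals become \<open>\<Sum>\<^sub>\<rho> K\<^sub>\<rho>\<^sub>\<mu> K\<^sub>\<rho>\<^sub>\<nu>\<close> over \<open>\<ell>(\<rho>) \<le> N\<close> or
  \<open>\<rho>\<^sub>1 \<le> N\<close>. The RSK correspondence, in the form of Fomin's growth diagrams, turns this into the number of
  matrices, where \<open>\<rho>\<^sub>1\<close> is the longest SE-chain and \<open>\<ell>(\<rho>)\<close> the longest ne-chain.
\<close>

section \<open>The Robinson-Schensted-Knuth correspondence\<close>

text \<open>Haar measure enters only through its left invariance; no eigenvalue density is
  constructed. What invariance controls are polynomials in the power traces, so Newton's identities
  have to bring the elementary and complete functions into their span, and negative powers are kept
  throughout to hold the conjugated factors. On the matrix side, differentiating \<open>U^k\<close>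
  produces sums of products of two traces; on the eigenvalue side, the logarithmic derivative of the
  Vandermonde product produces the same sums up to multiples of \<open>p_k\<close>. These multiples
  fix the linear term of the quadratic eigenvalue, \<open>t (t - N + 1)\<close>. Eigenvalues are
  chosen for each \<open>U\<close> separately and without regularity in \<open>U\<close>: the
  algebra is done with formal Laurent polynomials, and only values that are polynomials in the
  traces get integrated. The staircase coefficient of the Vandermonde product stays in all
  identities as a factor, so that its sign is never computed and only its being nonzero matters.
  Conjugating partitions turns a bound on the first part into a bound on the number of parts, so
  both integrals and both matrix counts meet as sums over the same partitions.\<close>

definition hstrip :: "(nat \<Rightarrow> nat) \<Rightarrow> (nat \<Rightarrow> nat) \<Rightarrow> bool" where
  "hstrip \<kappa> \<rho> \<longleftrightarrow> (\<forall>k. \<rho> (Suc k) \<le> \<kappa> k \<and> \<kappa> k \<le> \<rho> k)"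

text \<open>Fomin's local rule in its piecewise linear form: \<open>\<kappa>\<close> sits in the upper left corner of a cell with entry
  \<open>a\<close>, \<open>\<mu>\<close> and \<open>\<nu>\<close> next to it, and the rule computes the lower right corner. Partitions are functions on
  part indices starting at \<open>0\<close>.\<close>

definition rsk_step :: "nat \<Rightarrow> (nat \<Rightarrow> nat) \<Rightarrow> (nat \<Rightarrow> nat) \<Rightarrow> (nat \<Rightarrow> nat) \<Rightarrow> nat \<Rightarrow> nat" where
  "rsk_step a \<kappa> \<mu> \<nu> k = (case k of 0 \<Rightarrow> max (\<mu> 0) (\<nu> 0) + a
     | Suc k' \<Rightarrow> max (\<mu> k) (\<nu> k) + (min (\<mu> k') (\<nu> k') - \<kappa> k'))"

text \<open>The local rule at part \<open>Suc k\<close> solved for \<open>\<kappa> k\<close>. The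
  partitions interlace where it is used, so the truncated subtraction is exact. The entry is
  recovered separately as \<open>\<rho> 0 - max (\<mu> 0) (\<nu> 0)\<close>.\<close>

definition rsk_unstep :: "(nat \<Rightarrow> nat) \<Rightarrow> (nat \<Rightarrow> nat) \<Rightarrow> (nat \<Rightarrow> nat) \<Rightarrow> nat \<Rightarrow> nat" where
  "rsk_unstep \<mu> \<nu> \<rho> k = min (\<mu> k) (\<nu> k) + max (\<mu> (Suc k)) (\<nu> (Suc k)) - \<rho> (Suc k)"

text \<open>The parts \<open>Suc k\<close> of \<open>\<mu>\<close> and \<open>\<nu>\<close> are at
  most \<open>\<kappa> k\<close> and the parts \<open>k\<close> at least \<open>\<kappa> k\<close>,
  so adding the increment \<open>min (\<mu> k) (\<nu> k) - \<kappa> k\<close> to the maximum cannot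
  pass the smaller of the two parts \<open>k\<close>. The entry \<open>a\<close> only touches the
  first part, which interlacing leaves unbounded above.\<close>

lemma hstrip_step:
  assumes "hstrip \<kappa> \<mu>" "hstrip \<kappa> \<nu>"
  shows "hstrip \<mu> (rsk_step a \<kappa> \<mu> \<nu>)" "hstrip \<nu> (rsk_step a \<kappa> \<mu> \<nu>)"
proof -
  have *: "\<mu> (Suc k) \<le> \<kappa> k \<and> \<kappa> k \<le> \<mu> k \<and> \<nu> (Suc k) \<le> \<kappa> k \<and> \<kappa> k \<le> \<nu> k" for k
    using assms by (auto simp: hstrip_def)
  have "rsk_step a \<kappa> \<mu> \<nu> (Suc k) \<le> \<mu> k \<and> rsk_step a \<kappa> \<mu> \<nu> (Suc k) \<le> \<nu> k" for k
    using *[of k] by (auto simp: rsk_step_def max_def min_def)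
  moreover have "\<mu> k \<le> rsk_step a \<kappa> \<mu> \<nu> k \<and> \<nu> k \<le> rsk_step a \<kappa> \<mu> \<nu> k" for k
    by (auto simp: rsk_step_def split: nat.split)
  ultimately show "hstrip \<mu> (rsk_step a \<kappa> \<mu> \<nu>)" "hstrip \<nu> (rsk_step a \<kappa> \<mu> \<nu>)"
    by (auto simp: hstrip_def)
qed

lemma hstrip_unstep:
  assumes "hstrip \<mu> \<rho>" "hstrip \<nu> \<rho>"
  shows "hstrip (rsk_unstep \<mu> \<nu> \<rho>) \<mu>" "hstrip (rsk_unstep \<mu> \<nu> \<rho>) \<nu>"
proof -
  have *: "\<rho> (Suc k) \<le> \<mu> k \<and> \<mu> k \<le> \<rho> k \<and> \<rho> (Suc k) \<le> \<nu> k \<and> \<nu> k \<le> \<rho> k" for k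
    using assms by (auto simp: hstrip_def)
  have "\<mu> (Suc k) \<le> rsk_unstep \<mu> \<nu> \<rho> k \<and> rsk_unstep \<mu> \<nu> \<rho> k \<le> \<mu> k \<and>
      \<nu> (Suc k) \<le> rsk_unstep \<mu> \<nu> \<rho> k \<and> rsk_unstep \<mu> \<nu> \<rho> k \<le> \<nu> k" for k
    using *[of k] *[of "Suc k"] unfolding rsk_unstep_def by (auto simp: max_def min_def)
  then show "hstrip (rsk_unstep \<mu> \<nu> \<rho>) \<mu>" "hstrip (rsk_unstep \<mu> \<nu> \<rho>) \<nu>"
    by (auto simp: hstrip_def)
qed

lemma step_unstep:
  assumes "hstrip \<mu> \<rho>" "hstrip \<nu> \<rho>"
  shows "rsk_step (\<rho> 0 - max (\<mu> 0) (\<nu> 0)) (rsk_unstep \<mu> \<nu> \<rho>) \<mu> \<nu> = \<rho>"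
proof
  fix k
  have *: "\<rho> (Suc k) \<le> \<mu> k \<and> \<mu> k \<le> \<rho> k \<and> \<rho> (Suc k) \<le> \<nu> k \<and> \<nu> k \<le> \<rho> k" for k
    using assms by (auto simp: hstrip_def)
  show "rsk_step (\<rho> 0 - max (\<mu> 0) (\<nu> 0)) (rsk_unstep \<mu> \<nu> \<rho>) \<mu> \<nu> k = \<rho> k"
  proof (cases k)
    case 0
    then show ?thesis using *[of 0] by (simp add: rsk_step_def)
  next
    case (Suc k')
    then show ?thesis using *[of k'] *[of "Suc k'"]
      by (auto simp: rsk_step_def rsk_unstep_def max_def min_def)
  qed
qed

lemma unstep_step:
  assumes "hstrip \<kappa> \<mu>" "hstrip \<kappa> \<nu>"
  shows "rsk_unstep \<mu> \<nu> (rsk_step a \<kappa> \<mu> \<nu>) = \<kappa>"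
    and "rsk_step a \<kappa> \<mu> \<nu> 0 - max (\<mu> 0) (\<nu> 0) = a"
proof -
  have *: "\<mu> (Suc k) \<le> \<kappa> k \<and> \<kappa> k \<le> \<mu> k \<and> \<nu> (Suc k) \<le> \<kappa> k \<and> \<kappa> k \<le> \<nu> k" for k
    using assms by (auto simp: hstrip_def)
  show "rsk_unstep \<mu> \<nu> (rsk_step a \<kappa> \<mu> \<nu>) = \<kappa>"
  proof
    fix k show "rsk_unstep \<mu> \<nu> (rsk_step a \<kappa> \<mu> \<nu>) k = \<kappa> k"
      using *[of k] by (auto simp: rsk_step_def rsk_unstep_def max_def min_def)
  qed
  show "rsk_step a \<kappa> \<mu> \<nu> 0 - max (\<mu> 0) (\<nu> 0) = a" by (simp add: rsk_step_def)
qed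

text \<open>The position \<open>(i, j)\<close> is a grid corner: its partition depends on the first
  \<open>i\<close> rows and \<open>j\<close> columns, and the entry \<open>A i j\<close> lies in the
  cell whose lower right corner is \<open>(Suc i, Suc j)\<close>.\<close>

fun growth :: "(nat \<Rightarrow> nat \<Rightarrow> nat) \<Rightarrow> nat \<Rightarrow> nat \<Rightarrow> nat \<Rightarrow> nat" where
  "growth A 0 j = (\<lambda>_. 0)"
| "growth A (Suc i) 0 = (\<lambda>_. 0)"
| "growth A (Suc i) (Suc j) =
     rsk_step (A i j) (growth A i j) (growth A i (Suc j)) (growth A (Suc i) j)"

lemma growth_0_right [simp]: "growth A i 0 = (\<lambda>_. 0)"
  by (cases i) auto

lemma hstrip_growth:
  "hstrip (growth A i j) (growth A (Suc i) j)" "hstrip (growth A i j) (growth A i (Suc j))"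
proof -
  have "hstrip (growth A i j) (growth A (Suc i) j) \<and> hstrip (growth A i j) (growth A i (Suc j))"
  proof (induction i arbitrary: j)
    case 0
    have "hstrip (growth A 0 j) (growth A (Suc 0) j)" for j
    proof (induction j)
      case (Suc j)
      then show ?case using hstrip_step(1)[of "growth A 0 j" "growth A 0 (Suc j)" "growth A (Suc 0) j"]
        by (simp add: hstrip_def)
    qed (simp add: hstrip_def)
    then show ?case by (simp add: hstrip_def)
  next
    case (Suc i)
    have 1: "hstrip (growth A (Suc i) j) (growth A (Suc i) (Suc j))" for j
      using hstrip_step(2)[OF Suc[of j, THEN conjunct2] Suc[of j, THEN conjunct1]] by simp
    have "hstrip (growth A (Suc i) j) (growth A (Suc (Suc i)) j)" for j
    proof (induction j)
      case (Suc j)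
      then show ?case using hstrip_step(1)[OF 1[of j] Suc] by simp
    qed (simp add: hstrip_def)
    with 1 show ?case by blast
  qed
  then show "hstrip (growth A i j) (growth A (Suc i) j)" "hstrip (growth A i j) (growth A i (Suc j))"
    by auto
qed

lemma growth_unstep:
  "rsk_unstep (growth A i (Suc j)) (growth A (Suc i) j) (growth A (Suc i) (Suc j)) = growth A i j"
  "growth A (Suc i) (Suc j) 0 - max (growth A i (Suc j) 0) (growth A (Suc i) j 0) = A i j"
  using unstep_step[OF hstrip_growth(2) hstrip_growth(1)] by (metis growth.simps(3))+

section \<open>Sizes along a growth diagram as row and column sums\<close>

definition psize :: "(nat \<Rightarrow> nat) \<Rightarrow> nat" where
  "psize \<rho> = (\<Sum>k | \<rho> k \<noteq> 0. \<rho> k)"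

lemma psize_eq: "(\<And>k. k \<ge> K \<Longrightarrow> \<rho> k = 0) \<Longrightarrow> psize \<rho> = (\<Sum>k<K. \<rho> k)"
  unfolding psize_def by (rule sum.mono_neutral_left) (auto intro: ccontr simp: not_less)

lemma growth_support: "k \<ge> j \<Longrightarrow> growth A i j k = 0"
proof (induction j arbitrary: k)
  case (Suc j)
  then obtain k' where k': "k = Suc k'" "k' \<ge> j" by (cases k) auto
  then show ?case using Suc.IH[of k'] hstrip_growth(2)[of A i j] by (metis hstrip_def le_zero_eq)
qed simp

text \<open>The rule pairs the maximum at \<open>Suc k\<close> with the minimum at \<open>k\<close>.
  Adding \<open>psize \<kappa>\<close> cancels the subtracted parts, and shifting the index back
  puts maximum and minimum at the same \<open>k\<close>, where they add up to
  \<open>\<mu> k + \<nu> k\<close>.\<close>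

lemma psize_step:
  assumes "hstrip \<kappa> \<mu>" "hstrip \<kappa> \<nu>"
    and "\<And>k. k \<ge> K \<Longrightarrow> \<mu> k = 0" "\<And>k. k \<ge> K \<Longrightarrow> \<nu> k = 0"
  shows "psize (rsk_step a \<kappa> \<mu> \<nu>) + psize \<kappa> = psize \<mu> + psize \<nu> + a"
proof -
  have *: "\<mu> (Suc k) \<le> \<kappa> k \<and> \<kappa> k \<le> \<mu> k \<and> \<nu> (Suc k) \<le> \<kappa> k \<and> \<kappa> k \<le> \<nu> k" for k
    using assms by (auto simp: hstrip_def)
  have \<kappa>0: "\<kappa> k = 0" if "k \<ge> K" for k using *[of k] assms(3)[OF that] by auto
  have s: "rsk_step a \<kappa> \<mu> \<nu> k = 0" if "k \<ge> Suc K" for k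
  proof (cases k)
    case (Suc k')
    then have "K \<le> k'" using that by auto
    then show ?thesis using Suc that assms(3)[of k] assms(4)[of k] assms(3)[of k'] by (auto simp: rsk_step_def)
  qed (use that in simp)
  have "psize (rsk_step a \<kappa> \<mu> \<nu>) = (\<Sum>k<Suc K. rsk_step a \<kappa> \<mu> \<nu> k)"
    using s by (rule psize_eq)
  also have "\<dots> = max (\<mu> 0) (\<nu> 0) + a + (\<Sum>k<K. max (\<mu> (Suc k)) (\<nu> (Suc k)) + (min (\<mu> k) (\<nu> k) - \<kappa> k))"
    unfolding sum.lessThan_Suc_shift by (simp add: rsk_step_def)
  finally have 1: "psize (rsk_step a \<kappa> \<mu> \<nu>) + psize \<kappa> =
     max (\<mu> 0) (\<nu> 0) + (\<Sum>k<K. max (\<mu> (Suc k)) (\<nu> (Suc k))) + a + (\<Sum>k<K. (min (\<mu> k) (\<nu> k) - \<kappa> k) + \<kappa> k)"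
    using psize_eq[OF \<kappa>0] by (simp add: sum.distrib)
  have 2: "max (\<mu> 0) (\<nu> 0) + (\<Sum>k<K. max (\<mu> (Suc k)) (\<nu> (Suc k))) = (\<Sum>k<Suc K. max (\<mu> k) (\<nu> k))"
    unfolding sum.lessThan_Suc_shift by simp
  have 4: "(\<Sum>k<Suc K. max (\<mu> k) (\<nu> k)) = (\<Sum>k<K. max (\<mu> k) (\<nu> k))"
    using assms(3)[of K] assms(4)[of K] by simp
  have 5: "(\<Sum>k<K. (min (\<mu> k) (\<nu> k) - \<kappa> k) + \<kappa> k) = (\<Sum>k<K. min (\<mu> k) (\<nu> k))"
    using * by (intro sum.cong) auto
  have 3: "psize (rsk_step a \<kappa> \<mu> \<nu>) + psize \<kappa> = (\<Sum>k<K. max (\<mu> k) (\<nu> k) + min (\<mu> k) (\<nu> k)) + a"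
    using 1 unfolding 2 4 5 by (simp only: sum.distrib ac_simps)
  have 6: "(\<Sum>k<K. max (\<mu> k) (\<nu> k) + min (\<mu> k) (\<nu> k)) = (\<Sum>k<K. \<mu> k + \<nu> k)"
    by (intro sum.cong) auto
  have 7: "psize \<mu> = (\<Sum>k<K. \<mu> k)" "psize \<nu> = (\<Sum>k<K. \<nu> k)"
    using assms(3,4) by (auto intro!: psize_eq)
  show ?thesis using 3 unfolding 6 7 by (simp only: sum.distrib)
qed

lemma psize_growth_cell:
  "psize (growth A (Suc i) (Suc j)) + psize (growth A i j) =
   psize (growth A i (Suc j)) + psize (growth A (Suc i) j) + A i j"
  unfolding growth.simps(3)
  by (rule psize_step[OF hstrip_growth(2) hstrip_growth(1), where K = "Suc j"]) (simp_all add: growth_support)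

lemma psize_zero [simp]: "psize (\<lambda>_. 0) = 0" by (simp add: psize_def)

lemma psize_growth_row: "psize (growth A (Suc i) n) = psize (growth A i n) + (\<Sum>j<n. A i j)"
proof (induction n)
  case (Suc n)
  then show ?case using psize_growth_cell[of A i n] by simp
qed simp

lemma psize_growth_col: "psize (growth A n (Suc j)) = psize (growth A n j) + (\<Sum>i<n. A i j)"
proof (induction n)
  case (Suc n)
  then show ?case using psize_growth_cell[of A n j] by simp
qed simp

subsection \<open>The bijection\<close>

text \<open>A semistandard tableau, given as the chain of shapes occupied by its smallest letters.
  Freezing the chain past \<open>m\<close> makes equality of functions equality of chains, as
  counting requires.\<close>

definition strip_chain :: "nat \<Rightarrow> (nat \<Rightarrow> nat \<Rightarrow> nat) \<Rightarrow> bool" where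
  "strip_chain m \<tau> \<longleftrightarrow> \<tau> 0 = (\<lambda>_. 0) \<and> (\<forall>i<m. hstrip (\<tau> i) (\<tau> (Suc i))) \<and> (\<forall>i\<ge>m. \<tau> i = \<tau> m)"

text \<open>The right and the bottom border of the growth diagram. They end in the same corner
  \<open>(m, n)\<close>, which makes them a pair of tableaux of equal shape.\<close>

definition rsk :: "nat \<Rightarrow> nat \<Rightarrow> (nat \<Rightarrow> nat \<Rightarrow> nat) \<Rightarrow> (nat \<Rightarrow> nat \<Rightarrow> nat) \<times> (nat \<Rightarrow> nat \<Rightarrow> nat)" where
  "rsk m n A = (\<lambda>i. growth A (min i m) n, \<lambda>j. growth A m (min j n))"

text \<open>Starting from the two borders, \<open>rsk_unstep\<close> determines each inner corner
  from its three neighbours to the right and below, so the inductions run on the distances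
  \<open>p\<close> and \<open>q\<close> from the last corner. The entries are then the excesses of
  the first parts.\<close>

lemma rsk_inj: "inj_on (rsk m n) (nat_matrices m n)"
proof (rule inj_onI)
  fix A B assume A: "A \<in> nat_matrices m n" and B: "B \<in> nat_matrices m n" and eq: "rsk m n A = rsk m n B"
  have r: "growth A i n = growth B i n" if "i \<le> m" for i
    using eq that by (auto simp: rsk_def fun_eq_iff min_def dest!: spec[of _ i] split: if_splits)
  have c: "growth A m j = growth B m j" if "j \<le> n" for j
    using eq that by (auto simp: rsk_def fun_eq_iff min_def dest!: spec[of _ j] split: if_splits)
  have g: "growth A (m - p) (n - q) = growth B (m - p) (n - q)" for p q
  proof (induction p arbitrary: q)
    case 0
    then show ?case using c by simp
  next
    case (Suc p)
    note IH = this
    show ?case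
    proof (cases "p < m")
      case True
      then have mp: "m - p = Suc (m - Suc p)" by simp
      show ?thesis
      proof (induction q)
        case 0
        then show ?case using r by simp
      next
        case (Suc q)
        show ?case
        proof (cases "q < n")
          case True
          then have nq: "n - q = Suc (n - Suc q)" by simp
          show ?thesis
            using growth_unstep(1)[of A "m - Suc p" "n - Suc q"] growth_unstep(1)[of B "m - Suc p" "n - Suc q"]
              Suc IH[of q] IH[of "Suc q"] unfolding mp nq by (simp del: growth.simps)
        next
          case False
          then show ?thesis using Suc by simp
        qed
      qed
    next
      case False
      then show ?thesis using IH by simp
    qed
  qed
  have g': "growth A i j = growth B i j" if "i \<le> m" "j \<le> n" for i j
    using g[of "m - i" "n - j"] that by simp
  show "A = B"
  proof (intro ext)
    fix i j
    show "A i j = B i j"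
    proof (cases "i < m \<and> j < n")
      case True
      then show ?thesis using growth_unstep(2)[of A i j] growth_unstep(2)[of B i j]
        g'[of "Suc i" "Suc j"] g'[of i "Suc j"] g'[of "Suc i" j] by (simp del: growth.simps)
    next
      case False
      then have "A i j = 0" "B i j = 0" using A B unfolding nat_matrices_def by blast+
      then show ?thesis by simp
    qed
  qed
qed

text \<open>The indices count steps up (\<open>p\<close>) and to the left (\<open>q\<close>) from
  the last corner, which turns the backward filling of the grid into a structural recursion.\<close>

fun unrsk :: "(nat \<Rightarrow> nat \<Rightarrow> nat) \<Rightarrow> (nat \<Rightarrow> nat \<Rightarrow> nat) \<Rightarrow> nat \<Rightarrow> nat \<Rightarrow> nat \<Rightarrow> nat \<Rightarrow> nat \<Rightarrow> nat" where
  "unrsk \<tau> \<sigma> m n 0 q = \<sigma> (n - q)"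
| "unrsk \<tau> \<sigma> m n (Suc p) 0 = \<tau> (m - Suc p)"
| "unrsk \<tau> \<sigma> m n (Suc p) (Suc q) =
     rsk_unstep (unrsk \<tau> \<sigma> m n (Suc p) q) (unrsk \<tau> \<sigma> m n p (Suc q)) (unrsk \<tau> \<sigma> m n p q)"

text \<open>Interlacing survives each inverse step, so the backward filling shrinks towards the top
  and the left and is zero on these two edges. Hence it is the growth diagram of the matrix of
  first-part excesses.\<close>

lemma rsk_surj:
  assumes \<tau>: "strip_chain m \<tau>" and \<sigma>: "strip_chain n \<sigma>" and eq: "\<tau> m = \<sigma> n"
  shows "(\<tau>, \<sigma>) \<in> rsk m n ` nat_matrices m n"
proof -
  let ?b = "unrsk \<tau> \<sigma> m n"
  have b0: "?b p 0 = \<tau> (m - p)" for p using eq by (cases p) auto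
  have H0: "hstrip (?b 0 (Suc q)) (?b 0 q)" if "q < n" for q
  proof -
    have "n - q = Suc (n - Suc q)" "n - Suc q < n" using that by auto
    then show ?thesis using \<sigma> by (simp add: strip_chain_def)
  qed
  have V0: "hstrip (?b (Suc p) 0) (?b p 0)" if "p < m" for p
  proof -
    have "m - p = Suc (m - Suc p)" "m - Suc p < m" using that by auto
    then show ?thesis using \<tau> unfolding b0 by (simp add: strip_chain_def)
  qed
  have HV: "(\<forall>q<n. hstrip (?b p (Suc q)) (?b p q)) \<and> (p < m \<longrightarrow> (\<forall>q\<le>n. hstrip (?b (Suc p) q) (?b p q)))"
    if "p \<le> m" for p
    using that
  proof (induction p)
    case 0
    have "hstrip (?b (Suc 0) q) (?b 0 q)" if "0 < m" "q \<le> n" for q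
      using that(2)
    proof (induction q)
      case 0
      then show ?case using V0[of 0] \<open>0 < m\<close> by simp
    next
      case (Suc q)
      have "hstrip (?b 0 (Suc q)) (?b 0 q)" using H0[of q] Suc by simp
      moreover have "hstrip (?b (Suc 0) q) (?b 0 q)" using Suc by simp
      ultimately show ?case unfolding unrsk.simps(3) by (intro hstrip_unstep(2))
    qed
    with H0 show ?case by (intro conjI allI impI) blast+
  next
    case (Suc p)
    then have V: "hstrip (?b (Suc p) q) (?b p q)" if "q \<le> n" for q using that by simp
    have H: "hstrip (?b p (Suc q)) (?b p q)" if "q < n" for q using that Suc by simp
    have H': "hstrip (?b (Suc p) (Suc q)) (?b (Suc p) q)" if "q < n" for q
      unfolding unrsk.simps(3) using V[of q] H[of q] that by (intro hstrip_unstep(1)) (auto simp del: unrsk.simps)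
    have "hstrip (?b (Suc (Suc p)) q) (?b (Suc p) q)" if "Suc p < m" "q \<le> n" for q
      using that(2)
    proof (induction q)
      case 0
      then show ?case using V0[of "Suc p"] \<open>Suc p < m\<close> by simp
    next
      case (Suc q)
      then have "hstrip (?b (Suc (Suc p)) q) (?b (Suc p) q)" by simp
      moreover have "hstrip (?b (Suc p) (Suc q)) (?b (Suc p) q)" using H' Suc by simp
      ultimately show ?case unfolding unrsk.simps(3)[of _ _ _ _ "Suc p"] by (intro hstrip_unstep(2))
    qed
    with H' show ?case by (intro conjI allI impI) blast+
  qed
  have le: "\<mu> k \<le> \<nu> k" if "hstrip \<mu> \<nu>" for \<mu> \<nu> k using that by (auto simp: hstrip_def)
  \<comment> \<open>In the bottom row the left edge carries \<open>\<sigma> 0\<close>, the zero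
    partition, and it can only decrease upwards.\<close>
  have left0: "?b p n = (\<lambda>_. 0)" if "p \<le> m" for p
    using that
  proof (induction p)
    case 0
    then show ?case using \<sigma> by (simp add: strip_chain_def)
  next
    case (Suc p)
    have "hstrip (?b (Suc p) n) (?b p n)" using HV[of p] Suc.prems by (simp del: unrsk.simps)
    from le[OF this] have "?b (Suc p) n k \<le> ?b p n k" for k .
    with Suc show ?case by (auto simp del: unrsk.simps)
  qed
  have top0: "?b m q = (\<lambda>_. 0)" if "q \<le> n" for q
    using that
  proof (induction q)
    case 0
    then show ?case using \<tau> by (simp add: b0 strip_chain_def)
  next
    case (Suc q)
    have "hstrip (?b m (Suc q)) (?b m q)" using HV[of m] Suc.prems by (simp del: unrsk.simps)
    from le[OF this] have "?b m (Suc q) k \<le> ?b m q k" for k .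
    with Suc show ?case by (auto simp del: unrsk.simps)
  qed
  define A where "A i j = (if i < m \<and> j < n then ?b (m - Suc i) (n - Suc j) 0 -
      max (?b (m - i) (n - Suc j) 0) (?b (m - Suc i) (n - j) 0) else 0)" for i j
  have g: "growth A i j = ?b (m - i) (n - j)" if "i \<le> m" "j \<le> n" for i j
    using that
  proof (induction i arbitrary: j)
    case 0
    then show ?case using top0[of "n - j"] by simp
  next
    case (Suc i)
    note outer = this
    show ?case using \<open>j \<le> n\<close>
    proof (induction j)
    case 0
    then show ?case using left0[of "m - Suc i"] by simp
  next
    case (Suc j)
    note 3 = outer(1)[of j] outer(1)[of "Suc j"] outer(2) Suc
    have mi: "m - i = Suc (m - Suc i)" and nj: "n - j = Suc (n - Suc j)" using 3 by auto
    let ?p = "m - Suc i" and ?q = "n - Suc j"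
    have h: "hstrip (?b (Suc ?p) ?q) (?b ?p ?q)" "hstrip (?b ?p (Suc ?q)) (?b ?p ?q)"
      using HV[of ?p] 3 by auto
    have "A i j = ?b ?p ?q 0 - max (?b (Suc ?p) ?q 0) (?b ?p (Suc ?q) 0)"
      using 3 by (simp add: A_def mi nj del: unrsk.simps)
    moreover have "growth A i j = rsk_unstep (?b (Suc ?p) ?q) (?b ?p (Suc ?q)) (?b ?p ?q)"
      using 3 by (simp add: mi nj)
    moreover have "growth A i (Suc j) = ?b (Suc ?p) ?q" "growth A (Suc i) j = ?b ?p (Suc ?q)"
      using 3 mi nj by (simp_all del: growth.simps unrsk.simps)
    ultimately show ?case using step_unstep[OF h] by simp
    qed
  qed
  have "A \<in> nat_matrices m n" unfolding nat_matrices_def A_def by (simp del: unrsk.simps)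
  moreover have "rsk m n A = (\<tau>, \<sigma>)"
  proof -
    have "growth A (min i m) n = \<tau> i" for i
    proof (cases "i \<le> m")
      case True
      then show ?thesis using g[of i n] b0[of "m - i"] by simp
    next
      case False
      then have "\<tau> i = \<tau> m" using \<tau> unfolding strip_chain_def by (meson nat_le_linear)
      then show ?thesis using False g[of m n] b0[of 0] by simp
    qed
    moreover have "growth A m (min j n) = \<sigma> j" for j
    proof (cases "j \<le> n")
      case True
      then show ?thesis using g[of m j] by simp
    next
      case False
      then have "\<sigma> j = \<sigma> n" using \<sigma> unfolding strip_chain_def by (meson nat_le_linear)
      then show ?thesis using False g[of m n] by simp
    qed
    ultimately show ?thesis by (simp add: rsk_def)
  qed
  ultimately show ?thesis by force
qed

lemma rsk_chains: "strip_chain m (fst (rsk m n A))" "strip_chain n (snd (rsk m n A))"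
  using hstrip_growth by (auto simp: rsk_def strip_chain_def min_def)

subsection \<open>Kostka numbers\<close>

text \<open>The horizontal strip of the largest letter is removed; the size equation prescribes how
  often that letter occurs.\<close>

fun kostka :: "(nat \<Rightarrow> nat) \<Rightarrow> nat \<Rightarrow> (nat \<Rightarrow> nat) \<Rightarrow> nat" where
  "kostka \<mu> 0 \<rho> = (if \<rho> = (\<lambda>_. 0) then 1 else 0)"
| "kostka \<mu> (Suc m) \<rho> = (\<Sum>\<kappa> | hstrip \<kappa> \<rho> \<and> psize \<rho> = psize \<kappa> + \<mu> m. kostka \<mu> m \<kappa>)"

definition content_chains :: "(nat \<Rightarrow> nat) \<Rightarrow> nat \<Rightarrow> (nat \<Rightarrow> nat) \<Rightarrow> (nat \<Rightarrow> nat \<Rightarrow> nat) set" where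
  "content_chains \<mu> m \<rho> =
     {\<tau>. strip_chain m \<tau> \<and> \<tau> m = \<rho> \<and> (\<forall>i<m. psize (\<tau> (Suc i)) = psize (\<tau> i) + \<mu> i)}"

lemma strip_chain_support:
  assumes "strip_chain m \<tau>" "i \<le> m" "k \<ge> i"
  shows "\<tau> i k = 0"
  using assms(2,3)
proof (induction i arbitrary: k)
  case 0
  then show ?case using assms(1) by (simp add: strip_chain_def)
next
  case (Suc i)
  then obtain k' where k: "k = Suc k'" "k' \<ge> i" by (cases k) auto
  have "hstrip (\<tau> i) (\<tau> (Suc i))" using assms(1) Suc by (simp add: strip_chain_def)
  then have "\<tau> (Suc i) k \<le> \<tau> i k'" by (simp add: hstrip_def k)
  then show ?case using Suc k by simp
qed

lemma finite_dominated:
  fixes \<rho> :: "nat \<Rightarrow> nat"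
  assumes "\<And>k. k \<ge> K \<Longrightarrow> \<rho> k = 0"
  shows "finite {\<kappa>. \<forall>k. \<kappa> k \<le> \<rho> k}"
proof -
  have "finite {\<kappa>. \<forall>k. (k \<in> {..<K} \<longrightarrow> \<kappa> k \<in> (\<Union>k<K. {..\<rho> k})) \<and> (k \<notin> {..<K} \<longrightarrow> \<kappa> k = 0)}"
    by (rule finite_set_of_finite_funs) auto
  then show ?thesis
  proof (rule rev_finite_subset, intro subsetI CollectI allI conjI impI)
    fix \<kappa> k assume *: "\<kappa> \<in> {\<kappa>. \<forall>k. \<kappa> k \<le> \<rho> k}"
    show "k \<in> {..<K} \<Longrightarrow> \<kappa> k \<in> (\<Union>k<K. {..\<rho> k})" using * by auto
    show "k \<notin> {..<K} \<Longrightarrow> \<kappa> k = 0" using * assms[of k] by (metis le_zero_eq lessThan_iff mem_Collect_eq not_le)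
  qed
qed

lemma finite_hstrips:
  assumes "\<And>k. k \<ge> K \<Longrightarrow> \<rho> k = 0"
  shows "finite {\<kappa>. hstrip \<kappa> \<rho> \<and> P \<kappa>}"
  by (rule finite_subset[OF _ finite_dominated[of K \<rho>, OF assms]]) (auto simp: hstrip_def)

lemma content_chains_Suc:
  "content_chains \<mu> (Suc m) \<rho> = (\<Union>\<kappa>\<in>{\<kappa>. hstrip \<kappa> \<rho> \<and> psize \<rho> = psize \<kappa> + \<mu> m}.
     (\<lambda>\<tau> i. if i \<le> m then \<tau> i else \<rho>) ` content_chains \<mu> m \<kappa>)" (is "?L = ?R")
proof (intro equalityI subsetI)
  fix \<tau> assume t: "\<tau> \<in> ?L"
  have *: "\<tau> 0 = (\<lambda>_. 0)" "\<And>i. i \<le> m \<Longrightarrow> hstrip (\<tau> i) (\<tau> (Suc i))" "\<And>i. Suc m \<le> i \<Longrightarrow> \<tau> i = \<tau> (Suc m)"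
    "\<tau> (Suc m) = \<rho>" "\<And>i. i \<le> m \<Longrightarrow> psize (\<tau> (Suc i)) = psize (\<tau> i) + \<mu> i"
    using t unfolding content_chains_def strip_chain_def by auto
  define \<tau>' where "\<tau>' i = \<tau> (min i m)" for i
  have "\<tau>' \<in> content_chains \<mu> m (\<tau> m)"
    using * by (auto simp: content_chains_def strip_chain_def \<tau>'_def min_def not_less_eq_eq)
  moreover have "\<tau> = (\<lambda>i. if i \<le> m then \<tau>' i else \<rho>)"
    using *(3,4) by (auto simp: fun_eq_iff \<tau>'_def min_def not_less_eq_eq)
  moreover have "hstrip (\<tau> m) \<rho>" "psize \<rho> = psize (\<tau> m) + \<mu> m" using *(2)[of m] *(4) *(5)[of m] by auto
  ultimately show "\<tau> \<in> ?R" by blast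
next
  fix \<tau> assume "\<tau> \<in> ?R"
  then obtain \<kappa> \<tau>' where *: "hstrip \<kappa> \<rho>" "psize \<rho> = psize \<kappa> + \<mu> m" "\<tau>' \<in> content_chains \<mu> m \<kappa>"
    "\<tau> = (\<lambda>i. if i \<le> m then \<tau>' i else \<rho>)" by blast
  then show "\<tau> \<in> ?L"
    by (auto simp: content_chains_def strip_chain_def less_Suc_eq_le le_less)
qed

lemma content_chains_inj:
  "inj_on (\<lambda>\<tau> i. if i \<le> m then \<tau> i else \<rho>) (content_chains \<mu> m \<kappa>)"
proof (rule inj_onI, rule ext)
  fix \<tau> \<tau>' i assume *: "\<tau> \<in> content_chains \<mu> m \<kappa>" "\<tau>' \<in> content_chains \<mu> m \<kappa>"
    and "(\<lambda>i. if i \<le> m then \<tau> i else \<rho>) = (\<lambda>i. if i \<le> m then \<tau>' i else \<rho>)"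
  then have "i \<le> m \<Longrightarrow> \<tau> i = \<tau>' i" by (metis (full_types))
  moreover have "i \<ge> m \<Longrightarrow> \<tau> i = \<tau>' i" using * unfolding content_chains_def strip_chain_def by auto
  ultimately show "\<tau> i = \<tau>' i" by linarith
qed

lemma content_chains_support:
  assumes "\<tau> \<in> content_chains \<mu> m \<rho>" "k \<ge> m"
  shows "\<rho> k = 0"
  using assms strip_chain_support[of m \<tau> m k] by (auto simp: content_chains_def)

lemma card_content_chains:
  assumes "\<And>k. k \<ge> K \<Longrightarrow> \<rho> k = 0"
  shows "finite (content_chains \<mu> m \<rho>) \<and> card (content_chains \<mu> m \<rho>) = kostka \<mu> m \<rho>"
  using assms
proof (induction m arbitrary: \<rho>)
  case 0
  have "content_chains \<mu> 0 \<rho> = (if \<rho> = (\<lambda>_. 0) then {\<lambda>_ _. 0} else {})"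
    by (auto simp: content_chains_def strip_chain_def fun_eq_iff)
  then show ?case by simp
next
  case (Suc m)
  let ?S = "{\<kappa>. hstrip \<kappa> \<rho> \<and> psize \<rho> = psize \<kappa> + \<mu> m}"
  let ?f = "\<lambda>\<tau> i. if i \<le> m then \<tau> i else \<rho>"
  have fin: "finite ?S" using Suc.prems by (rule finite_hstrips)
  have IH: "finite (content_chains \<mu> m \<kappa>) \<and> card (content_chains \<mu> m \<kappa>) = kostka \<mu> m \<kappa>" if "\<kappa> \<in> ?S" for \<kappa>
  proof (rule Suc.IH)
    fix k assume "K \<le> k"
    then show "\<kappa> k = 0" using that Suc.prems[of k] by (auto simp: hstrip_def) (metis le_zero_eq)
  qed
  have disj: "?f ` content_chains \<mu> m \<kappa> \<inter> ?f ` content_chains \<mu> m \<kappa>' = {}" if "\<kappa> \<noteq> \<kappa>'" for \<kappa> \<kappa>'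
  proof -
    have "h m = \<kappa>''" if "h \<in> ?f ` content_chains \<mu> m \<kappa>''" for h \<kappa>''
      using that by (auto simp: content_chains_def)
    then show ?thesis using that by blast
  qed
  have "card (content_chains \<mu> (Suc m) \<rho>) = (\<Sum>\<kappa>\<in>?S. card (?f ` content_chains \<mu> m \<kappa>))"
    unfolding content_chains_Suc using fin IH disj by (intro card_UN_disjoint) auto
  also have "\<dots> = (\<Sum>\<kappa>\<in>?S. kostka \<mu> m \<kappa>)"
    using IH content_chains_inj by (intro sum.cong) (auto simp: card_image)
  finally show ?case using fin IH by (auto simp: content_chains_Suc)
qed

text \<open>Sizes grow by the row sums along the right border and by the column sums along the
  bottom border, so the contents of the two tableaux are the margins of \<open>A\<close>.\<close>

lemma rsk_content:
  "fst (rsk m n A) \<in> content_chains \<mu> m (growth A m n) \<longleftrightarrow> (\<forall>i<m. (\<Sum>j<n. A i j) = \<mu> i)"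
  "snd (rsk m n A) \<in> content_chains \<nu> n (growth A m n) \<longleftrightarrow> (\<forall>j<n. (\<Sum>i<m. A i j) = \<nu> j)"
  using rsk_chains[where m = m and n = n and A = A] psize_growth_row[of A _ n] psize_growth_col[of A m]
  by (auto simp: content_chains_def rsk_def min_def not_less_eq_eq simp del: growth.simps)

text \<open>\<open>P\<close> is the condition on the common shape of the two tableaux.
  \<open>R\<close> is a finite set of shapes with \<open>P\<close> that contains all those occurring
  for content \<open>\<mu>\<close>. Grouping the pairs of tableaux by shape gives the sum of
  products.\<close>

lemma card_matrices_shape:
  assumes fin: "finite R" and RP: "\<And>\<rho>. \<rho> \<in> R \<Longrightarrow> P \<rho>"
    and R: "\<And>\<rho>. P \<rho> \<Longrightarrow> kostka \<mu> m \<rho> \<noteq> 0 \<Longrightarrow> \<forall>k\<ge>m. \<rho> k = 0 \<Longrightarrow> \<rho> \<in> R"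
    and supp: "\<And>\<rho> k. \<rho> \<in> R \<Longrightarrow> k \<ge> K \<Longrightarrow> \<rho> k = 0"
  shows "card {A \<in> nat_matrices m n. (\<forall>i<m. (\<Sum>j<n. A i j) = \<mu> i) \<and> (\<forall>j<n. (\<Sum>i<m. A i j) = \<nu> j) \<and>
      P (growth A m n)} = (\<Sum>\<rho>\<in>R. kostka \<mu> m \<rho> * kostka \<nu> n \<rho>)" (is "card ?M = _")
proof -
  let ?C = "\<lambda>\<rho>. content_chains \<mu> m \<rho> \<times> content_chains \<nu> n \<rho>"
  have c: "finite (?C \<rho>) \<and> card (?C \<rho>) = kostka \<mu> m \<rho> * kostka \<nu> n \<rho>" if "\<rho> \<in> R" for \<rho>
    using card_content_chains[of K \<rho>, OF supp[OF that]] by (simp add: card_cartesian_product)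
  have mem: "\<tau> m = \<rho>" if "\<tau> \<in> content_chains \<mu> m \<rho>" for \<tau> \<mu> m \<rho> using that by (simp add: content_chains_def)
  have corner: "fst (rsk m n A) m = growth A m n" for A by (simp add: rsk_def)
  have "(\<Union>\<rho>\<in>R. ?C \<rho>) = rsk m n ` ?M"
  proof (intro equalityI subsetI)
    fix x assume "x \<in> rsk m n ` ?M"
    then obtain A where A: "x = rsk m n A" "A \<in> ?M" by blast
    let ?g = "growth A m n"
    have x: "fst x \<in> content_chains \<mu> m ?g" "snd x \<in> content_chains \<nu> n ?g" using A rsk_content by auto
    have s: "\<forall>k\<ge>m. ?g k = 0" using x(1) content_chains_support by blast
    then have "kostka \<mu> m ?g \<noteq> 0" using card_content_chains[of m ?g \<mu> m] x(1) by (metis card_0_eq empty_iff)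
    then have "?g \<in> R" using A s by (intro R) auto
    then show "x \<in> (\<Union>\<rho>\<in>R. ?C \<rho>)" using x by (cases x) auto
  next
    fix x assume "x \<in> (\<Union>\<rho>\<in>R. ?C \<rho>)"
    then obtain \<rho> \<tau> \<sigma> where x: "x = (\<tau>, \<sigma>)" "\<rho> \<in> R" "\<tau> \<in> content_chains \<mu> m \<rho>" "\<sigma> \<in> content_chains \<nu> n \<rho>"
      by auto
    then have "(\<tau>, \<sigma>) \<in> rsk m n ` nat_matrices m n"
      by (intro rsk_surj) (auto simp: content_chains_def)
    then obtain A where A: "A \<in> nat_matrices m n" "rsk m n A = (\<tau>, \<sigma>)" by force
    then have "growth A m n = \<rho>" using corner[of A] mem[OF x(3)] by simp
    then have "A \<in> ?M" using A x rsk_content[of m n A] RP by auto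
    then show "x \<in> rsk m n ` ?M" using A x by force
  qed
  moreover have "inj_on (rsk m n) ?M" by (rule inj_on_subset[OF rsk_inj]) (rule Collect_restrict)
  ultimately have "card ?M = card (\<Union>\<rho>\<in>R. ?C \<rho>)" by (simp add: card_image[symmetric])
  also have "\<dots> = (\<Sum>\<rho>\<in>R. card (?C \<rho>))"
    using fin c by (intro card_UN_disjoint) (auto dest: mem)
  finally show ?thesis using c by simp
qed


subsection \<open>First part and number of parts of the shape\<close>

lemma sorted_position:
  assumes "successively (\<lambda>(i, j) (i', j'). i \<le> i' \<and> j \<le> j') (ps @ [(i', j')])"
    and "(i, j) \<in> set ps"
  shows "i \<le> (i'::nat) \<and> j \<le> (j'::nat)"
proof -
  have "transp (\<lambda>(i, j) (i', j'). i \<le> (i'::nat) \<and> j \<le> (j'::nat))"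
    by (rule transpI) auto
  then have "sorted_wrt (\<lambda>(i, j) (i', j'). i \<le> i' \<and> j \<le> j') (ps @ [(i', j')])"
    using assms(1) successively_conv_sorted_wrt by blast
  then show ?thesis using assms(2) by (auto simp: sorted_wrt_append)
qed

lemma growth_first:
  "growth A (Suc i) (Suc j) 0 = max (growth A i (Suc j) 0) (growth A (Suc i) j 0) + A i j"
  by (simp add: rsk_step_def)

lemma growth_mono: "i \<le> i' \<Longrightarrow> j \<le> j' \<Longrightarrow> growth A i j k \<le> growth A i' j' k"
proof -
  assume "i \<le> i'" "j \<le> j'"
  have "growth A i j k \<le> growth A i' j k"
    by (rule lift_Suc_mono_le[OF _ \<open>i \<le> i'\<close>]) (use hstrip_growth(1) in \<open>auto simp: hstrip_def\<close>)
  also have "\<dots> \<le> growth A i' j' k"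
    by (rule lift_Suc_mono_le[OF _ \<open>j \<le> j'\<close>]) (use hstrip_growth(2) in \<open>auto simp: hstrip_def\<close>)
  finally show ?thesis .
qed

text \<open>The first part obeys the recursion of last passage percolation. Deleting the last
  position \<open>(i, j)\<close> of a chain leaves a chain that avoids row \<open>i\<close> or
  column \<open>j\<close>, because its own last position is weakly northwest of
  \<open>(i, j)\<close> and different from it.\<close>

lemma SE_chain_le_growth: "SE_chain m n ps \<Longrightarrow> SE_length A ps \<le> growth A m n 0"
proof (induction ps arbitrary: m n rule: rev_induct)
  case Nil
  then show ?case by (simp add: SE_length_def)
next
  case (snoc p qs)
  obtain i j where p: "p = (i, j)" by force
  have ij: "i < m" "j < n" using snoc.prems by (auto simp: SE_chain_def p)
  have qs: "successively (\<lambda>(i, j) (i', j'). i \<le> i' \<and> j \<le> j') qs" "distinct qs" "(i, j) \<notin> set qs"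
    using snoc.prems by (auto simp: SE_chain_def p successively_append_iff)
  have le: "x \<le> i \<and> y \<le> j" if "(x, y) \<in> set qs" for x y
    using sorted_position[of qs i j x y] that snoc.prems by (auto simp: SE_chain_def p)
  have "SE_chain i (Suc j) qs \<or> SE_chain (Suc i) j qs"
  proof (cases qs rule: rev_cases)
    case Nil
    then show ?thesis by (simp add: SE_chain_def)
  next
    case (snoc rs q)
    obtain i' j' where q: "q = (i', j')" by force
    have le': "x \<le> i' \<and> y \<le> j'" if "(x, y) \<in> set qs" for x y
      using sorted_position[of rs i' j' x y] that qs by (auto simp: snoc q)
    have "i' < i \<or> j' < j" using le[of i' j'] qs(3) snoc q by fastforce
    then show ?thesis using le le' qs by (fastforce simp: SE_chain_def)
  qed
  then have "SE_length A qs \<le> max (growth A i (Suc j) 0) (growth A (Suc i) j 0)"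
    using snoc.IH le_max_iff_disj by blast
  then have "SE_length A (qs @ [p]) \<le> growth A (Suc i) (Suc j) 0"
    unfolding growth_first by (simp add: SE_length_def p)
  also have "\<dots> \<le> growth A m n 0" using ij by (intro growth_mono) auto
  finally show ?case .
qed

lemma SE_chain_attained: "\<exists>ps. SE_chain m n ps \<and> SE_length A ps = growth A m n 0"
proof (induction m arbitrary: n)
  case 0
  show ?case by (rule exI[of _ "[]"]) (simp add: SE_chain_def SE_length_def)
next
  case (Suc m)
  note outer = this
  show ?case
  proof (induction n)
    case 0
    show ?case by (rule exI[of _ "[]"]) (simp add: SE_chain_def SE_length_def)
  next
    case (Suc n)
    obtain ps where ps: "SE_chain m (Suc n) ps \<or> SE_chain (Suc m) n ps"
      "SE_length A ps = max (growth A m (Suc n) 0) (growth A (Suc m) n 0)"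
      using outer[of "Suc n"] Suc by (metis max_def)
    then have sub: "set ps \<subseteq> {..<Suc m} \<times> {..<Suc n}" "(m, n) \<notin> set ps"
      by (fastforce simp: SE_chain_def)+
    have "SE_chain (Suc m) (Suc n) (ps @ [(m, n)])"
    proof -
      have "successively (\<lambda>(i, j) (i', j'). i \<le> i' \<and> j \<le> j') ps" "distinct ps"
        using ps by (auto simp: SE_chain_def)
      moreover have "fst (last ps) \<le> m \<and> snd (last ps) \<le> n" if "ps \<noteq> []"
        using sub(1) last_in_set[OF that] by (force simp: less_Suc_eq_le)
      ultimately show ?thesis using sub by (auto simp: SE_chain_def successively_append_iff split: prod.splits)
    qed
    moreover have "SE_length A (ps @ [(m, n)]) = growth A (Suc m) (Suc n) 0"
      unfolding growth_first using ps(2) by (simp add: SE_length_def)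
    ultimately show ?case by blast
  qed
qed

lemma longest_SE_eq: "longest_SE m n A = growth A m n 0"
  unfolding longest_SE_def
proof (rule Max_eqI)
  have "finite {ps. set ps \<subseteq> {..<m} \<times> {..<n} \<and> distinct ps}" by (rule finite_subset_distinct) simp
  then have "finite {ps. SE_chain m n ps}" by (rule rev_finite_subset) (auto simp: SE_chain_def)
  then show "finite (SE_length A ` {ps. SE_chain m n ps})" by simp
  show "growth A m n 0 \<in> SE_length A ` {ps. SE_chain m n ps}" using SE_chain_attained[of m n A] by force
qed (use SE_chain_le_growth in auto)

text \<open>Viennot's shadows: the first row of the growth diagram of \<open>shadow A\<close> is the second row of that of \<open>A\<close>,
  and passing to the shadow shortens the longest ne-chain by exactly one, since between two consecutive
  entries of an ne-chain there is a shadow entry and vice versa.\<close>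

definition shadow :: "(nat \<Rightarrow> nat \<Rightarrow> nat) \<Rightarrow> nat \<Rightarrow> nat \<Rightarrow> nat" where
  "shadow A i j = min (growth A i (Suc j) 0) (growth A (Suc i) j 0) - growth A i j 0"

text \<open>On the parts after the first, the local rule is the local rule again, with index shifted
  by one and with \<open>min (\<mu> 0) (\<nu> 0) - \<kappa> 0\<close> in the place of the entry.
  This number is the value of \<open>shadow A\<close>.\<close>

lemma growth_shadow: "growth A i j (Suc k) = growth (shadow A) i j k"
proof (induction i arbitrary: j k)
  case 0
  then show ?case by simp
next
  case (Suc i)
  note outer = this
  show ?case
  proof (induction j arbitrary: k)
    case 0
    then show ?case by simp
  next
    case (Suc j)
    then show ?case using outer by (cases k) (simp_all add: rsk_step_def shadow_def)
  qed
qed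

lemma growth_first_mono:
  "growth A i j 0 \<le> growth A (Suc i) j 0" "growth A i j 0 \<le> growth A i (Suc j) 0"
  by (simp_all add: growth_mono del: growth.simps)

lemma shadow_0_iff: "shadow A i j = 0 \<longleftrightarrow>
    growth A (Suc i) j 0 = growth A i j 0 \<or> growth A i (Suc j) 0 = growth A i j 0"
  using growth_first_mono[of A i j] by (auto simp: shadow_def min_def simp del: growth.simps)

text \<open>An increase of the first part from \<open>i\<close> to \<open>Suc i\<close> is a shadow
  line running along row \<open>i\<close>. It continues to the right until it meets a line running
  down a column; the cells where two lines meet are those with a nonzero entry of
  \<open>shadow A\<close>.\<close>

lemma vertical_propagate:
  assumes "growth A i j 0 < growth A (Suc i) j 0" "j \<le> j'" "\<And>k. j \<le> k \<Longrightarrow> k < j' \<Longrightarrow> shadow A i k = 0"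
  shows "growth A i j' 0 < growth A (Suc i) j' 0"
  using assms(2,3)
proof (induction j' rule: dec_induct)
  case (step k)
  then have "growth A i k 0 < growth A (Suc i) k 0" "shadow A i k = 0" by auto
  then have "growth A i (Suc k) 0 = growth A i k 0" using shadow_0_iff[of A i k] by (auto simp del: growth.simps)
  then show ?case using \<open>growth A i k 0 < growth A (Suc i) k 0\<close> unfolding growth_first by simp
qed (use assms(1) in simp)

lemma horizontal_propagate:
  assumes "growth A i j 0 < growth A i (Suc j) 0" "i \<le> i'" "\<And>k. i \<le> k \<Longrightarrow> k < i' \<Longrightarrow> shadow A k j = 0"
  shows "growth A i' j 0 < growth A i' (Suc j) 0"
  using assms(2,3)
proof (induction i' rule: dec_induct)
  case (step k)
  then have "growth A k j 0 < growth A k (Suc j) 0" "shadow A k j = 0" by auto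
  then have "growth A (Suc k) j 0 = growth A k j 0" using shadow_0_iff[of A k j] by (auto simp del: growth.simps)
  then show ?case using \<open>growth A k j 0 < growth A k (Suc j) 0\<close> unfolding growth_first by simp
qed (use assms(1) in simp)

text \<open>The lower left entry starts a line to the right along row \<open>i\<close>, the upper
  right entry one down column \<open>j'\<close>. Unless one of them hits a shadow entry before, both
  reach the cell \<open>(i, j')\<close> and create one there.\<close>

lemma shadow_between:
  assumes "A i j \<noteq> 0" "A i' j' \<noteq> 0" "i' < i" "j < j'"
  shows "\<exists>x y. i' < x \<and> x \<le> i \<and> j < y \<and> y \<le> j' \<and> shadow A x y \<noteq> 0"
proof (rule ccontr)
  assume "\<not> ?thesis"
  then have none: "shadow A x y = 0" if "i' < x" "x \<le> i" "j < y" "y \<le> j'" for x y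
    using that by blast
  have "growth A i (Suc j) 0 < growth A (Suc i) (Suc j) 0" unfolding growth_first using assms(1) by simp
  then have v: "growth A i j' 0 < growth A (Suc i) j' 0"
    by (rule vertical_propagate) (use assms none in auto)
  have "growth A (Suc i') j' 0 < growth A (Suc i') (Suc j') 0" unfolding growth_first using assms(2) by simp
  then have h: "growth A i j' 0 < growth A i (Suc j') 0"
    by (rule horizontal_propagate) (use assms none in auto)
  have "shadow A i j' \<noteq> 0" using v h by (simp add: shadow_0_iff del: growth.simps)
  then show False using none[of i j'] assms by simp
qed

text \<open>Followed to the left, a line can only begin at a nonzero entry. Since the left edge of
  the diagram carries zero partitions, each line does begin somewhere.\<close>

lemma vertical_back:
  assumes "growth A i j' 0 < growth A (Suc i) j' 0" "j \<le> j'" "\<And>k. j \<le> k \<Longrightarrow> k < j' \<Longrightarrow> A i k = 0"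
  shows "growth A i j 0 < growth A (Suc i) j 0"
  using assms(2,1,3)
proof (induction j rule: inc_induct)
  case (step k)
  then have *: "growth A i (Suc k) 0 < growth A (Suc i) (Suc k) 0" "A i k = 0" by auto
  then show ?case using growth_first_mono(2)[of A i k] unfolding growth_first by (simp del: growth.simps)
qed simp

lemma horizontal_back:
  assumes "growth A i' j 0 < growth A i' (Suc j) 0" "i \<le> i'" "\<And>k. i \<le> k \<Longrightarrow> k < i' \<Longrightarrow> A k j = 0"
  shows "growth A i j 0 < growth A i (Suc j) 0"
  using assms(2,1,3)
proof (induction i rule: inc_induct)
  case (step k)
  then have *: "growth A (Suc k) j 0 < growth A (Suc k) (Suc j) 0" "A k j = 0" by auto
  then show ?case using growth_first_mono(1)[of A k j] unfolding growth_first by (simp del: growth.simps)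
qed simp

lemma shadow_nz:
  assumes "shadow A i j \<noteq> 0"
  shows "growth A i j 0 < growth A (Suc i) j 0" "growth A i j 0 < growth A i (Suc j) 0"
  using assms growth_first_mono[of A i j] by (auto simp: shadow_0_iff le_less simp del: growth.simps)

lemma entry_left_of_shadow: "shadow A i j \<noteq> 0 \<Longrightarrow> \<exists>y<j. A i y \<noteq> 0"
  using vertical_back[of A i j 0, OF shadow_nz(1)] by (metis growth_0_right le0 less_irrefl)

lemma entry_above_shadow: "shadow A i j \<noteq> 0 \<Longrightarrow> \<exists>x<i. A x j \<noteq> 0"
  using horizontal_back[of A i j 0, OF shadow_nz(2)] by (metis growth.simps(1) le0 less_irrefl)

text \<open>If the rectangle had no entry, the lines through the two shadow entries would extend
  backwards to the cell \<open>(i', j)\<close>. There the first part at the last corner would exceed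
  both of its neighbours, which only a nonzero entry of that cell can cause.\<close>

lemma entry_between:
  assumes "shadow A i j \<noteq> 0" "shadow A i' j' \<noteq> 0" "i' < i" "j < j'"
  shows "\<exists>x y. i' \<le> x \<and> x < i \<and> j \<le> y \<and> y < j' \<and> A x y \<noteq> 0"
proof (rule ccontr)
  assume "\<not> ?thesis"
  then have none: "A x y = 0" if "i' \<le> x" "x < i" "j \<le> y" "y < j'" for x y
    using that by blast
  have "growth A (Suc i') j 0 < growth A (Suc i') (Suc j) 0"
    using shadow_nz(2)[OF assms(1)] by (rule horizontal_back) (use assms none in auto)
  moreover have "growth A i' (Suc j) 0 < growth A (Suc i') (Suc j) 0"
    using shadow_nz(1)[OF assms(2)] by (rule vertical_back) (use assms none in auto)
  ultimately show False using none[of i' j] assms unfolding growth_first by simp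
qed

lemma ne_chain_Cons:
  "ne_chain m n A ((i, j) # ps) \<longleftrightarrow> i < m \<and> j < n \<and> A i j \<noteq> 0 \<and> ne_chain m n A ps \<and>
     (ps \<noteq> [] \<longrightarrow> fst (hd ps) < i \<and> j < snd (hd ps))"
  by (cases ps) (auto simp: ne_chain_def)

text \<open>One shadow entry is placed between each two consecutive entries. The position bound on
  the head of the new chain is what allows the next shadow entry to be prepended.\<close>

lemma ne_chain_shadow:
  "ne_chain m n A ((i, j) # ps) \<Longrightarrow> \<exists>qs. ne_chain m n (shadow A) qs \<and> length qs = length ps \<and>
     (qs \<noteq> [] \<longrightarrow> fst (hd qs) \<le> i \<and> j < snd (hd qs))"
proof (induction ps arbitrary: i j)
  case Nil
  then show ?case by (intro exI[of _ "[]"]) (simp add: ne_chain_def)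
next
  case (Cons p ps)
  obtain i' j' where p: "p = (i', j')" by force
  have *: "i < m" "i' < i" "j < j'" "A i j \<noteq> 0" "ne_chain m n A ((i', j') # ps)" "j' < n" "A i' j' \<noteq> 0"
    using Cons.prems by (auto simp: p ne_chain_Cons)
  obtain qs where qs: "ne_chain m n (shadow A) qs" "length qs = length ps"
    "qs \<noteq> [] \<longrightarrow> fst (hd qs) \<le> i' \<and> j' < snd (hd qs)" using Cons.IH[OF *(5)] by blast
  obtain x y where xy: "i' < x" "x \<le> i" "j < y" "y \<le> j'" "shadow A x y \<noteq> 0"
    using shadow_between[OF *(4,7,2,3)] by blast
  show ?case using * qs xy by (intro exI[of _ "(x, y) # qs"]) (auto simp: ne_chain_Cons)
qed

lemma shadow_ne_chain_aux:
  "ne_chain m n (shadow A) ((i, j) # ps) \<Longrightarrow> \<exists>q qs. ne_chain m n A (q # qs) \<and> length qs = length ps \<and>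
     fst q < i \<and> j \<le> snd q"
proof (induction ps arbitrary: i j)
  case Nil
  then have *: "i < m" "j < n" "shadow A i j \<noteq> 0" by (auto simp: ne_chain_Cons)
  obtain x where "x < i" "A x j \<noteq> 0" using entry_above_shadow[OF *(3)] by blast
  then show ?case using * by (intro exI[of _ "(x, j)"] exI[of _ "[]"]) (auto simp: ne_chain_def)
next
  case (Cons p ps)
  obtain i' j' where p: "p = (i', j')" by force
  have *: "i < m" "i' < i" "j < j'" "shadow A i j \<noteq> 0" "ne_chain m n (shadow A) ((i', j') # ps)" "j' < n" "shadow A i' j' \<noteq> 0"
    using Cons.prems by (auto simp: p ne_chain_Cons)
  obtain q qs where qs: "ne_chain m n A (q # qs)" "length qs = length ps" "fst q < i'" "j' \<le> snd q"
    using Cons.IH[OF *(5)] by blast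
  obtain x y where xy: "i' \<le> x" "x < i" "j \<le> y" "y < j'" "A x y \<noteq> 0"
    using entry_between[OF *(4,7,2,3)] by blast
  show ?case using * qs xy by (intro exI[of _ "(x, y)"] exI[of _ "q # qs"]) (auto simp: ne_chain_Cons)
qed

text \<open>The auxiliary lemma yields as many entries as there are shadow entries, all above the
  row of the first one. The additional entry lies in that row, to the left of the first shadow
  entry.\<close>

lemma shadow_ne_chain:
  assumes "ne_chain m n (shadow A) qs" "qs \<noteq> []"
  shows "\<exists>ps. ne_chain m n A ps \<and> length ps = Suc (length qs)"
proof -
  obtain i j qs' where q: "qs = (i, j) # qs'" using assms(2) by (metis list.exhaust surj_pair)
  then have *: "i < m" "j < n" "shadow A i j \<noteq> 0" using assms by (auto simp: ne_chain_Cons)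
  obtain r rs where r: "ne_chain m n A (r # rs)" "length rs = length qs'" "fst r < i" "j \<le> snd r"
    using shadow_ne_chain_aux assms(1) unfolding q by blast
  obtain y where "y < j" "A i y \<noteq> 0" using entry_left_of_shadow[OF *(3)] by blast
  then show ?thesis using * q r by (intro exI[of _ "(i, y) # r # rs"]) (auto simp: ne_chain_Cons)
qed

lemma growth_eq_0_iff: "growth A m n 0 = 0 \<longleftrightarrow> (\<forall>i<m. \<forall>j<n. A i j = 0)"
proof
  assume 0: "growth A m n 0 = 0"
  show "\<forall>i<m. \<forall>j<n. A i j = 0"
  proof (intro allI impI)
    fix i j assume "i < m" "j < n"
    then have "growth A (Suc i) (Suc j) 0 \<le> growth A m n 0" by (intro growth_mono) auto
    then show "A i j = 0" unfolding 0 growth_first by simp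
  qed
next
  assume "\<forall>i<m. \<forall>j<n. A i j = 0"
  then have "SE_length A ps = 0" if "SE_chain m n ps" for ps
    using that by (auto simp: SE_chain_def SE_length_def sum_list_eq_0_iff)
  then show "growth A m n 0 = 0" using SE_chain_attained[of m n A] by metis
qed

text \<open>Passing to the shadow removes the first part of the shape and one entry from a longest
  nonempty chain, so induction on the bound \<open>N\<close> counts the parts.\<close>

lemma ne_chain_length_iff:
  "(\<forall>ps. ne_chain m n A ps \<longrightarrow> length ps \<le> N) \<longleftrightarrow> growth A m n N = 0"
proof (induction N arbitrary: A)
  case 0
  have "(\<forall>ps. ne_chain m n A ps \<longrightarrow> length ps \<le> 0) \<longleftrightarrow> (\<forall>i<m. \<forall>j<n. A i j = 0)"
  proof
    assume L: "\<forall>ps. ne_chain m n A ps \<longrightarrow> length ps \<le> 0"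
    show "\<forall>i<m. \<forall>j<n. A i j = 0"
    proof (intro allI impI, rule ccontr)
      fix i j assume "i < m" "j < n" "A i j \<noteq> 0"
      then have "ne_chain m n A [(i, j)]" by (simp add: ne_chain_def)
      then show False using L by fastforce
    qed
  next
    assume R: "\<forall>i<m. \<forall>j<n. A i j = 0"
    show "\<forall>ps. ne_chain m n A ps \<longrightarrow> length ps \<le> 0"
    proof (intro allI impI)
      fix ps assume "ne_chain m n A ps"
      then show "length ps \<le> 0" using R by (cases ps) (auto simp: ne_chain_def)
    qed
  qed
  then show ?case by (simp add: growth_eq_0_iff)
next
  case (Suc N)
  have "(\<forall>ps. ne_chain m n A ps \<longrightarrow> length ps \<le> Suc N) \<longleftrightarrow> (\<forall>ps. ne_chain m n (shadow A) ps \<longrightarrow> length ps \<le> N)"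
  proof
    assume L: "\<forall>ps. ne_chain m n A ps \<longrightarrow> length ps \<le> Suc N"
    show "\<forall>ps. ne_chain m n (shadow A) ps \<longrightarrow> length ps \<le> N"
    proof (intro allI impI)
      fix qs assume "ne_chain m n (shadow A) qs"
      then show "length qs \<le> N" using L shadow_ne_chain[of m n A qs] by (cases "qs = []") auto
    qed
  next
    assume R: "\<forall>ps. ne_chain m n (shadow A) ps \<longrightarrow> length ps \<le> N"
    show "\<forall>ps. ne_chain m n A ps \<longrightarrow> length ps \<le> Suc N"
    proof (intro allI impI)
      fix ps assume c: "ne_chain m n A ps"
      show "length ps \<le> Suc N"
      proof (cases ps)
        case (Cons p ps')
        then show ?thesis using ne_chain_shadow[of m n A "fst p" "snd p" ps'] c R by auto
      qed simp
    qed
  qed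
  then show ?case using Suc[of "shadow A"] by (simp add: growth_shadow)
qed

lemma ne_chain_distinct: "ne_chain m n A ps \<Longrightarrow> distinct ps"
proof -
  assume "ne_chain m n A ps"
  then have s: "successively (\<lambda>(i, j) (i', j'). i' < i \<and> j < j') ps" by (simp add: ne_chain_def)
  have "transp (\<lambda>(i, j) (i', j'). i' < (i::nat) \<and> j < (j'::nat))" by (rule transpI) auto
  then have "sorted_wrt (\<lambda>(i, j) (i', j'). i' < i \<and> j < j') ps" using s successively_conv_sorted_wrt by blast
  then have "sorted_wrt (\<noteq>) ps" by (rule sorted_wrt_mono_rel[rotated]) auto
  then show ?thesis by (induction ps) auto
qed

lemma longest_ne_le_iff: "longest_ne m n A \<le> N \<longleftrightarrow> growth A m n N = 0"
proof -
  have "finite {ps. set ps \<subseteq> {..<m} \<times> {..<n} \<and> distinct ps}" by (rule finite_subset_distinct) simp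
  moreover have "{ps. ne_chain m n A ps} \<subseteq> {ps. set ps \<subseteq> {..<m} \<times> {..<n} \<and> distinct ps}"
    using ne_chain_distinct unfolding ne_chain_def by blast
  ultimately have "finite {ps. ne_chain m n A ps}" by (rule rev_finite_subset)
  moreover have "ne_chain m n A []" by (simp add: ne_chain_def)
  ultimately show ?thesis unfolding longest_ne_def ne_chain_length_iff[symmetric] by (subst Max_le_iff) auto
qed

subsection \<open>Partitions and transposition\<close>

definition parts_of :: "nat \<Rightarrow> (nat \<Rightarrow> nat) set" where
  "parts_of s = {\<rho>. antimono \<rho> \<and> finite {k. \<rho> k \<noteq> 0} \<and> psize \<rho> = s}"

lemma parts_of_pos:
  assumes "\<rho> \<in> parts_of s" "\<rho> k \<noteq> 0" shows "k < s"
proof -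
  have "\<rho> i \<ge> 1" if "i \<le> k" for i
    using assms antimonoD[of \<rho> i k] that by (auto simp: parts_of_def)
  then have "(\<Sum>i\<le>k. 1) \<le> (\<Sum>i\<le>k. \<rho> i)" by (intro sum_mono) auto
  also have "\<dots> \<le> psize \<rho>" unfolding psize_def
    using assms \<open>\<And>i. i \<le> k \<Longrightarrow> \<rho> i \<ge> 1\<close> by (intro sum_mono2) (fastforce simp: parts_of_def)+
  finally show ?thesis using assms by (simp add: parts_of_def)
qed

lemma parts_of_zero: "\<rho> \<in> parts_of s \<Longrightarrow> k \<ge> s \<Longrightarrow> \<rho> k = 0"
  using parts_of_pos[of \<rho> s k] by force

lemma parts_of_le: "\<rho> \<in> parts_of s \<Longrightarrow> \<rho> k \<le> s"
  unfolding parts_of_def psize_def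
  by (cases "\<rho> k = 0") (auto intro!: member_le_sum)

lemma finite_parts_of [simp]: "finite (parts_of s)"
proof -
  have "finite {\<kappa>. \<forall>k. \<kappa> k \<le> (if k < s then s else 0)}"
    by (rule finite_dominated[of s]) auto
  then show ?thesis
    by (rule rev_finite_subset) (use parts_of_le parts_of_zero in \<open>fastforce simp: not_less\<close>)
qed

text \<open>This is how the shapes in chains of horizontal strips come to be partitions:
  \<open>\<rho> (Suc k) \<le> \<kappa> k \<le> \<rho> k\<close>.\<close>

lemma antimono_hstrip: "hstrip \<kappa> \<rho> \<Longrightarrow> antimono \<rho>"
  unfolding antimono_iff_le_Suc hstrip_def using le_trans by blast

lemma antimono_hstrip_lower: "hstrip \<kappa> \<rho> \<Longrightarrow> antimono \<kappa>"
  unfolding antimono_iff_le_Suc hstrip_def using le_trans by blast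

lemma kostka_nz:
  assumes "kostka \<mu> m \<rho> \<noteq> 0" "\<forall>k\<ge>m. \<rho> k = 0"
  shows "\<rho> \<in> parts_of (\<Sum>i<m. \<mu> i)"
proof -
  have "{k. \<rho> k \<noteq> 0} \<subseteq> {..<m}" using assms(2) by (metis (mono_tags, lifting) lessThan_iff linorder_not_le mem_Collect_eq subsetI)
  then have "finite {k. \<rho> k \<noteq> 0}" by (rule finite_subset) simp
  moreover have "antimono \<rho> \<and> psize \<rho> = (\<Sum>i<m. \<mu> i)" using assms(1)
  proof (induction m arbitrary: \<rho>)
    case 0
    then show ?case by (auto split: if_splits simp: antimono_def)
  next
    case (Suc m)
    from Suc.prems have "(\<Sum>\<kappa> | hstrip \<kappa> \<rho> \<and> psize \<rho> = psize \<kappa> + \<mu> m. kostka \<mu> m \<kappa>) \<noteq> 0" by simp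
    then obtain \<kappa> where "hstrip \<kappa> \<rho>" "psize \<rho> = psize \<kappa> + \<mu> m" "kostka \<mu> m \<kappa> \<noteq> 0"
      by (rule sum.not_neutral_contains_not_neutral) blast
    then show ?case using Suc.IH[of \<kappa>] antimono_hstrip by auto
  qed
  ultimately show ?thesis by (simp add: parts_of_def)
qed

lemma card_matrices_ne:
  "card {A \<in> nat_matrices m n. (\<forall>i<m. (\<Sum>j<n. A i j) = \<mu> i) \<and> (\<forall>j<n. (\<Sum>i<m. A i j) = \<nu> j) \<and>
      longest_ne m n A \<le> N} =
   (\<Sum>\<rho>\<in>{\<rho> \<in> parts_of (\<Sum>i<m. \<mu> i). \<rho> N = 0}. kostka \<mu> m \<rho> * kostka \<nu> n \<rho>)"
  unfolding longest_ne_le_iff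
  by (rule card_matrices_shape[where K = "\<Sum>i<m. \<mu> i"])
    (auto intro: kostka_nz parts_of_zero)

lemma card_matrices_SE:
  "card {A \<in> nat_matrices m n. (\<forall>i<m. (\<Sum>j<n. A i j) = \<mu> i) \<and> (\<forall>j<n. (\<Sum>i<m. A i j) = \<nu> j) \<and>
      longest_SE m n A \<le> N} =
   (\<Sum>\<rho>\<in>{\<rho> \<in> parts_of (\<Sum>i<m. \<mu> i). \<rho> 0 \<le> N}. kostka \<mu> m \<rho> * kostka \<nu> n \<rho>)"
  unfolding longest_SE_eq
  by (rule card_matrices_shape[where K = "\<Sum>i<m. \<mu> i"])
    (auto intro: kostka_nz parts_of_zero)

definition transp_part :: "(nat \<Rightarrow> nat) \<Rightarrow> nat \<Rightarrow> nat" where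
  "transp_part \<rho> k = card {i. k < \<rho> i}"

text \<open>The rows longer than \<open>k\<close> form an initial segment, so their number decides
  membership. In terms of cells this is the reflection of the diagram in its diagonal, from which
  the later facts on conjugation are derived.\<close>

lemma transp_part_less:
  assumes "\<rho> \<in> parts_of s"
  shows "i < transp_part \<rho> k \<longleftrightarrow> k < \<rho> i"
proof -
  define S where "S = {i. k < \<rho> i}"
  have fin: "finite S" unfolding S_def
    by (rule finite_subset[of _ "{..<s}"]) (auto intro: parts_of_pos[OF assms])
  have down: "j \<in> S" if "i \<in> S" "j \<le> i" for i j
    using that assms antimonoD[of \<rho> j i] by (auto simp: S_def parts_of_def)
  have "S = {..<card S}"
  proof (cases "S = {}")
    case False
    then have "S = {..Max S}" using fin down[OF Max_in] by (auto intro: Max_ge)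
    then show ?thesis by (metis card_atMost lessThan_Suc_atMost)
  qed simp
  then show ?thesis unfolding transp_part_def S_def[symmetric] by (auto simp: S_def)
qed

lemma psize_card:
  assumes "finite {k. \<rho> k \<noteq> 0}"
  shows "psize \<rho> = card {(i, k). k < \<rho> i}"
proof -
  have "{(i, k). k < \<rho> i} = Sigma {k. \<rho> k \<noteq> 0} (\<lambda>i. {..<\<rho> i})" by auto
  then show ?thesis using assms by (simp add: psize_def)
qed

lemma transp_part_parts_of:
  assumes "\<rho> \<in> parts_of s" shows "transp_part \<rho> \<in> parts_of s"
proof -
  note less = transp_part_less[OF assms]
  have am: "antimono (transp_part \<rho>)"
  proof (rule antimonoI)
    fix x y :: nat assume "x \<le> y"
    show "transp_part \<rho> y \<le> transp_part \<rho> x"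
    proof (rule ccontr)
      assume "\<not> ?thesis"
      then have "y < \<rho> (transp_part \<rho> x)" using less[of "transp_part \<rho> x" y] by simp
      then have "transp_part \<rho> x < transp_part \<rho> x" using less[of "transp_part \<rho> x" x] \<open>x \<le> y\<close> by simp
      then show False by simp
    qed
  qed
  have "{k. transp_part \<rho> k \<noteq> 0} \<subseteq> {..<s}"
    using less[of 0] parts_of_le[OF assms, of 0] by (auto intro: less_le_trans)
  then have fin: "finite {k. transp_part \<rho> k \<noteq> 0}" by (rule finite_subset) simp
  have "{(i, k). k < transp_part \<rho> i} = prod.swap ` {(i, k). k < \<rho> i}" using less by force
  then have "psize (transp_part \<rho>) = psize \<rho>"
    using assms psize_card[OF fin] psize_card[of \<rho>] by (simp add: parts_of_def card_image)
  then show ?thesis using am fin assms by (simp add: parts_of_def)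
qed

lemma transp_part_idem:
  assumes "\<rho> \<in> parts_of s" shows "transp_part (transp_part \<rho>) = \<rho>"
proof
  fix i
  have "j < transp_part (transp_part \<rho>) i \<longleftrightarrow> j < \<rho> i" for j
    using transp_part_less[OF assms] transp_part_less[OF transp_part_parts_of[OF assms]] by simp
  then show "transp_part (transp_part \<rho>) i = \<rho> i" by (meson linorder_neqE_nat less_irrefl)
qed

text \<open>Unlike interlacing, this condition does not make \<open>\<kappa>\<close> decrease;
  \<open>vkostka\<close> therefore asks for \<open>antimono \<kappa>\<close> separately.\<close>

definition vstrip :: "(nat \<Rightarrow> nat) \<Rightarrow> (nat \<Rightarrow> nat) \<Rightarrow> bool" where
  "vstrip \<kappa> \<rho> \<longleftrightarrow> (\<forall>k. \<kappa> k \<le> \<rho> k \<and> \<rho> k \<le> Suc (\<kappa> k))"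

lemma vstrip_transp:
  assumes \<kappa>: "\<kappa> \<in> parts_of s" and \<rho>: "\<rho> \<in> parts_of t"
  shows "hstrip (transp_part \<kappa>) (transp_part \<rho>) \<longleftrightarrow> vstrip \<kappa> \<rho>"
proof -
  note less = transp_part_less[OF \<kappa>] transp_part_less[OF \<rho>]
  have le: "x \<le> y \<longleftrightarrow> (\<forall>i. i < x \<longrightarrow> i < y)" for x y :: nat by (metis less_irrefl not_less order_less_le_trans)
  have "(\<forall>k. transp_part \<kappa> k \<le> transp_part \<rho> k) \<longleftrightarrow> (\<forall>k. \<kappa> k \<le> \<rho> k)"
    unfolding le[of "transp_part _ _"] le[of "\<kappa> _"] less by blast
  moreover have "(\<forall>k. transp_part \<rho> (Suc k) \<le> transp_part \<kappa> k) \<longleftrightarrow> (\<forall>k. \<rho> k \<le> Suc (\<kappa> k))"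
  proof -
    have "\<rho> i \<le> Suc (\<kappa> i) \<longleftrightarrow> (\<forall>k. Suc k < \<rho> i \<longrightarrow> k < \<kappa> i)" for i
    proof
      assume "\<forall>k. Suc k < \<rho> i \<longrightarrow> k < \<kappa> i"
      then show "\<rho> i \<le> Suc (\<kappa> i)" by (cases "\<rho> i \<le> 1") (auto dest: spec[of _ "\<rho> i - 2"])
    qed auto
    then show ?thesis unfolding le[of "transp_part _ _"] less by blast
  qed
  ultimately show ?thesis unfolding hstrip_def vstrip_def by blast
qed

fun vkostka :: "(nat \<Rightarrow> nat) \<Rightarrow> nat \<Rightarrow> (nat \<Rightarrow> nat) \<Rightarrow> nat" where
  "vkostka \<mu> 0 \<rho> = (if \<rho> = (\<lambda>_. 0) then 1 else 0)"
| "vkostka \<mu> (Suc m) \<rho> =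
     (\<Sum>\<kappa> | vstrip \<kappa> \<rho> \<and> antimono \<kappa> \<and> psize \<rho> = psize \<kappa> + \<mu> m. vkostka \<mu> m \<kappa>)"

lemma parts_of_lower:
  assumes "\<rho> \<in> parts_of s" "\<And>k. \<kappa> k \<le> \<rho> k" "antimono \<kappa>"
  shows "\<kappa> \<in> parts_of (psize \<kappa>)"
proof -
  have "{k. \<kappa> k \<noteq> 0} \<subseteq> {k. \<rho> k \<noteq> 0}" using assms(2) by (metis (mono_tags, lifting) Collect_mono le_zero_eq)
  then show ?thesis using assms by (auto simp: parts_of_def intro: finite_subset)
qed

lemma kostka_transp: "\<rho> \<in> parts_of s \<Longrightarrow> kostka \<mu> m (transp_part \<rho>) = vkostka \<mu> m \<rho>"
proof (induction m arbitrary: \<rho> s)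
  case 0
  have "transp_part \<rho> = (\<lambda>_. 0) \<longleftrightarrow> \<rho> = (\<lambda>_. 0)"
    using transp_part_less[OF 0] by (metis ext less_nat_zero_code neq0_conv)
  then show ?case by simp
next
  case (Suc m)
  let ?H = "{\<kappa>. hstrip \<kappa> (transp_part \<rho>) \<and> psize (transp_part \<rho>) = psize \<kappa> + \<mu> m}"
  let ?V = "{\<kappa>. vstrip \<kappa> \<rho> \<and> antimono \<kappa> \<and> psize \<rho> = psize \<kappa> + \<mu> m}"
  note T = transp_part_parts_of[OF Suc.prems]
  have sz: "psize (transp_part \<rho>) = psize \<rho>" using T Suc.prems by (simp add: parts_of_def)
  have V: "\<kappa> \<in> parts_of (psize \<kappa>)" if "\<kappa> \<in> ?V" for \<kappa>
    using that by (intro parts_of_lower[OF Suc.prems]) (auto simp: vstrip_def)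
  have H: "\<kappa> \<in> parts_of (psize \<kappa>)" if "\<kappa> \<in> ?H" for \<kappa>
    using that by (intro parts_of_lower[OF T]) (auto simp: hstrip_def intro: antimono_hstrip_lower)
  have psz: "psize (transp_part \<kappa>) = psize \<kappa>" if "\<kappa> \<in> parts_of (psize \<kappa>)" for \<kappa>
    using transp_part_parts_of[OF that] by (simp add: parts_of_def)
  have 1: "transp_part \<kappa> \<in> ?H" if "\<kappa> \<in> ?V" for \<kappa>
    using that V[OF that] vstrip_transp[OF V[OF that] Suc.prems] psz[OF V[OF that]] sz by simp
  have 2: "transp_part \<kappa> \<in> ?V" if "\<kappa> \<in> ?H" for \<kappa>
    using that vstrip_transp[OF transp_part_parts_of[OF H[OF that]] Suc.prems] psz[OF H[OF that]] sz
      transp_part_parts_of[OF H[OF that]] transp_part_idem[OF H[OF that]] by (simp add: parts_of_def)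
  have "(\<Sum>\<kappa>\<in>?V. vkostka \<mu> m \<kappa>) = (\<Sum>\<kappa>\<in>?H. kostka \<mu> m \<kappa>)"
  proof (rule sum.reindex_bij_witness[where i = transp_part and j = transp_part])
    show "kostka \<mu> m (transp_part \<kappa>) = vkostka \<mu> m \<kappa>" if "\<kappa> \<in> ?V" for \<kappa>
      using Suc.IH[OF V[OF that]] .
  qed (use 1 2 H V transp_part_idem in blast)+
  then show ?case by simp
qed

text \<open>Reindexing by conjugate shapes brings the count into the form that the integral
  produces, with at most \<open>N\<close> parts and vertical strips.\<close>

lemma card_matrices_SE':
  "card {A \<in> nat_matrices m n. (\<forall>i<m. (\<Sum>j<n. A i j) = \<mu> i) \<and> (\<forall>j<n. (\<Sum>i<m. A i j) = \<nu> j) \<and>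
      longest_SE m n A \<le> N} =
   (\<Sum>\<rho>\<in>{\<rho> \<in> parts_of (\<Sum>i<m. \<mu> i). \<rho> N = 0}. vkostka \<mu> m \<rho> * vkostka \<nu> n \<rho>)"
proof -
  have key: "transp_part \<rho> N = 0 \<longleftrightarrow> \<rho> 0 \<le> N" if "\<rho> \<in> parts_of s" for \<rho> s
    using transp_part_less[OF that, of 0 N] by auto
  have k: "vkostka \<mu> m (transp_part \<rho>) = kostka \<mu> m \<rho>" if "\<rho> \<in> parts_of s" for \<rho> s \<mu> m
    using kostka_transp[OF transp_part_parts_of[OF that], of \<mu> m] transp_part_idem[OF that] by simp
  show ?thesis unfolding card_matrices_SE
  proof (rule sum.reindex_bij_witness[where i = transp_part and j = transp_part])
    fix \<rho> assume "\<rho> \<in> {\<rho> \<in> parts_of (\<Sum>i<m. \<mu> i). \<rho> N = 0}"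
    then show "transp_part \<rho> \<in> {\<rho> \<in> parts_of (\<Sum>i<m. \<mu> i). \<rho> 0 \<le> N}"
      using key[OF transp_part_parts_of, of \<rho>] by (auto simp: transp_part_idem transp_part_parts_of)
  qed (auto simp: transp_part_idem transp_part_parts_of key k)
qed

section \<open>Laurent polynomials\<close>

text \<open>Exponents are arbitrary functions, so that one type serves every number of variables;
  \<open>supp N\<close> later confines them to the first \<open>N\<close>. They form an additive
  group, so coefficients of a product can be found by subtracting exponents.\<close>

type_synonym laurent = "(nat \<Rightarrow> int) \<Rightarrow>\<^sub>0 complex"

abbreviation lcoeff :: "laurent \<Rightarrow> (nat \<Rightarrow> int) \<Rightarrow> complex" where
  "lcoeff \<equiv> Poly_Mapping.lookup"

abbreviation lkeys :: "laurent \<Rightarrow> (nat \<Rightarrow> int) set" where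
  "lkeys \<equiv> Poly_Mapping.keys"

lemma lookup_mult:
  fixes f g :: laurent
  shows "lcoeff (f * g) \<alpha> = (\<Sum>\<beta>\<in>lkeys f. lcoeff f \<beta> * lcoeff g (\<alpha> - \<beta>))"
proof -
  have fin: "finite {\<gamma>. lcoeff g \<gamma> \<noteq> 0 \<and> \<alpha> = \<beta> + \<gamma>}" for \<beta>
    by (rule finite_subset[of _ "lkeys g"]) (auto simp: in_keys_iff)
  have "lcoeff (f * g) \<alpha> = Sum_any (\<lambda>\<beta>. lcoeff f \<beta> * Sum_any (\<lambda>\<gamma>. lcoeff g \<gamma> when \<alpha> = \<beta> + \<gamma>))"
    by (simp add: times_poly_mapping.rep_eq prod_fun_def)
  also have "\<dots> = Sum_any (\<lambda>\<beta>. lcoeff f \<beta> * lcoeff g (\<alpha> - \<beta>))"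
  proof (rule Sum_any.cong)
    fix \<beta>
    have "\<alpha> = \<beta> + \<gamma> \<longleftrightarrow> \<gamma> = \<alpha> - \<beta>" for \<gamma> by auto
    then show "lcoeff f \<beta> * Sum_any (\<lambda>\<gamma>. lcoeff g \<gamma> when \<alpha> = \<beta> + \<gamma>) = lcoeff f \<beta> * lcoeff g (\<alpha> - \<beta>)"
      by simp
  qed
  also have "\<dots> = (\<Sum>\<beta>\<in>lkeys f. lcoeff f \<beta> * lcoeff g (\<alpha> - \<beta>))"
    by (rule Sum_any.expand_superset) (auto simp: in_keys_iff)
  finally show ?thesis .
qed

lemma lookup_mult_superset:
  fixes f g :: laurent
  assumes "finite K" "lkeys f \<subseteq> K"
  shows "lcoeff (f * g) \<alpha> = (\<Sum>\<beta>\<in>K. lcoeff f \<beta> * lcoeff g (\<alpha> - \<beta>))"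
  unfolding lookup_mult using assms by (intro sum.mono_neutral_left) (auto simp: in_keys_iff)

section \<open>Diagonal operators and Euler derivations\<close>

definition wt :: "((nat \<Rightarrow> int) \<Rightarrow> int) \<Rightarrow> laurent \<Rightarrow> laurent" where
  "wt w f = Poly_Mapping.mapp (\<lambda>\<alpha> c. of_int (w \<alpha>) * c) f"

lemma lookup_wt [simp]: "lcoeff (wt w f) \<alpha> = of_int (w \<alpha>) * lcoeff f \<alpha>"
  by (auto simp: wt_def Poly_Mapping.lookup_mapp when_def in_keys_iff)

lemma wt_add: "wt w (f + g) = wt w f + wt w g"
  by (rule poly_mapping_eqI) (simp add: lookup_add algebra_simps)

lemma wt_0 [simp]: "wt w 0 = 0"
  by (rule poly_mapping_eqI) simp

lemma wt_sum: "wt w (\<Sum>s\<in>S. f s) = (\<Sum>s\<in>S. wt w (f s))"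
  by (induction S rule: infinite_finite_induct) (simp_all add: wt_add)

lemma wt_leibniz:
  assumes "\<And>\<alpha> \<beta>. w (\<alpha> + \<beta>) = w \<alpha> + w \<beta>"
  shows "wt w (f * g) = wt w f * g + f * wt w g"
proof (rule poly_mapping_eqI)
  fix \<alpha>
  have "w \<alpha> = w \<beta> + w (\<alpha> - \<beta>)" for \<beta> using assms[of \<beta> "\<alpha> - \<beta>"] by simp
  then have "lcoeff (wt w (f * g)) \<alpha> = (\<Sum>\<beta>\<in>lkeys f. (of_int (w \<beta>) + of_int (w (\<alpha> - \<beta>))) * lcoeff f \<beta> * lcoeff g (\<alpha> - \<beta>))"
    by (simp add: lookup_mult sum_distrib_left algebra_simps flip: of_int_add)
  also have "\<dots> = (\<Sum>\<beta>\<in>lkeys f. lcoeff (wt w f) \<beta> * lcoeff g (\<alpha> - \<beta>)) + lcoeff (f * wt w g) \<alpha>"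
    by (simp add: lookup_mult algebra_simps sum.distrib)
  also have "(\<Sum>\<beta>\<in>lkeys f. lcoeff (wt w f) \<beta> * lcoeff g (\<alpha> - \<beta>)) = lcoeff (wt w f * g) \<alpha>"
    by (rule lookup_mult_superset[symmetric]) (auto simp: in_keys_iff)
  finally show "lcoeff (wt w (f * g)) \<alpha> = lcoeff (wt w f * g + f * wt w g) \<alpha>"
    by (simp add: lookup_add)
qed

lemma derivation_prod:
  fixes D :: "'a::comm_ring_1 \<Rightarrow> 'a"
  assumes leibniz: "\<And>f g. D (f * g) = D f * g + f * D g" and "finite S"
  shows "D (\<Prod>s\<in>S. f s) = (\<Sum>s\<in>S. D (f s) * (\<Prod>t\<in>S - {s}. f t))"
  using \<open>finite S\<close>
proof (induction S)
  case empty
  have "D 1 = 0" using leibniz[of 1 1] by simp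
  then show ?case by simp
next
  case (insert x S)
  have "(\<Prod>t\<in>insert x S - {s}. f t) = f x * (\<Prod>t\<in>S - {s}. f t)" if "s \<in> S" for s
  proof -
    have "insert x S - {s} = insert x (S - {s})" using that insert by auto
    then show ?thesis using insert by simp
  qed
  moreover have "insert x S - {x} = S" using insert by auto
  ultimately show ?case using insert
    by (simp add: leibniz sum_distrib_left algebra_simps)
qed

definition ev :: "nat \<Rightarrow> int \<Rightarrow> nat \<Rightarrow> int" where
  "ev i k = (\<lambda>j. if j = i then k else 0)"

definition xv :: "nat \<Rightarrow> int \<Rightarrow> laurent" where
  "xv i k = Poly_Mapping.single (ev i k) 1"

definition cst :: "complex \<Rightarrow> laurent" where
  "cst c = Poly_Mapping.single 0 c"

lemma ev_add: "ev i k + ev i l = ev i (k + l)" by (auto simp: ev_def)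

lemma ev_0 [simp]: "ev i 0 = 0" by (auto simp: ev_def)

lemma xv_mult: "xv i k * xv i l = xv i (k + l)"
  by (simp add: xv_def mult_single ev_add)

lemma xv_0 [simp]: "xv i 0 = 1" by (simp add: xv_def)

lemma lookup_single_mult: "lcoeff (Poly_Mapping.single \<beta> c * g) \<alpha> = c * lcoeff (g :: laurent) (\<alpha> - \<beta>)"
  by (subst lookup_mult_superset[of "{\<beta>}"]) (auto split: if_splits)

lemma lookup_cst_mult [simp]: "lcoeff (cst c * g) \<alpha> = c * lcoeff g \<alpha>"
  by (simp add: cst_def lookup_single_mult)

lemma lookup_xv_mult: "lcoeff (xv i k * g) \<alpha> = lcoeff g (\<alpha> - ev i k)"
  by (simp add: xv_def lookup_single_mult)

lemma cst_simps: "cst 0 = 0" "cst 1 = 1" "cst (a + b) = cst a + cst b" "cst (a * b) = cst a * cst b"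
  "cst (a - b) = cst a - cst b" "cst (- a) = - cst a"
  by (simp_all add: cst_def single_add mult_single single_diff single_uminus)

lemma cst_of_int: "cst (of_int k) = of_int k"
proof -
  have n: "cst (of_nat n) = of_nat n" for n by (induction n) (simp_all add: cst_simps)
  show ?thesis by (cases k) (simp_all add: n cst_simps)
qed

text \<open>The Euler derivation \<open>x_i d/dx_i\<close>.\<close>

definition theta :: "nat \<Rightarrow> laurent \<Rightarrow> laurent" where "theta i = wt (\<lambda>\<alpha>. \<alpha> i)"

lemma theta_leibniz: "theta i (f * g) = theta i f * g + f * theta i g"
  unfolding theta_def by (rule wt_leibniz) simp

lemma theta_add: "theta i (f + g) = theta i f + theta i g" by (simp add: theta_def wt_add)

lemma theta_sum: "theta i (\<Sum>s\<in>S. f s) = (\<Sum>s\<in>S. theta i (f s))" by (simp add: theta_def wt_sum)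

lemma theta_prod: "finite S \<Longrightarrow> theta i (\<Prod>s\<in>S. f s) = (\<Sum>s\<in>S. theta i (f s) * (\<Prod>t\<in>S - {s}. f t))"
  by (rule derivation_prod) (rule theta_leibniz)

lemma theta_of_int: "theta i (of_int k * f) = of_int k * theta i f"
  unfolding cst_of_int[symmetric] by (rule poly_mapping_eqI) (simp add: theta_def)

lemma theta_xv: "theta i (xv j k) = (if i = j then of_int k * xv j k else 0)"
  unfolding cst_of_int[symmetric]
  by (rule poly_mapping_eqI) (auto simp: theta_def xv_def lookup_single when_def ev_def)

definition psum :: "nat \<Rightarrow> int \<Rightarrow> laurent" where "psum N k = (\<Sum>i<N. xv i k)"

lemma psum_0: "psum N 0 = of_nat N" by (simp add: psum_def)

lemma theta_psum: "i < N \<Longrightarrow> theta i (psum N k) = of_int k * xv i k"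
  by (simp add: psum_def theta_sum theta_xv)

section \<open>The Vandermonde product and its logarithmic derivative\<close>

definition vdm_pairs :: "nat \<Rightarrow> (nat \<times> nat) set" where "vdm_pairs N = {(i, j). i < j \<and> j < N}"

lemma vdm_pairs_iff: "(i, j) \<in> vdm_pairs N \<longleftrightarrow> i < j \<and> j < N" by (simp add: vdm_pairs_def)

lemma finite_vdm_pairs [simp]: "finite (vdm_pairs N)"
  by (rule finite_subset[of _ "{..<N} \<times> {..<N}"]) (auto simp: vdm_pairs_def)

definition vdm :: "nat \<Rightarrow> laurent" where
  "vdm N = (\<Prod>(i, j)\<in>vdm_pairs N. xv j 1 - xv i 1)"

text \<open>The contracted derivative of \<open>U^k\<close>: one product of two traces for each
  factor that can be differentiated, negative for inverse factors. For nonzero \<open>k\<close>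
  exactly one summand contains \<open>p 0\<close>, which is \<open>N\<close> in both uses. The
  argument \<open>p\<close> is abstract so that traces of a matrix and formal power sums share one
  expression.\<close>

definition loopsum :: "(int \<Rightarrow> 'a::comm_ring_1) \<Rightarrow> int \<Rightarrow> 'a" where
  "loopsum p k = (if k > 0 then \<Sum>r<nat k. p (int r) * p (k - int r)
     else - (\<Sum>r=1..nat (- k). p (- int r) * p (k + int r)))"

text \<open>The Laurent polynomial \<open>(x\<^sup>k\<^sup>+\<^sup>1 - y\<^sup>k\<^sup>+\<^sup>1) / (x - y)\<close>, where \<open>x k\<close> stands for \<open>x\<^sup>k\<close>.\<close>

definition divdiff :: "(int \<Rightarrow> 'a) \<Rightarrow> (int \<Rightarrow> 'a) \<Rightarrow> int \<Rightarrow> 'a::comm_ring_1" where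
  "divdiff x y k = (if k > 0 then \<Sum>r<Suc (nat k). x (int r) * y (k - int r)
     else - (\<Sum>r=1..nat (- k - 1). x (- int r) * y (k + int r)))"

text \<open>Multiplication by \<open>x 1 - y 1\<close> telescopes. For \<open>k = 0\<close> the
  defining sum is empty although the quotient is 1, hence the exclusion.\<close>

lemma divdiff_mult:
  fixes x y :: "int \<Rightarrow> 'a::comm_ring_1"
  assumes x: "\<And>a b. x a * x b = x (a + b)" "x 0 = 1" and y: "\<And>a b. y a * y b = y (a + b)" "y 0 = 1" and "k \<noteq> 0"
  shows "(x 1 - y 1) * divdiff x y k = x (k + 1) - y (k + 1)"
proof (cases "k > 0")
  case True
  have xy: "x 1 * (x a * y b) = x (1 + a) * y b" "y 1 * (x a * y b) = x a * y (1 + b)" for a b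
    by (simp_all add: x y mult.assoc[symmetric]) (simp add: y mult.assoc mult.left_commute mult.commute)
  have *: "(x 1 - y 1) * (\<Sum>r<n. x (int r) * y (k - int r)) = x (int n) * y (k + 1 - int n) - y (k + 1)" for n
  proof (induction n)
    case 0
    then show ?case by (simp add: x)
  next
    case (Suc n)
    then show ?case by (simp add: distrib_left left_diff_distrib xy algebra_simps)
  qed
  show ?thesis using *[of "Suc (nat k)"] True by (simp add: divdiff_def y add.commute del: sum.lessThan_Suc)
next
  case False
  have xy: "x 1 * (x a * y b) = x (1 + a) * y b" "y 1 * (x a * y b) = x a * y (1 + b)" for a b
    by (simp_all add: x y mult.assoc[symmetric]) (simp add: y mult.assoc mult.left_commute mult.commute)
  have *: "(x 1 - y 1) * (\<Sum>r=1..n. x (- int r) * y (k + int r)) = y (k + 1) - x (- int n) * y (k + 1 + int n)" for n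
  proof (induction n)
    case 0
    then show ?case by (simp add: x)
  next
    case (Suc n)
    then show ?case by (simp add: distrib_left left_diff_distrib xy algebra_simps)
  qed
  show ?thesis using *[of "nat (- k - 1)"] False \<open>k \<noteq> 0\<close> by (simp add: divdiff_def y algebra_simps)
qed

lemma divdiff_swap:
  fixes x y :: "int \<Rightarrow> 'a::comm_ring_1"
  shows "divdiff x y k = divdiff y x k"
proof (cases "k > 0")
  case True
  then show ?thesis unfolding divdiff_def
    by (simp del: sum.lessThan_Suc) (rule sum.reindex_bij_witness[where i = "\<lambda>r. nat k - r" and j = "\<lambda>r. nat k - r"],
      auto simp: mult.commute of_nat_diff)
next
  case False
  then show ?thesis unfolding divdiff_def
    by simp (rule sum.reindex_bij_witness[where i = "\<lambda>r. nat (-k) - r" and j = "\<lambda>r. nat (-k) - r"],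
      auto simp: mult.commute of_nat_diff add.commute)
qed

lemma sum_pairs:
  fixes c :: "nat \<Rightarrow> nat \<Rightarrow> 'a::comm_ring_1"
  assumes "\<And>i j. c i j = c j i"
  shows "2 * (\<Sum>(i, j)\<in>vdm_pairs N. c i j) = (\<Sum>i<N. \<Sum>j<N. c i j) - (\<Sum>i<N. c i i)"
proof -
  let ?S = "prod.swap ` vdm_pairs N" and ?D = "(\<lambda>i. (i, i)) ` {..<N}"
  have "{..<N} \<times> {..<N} = vdm_pairs N \<union> ?S \<union> ?D" by (force simp: vdm_pairs_def)
  then have "(\<Sum>i<N. \<Sum>j<N. c i j) = (\<Sum>(i, j)\<in>vdm_pairs N \<union> ?S \<union> ?D. c i j)"
    by (simp add: sum.cartesian_product)
  also have "\<dots> = (\<Sum>(i, j)\<in>vdm_pairs N. c i j) + (\<Sum>(i, j)\<in>?S. c i j) + (\<Sum>(i, j)\<in>?D. c i j)"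
    by (subst sum.union_disjoint, simp, simp, force simp: vdm_pairs_def, subst sum.union_disjoint) (auto simp del: mem_Collect_eq simp: vdm_pairs_iff)
  also have "(\<Sum>(i, j)\<in>?S. c i j) = (\<Sum>(i, j)\<in>vdm_pairs N. c i j)"
    by (subst sum.reindex) (auto simp: case_prod_unfold assms intro!: sum.cong)
  also have "(\<Sum>(i, j)\<in>?D. c i j) = (\<Sum>i<N. c i i)"
    by (subst sum.reindex) (auto simp: inj_on_def)
  finally show ?thesis by simp
qed

text \<open>For positive \<open>k\<close> the divided difference has the additional summand
  \<open>r = k\<close>; for negative \<open>k\<close> the loop sum has the additional, negatively
  counted summand \<open>r = -k\<close>. Either way the difference is \<open>psum N 0 = N\<close>
  times \<open>psum N k\<close>.\<close>

lemma sum_divdiff: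
  assumes "k \<noteq> 0"
  shows "(\<Sum>i<N. \<Sum>j<N. divdiff (xv i) (xv j) k) = loopsum (psum N) k + of_nat N * psum N k"
proof (cases "k > 0")
  case True
  have "(\<Sum>i<N. \<Sum>j<N. divdiff (xv i) (xv j) k) = (\<Sum>r<Suc (nat k). \<Sum>i<N. \<Sum>j<N. xv i (int r) * xv j (k - int r))"
    using True by (simp only: divdiff_def if_True sum.swap[of _ _ "{..<Suc (nat k)}"])
  also have "\<dots> = (\<Sum>r<Suc (nat k). psum N (int r) * psum N (k - int r))"
    by (simp only: psum_def sum_product)
  finally show ?thesis using True by (simp add: loopsum_def psum_0 mult.commute)
next
  case False
  then have k: "nat (- k) = Suc (nat (- k - 1))" using assms by simp
  have "(\<Sum>i<N. \<Sum>j<N. divdiff (xv i) (xv j) k) = - (\<Sum>r=1..nat (- k - 1). \<Sum>i<N. \<Sum>j<N. xv i (- int r) * xv j (k + int r))"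
    using False by (simp only: divdiff_def if_False sum_negf sum.swap[of _ _ "{1..nat (- k - 1)}"])
  also have "\<dots> = - (\<Sum>r=1..nat (- k - 1). psum N (- int r) * psum N (k + int r))"
    by (simp only: psum_def sum_product)
  finally show ?thesis using False assms unfolding loopsum_def k by (simp add: psum_0 algebra_simps)
qed

lemma sum_divdiff_diag:
  assumes "k \<noteq> 0"
  shows "(\<Sum>i<N. divdiff (xv i) (xv i) k) = of_int (k + 1) * psum N k"
proof -
  have "divdiff (xv i) (xv i) k = of_int (k + 1) * xv i k" for i
  proof (cases "k > 0")
    case True
    then have "(of_nat (nat k) :: laurent) = of_int k" by (simp add: of_nat_nat)
    then show ?thesis using True by (simp add: divdiff_def xv_mult distrib_right del: of_nat_nat)
  next
    case False
    then have "(of_nat (nat (- k - 1)) :: laurent) = of_int (- k - 1)" using assms by (simp add: of_nat_nat)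
    then show ?thesis using False by (simp add: divdiff_def xv_mult left_diff_distrib distrib_right del: of_nat_nat)
  qed
  then show ?thesis by (simp add: psum_def sum_distrib_left)
qed

text \<open>The operator \<open>D\<close> is the derivation that sends \<open>x_j\<close> to
  \<open>x_j^(k+1)\<close>, so it multiplies a factor \<open>x_j - x_i\<close> by the divided
  difference, and the whole product by the sum of these over all pairs. Twice that sum is the full
  double sum minus its diagonal, which leaves the loop sum and \<open>N - (k + 1)\<close> copies of
  \<open>psum N k\<close>.\<close>

lemma radial_vdm:
  assumes k: "k \<noteq> 0"
  shows "2 * (\<Sum>i<N. xv i k * theta i (vdm N)) =
    (loopsum (psum N) k - of_int k * psum N k + of_int (int N - 1) * psum N k) * vdm N"
proof -
  define D where "D f = (\<Sum>i<N. xv i k * theta i f)" for f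
  have leib: "D (f * g) = D f * g + f * D g" for f g
    by (simp add: D_def theta_leibniz sum.distrib sum_distrib_left sum_distrib_right algebra_simps)
  have Dx: "D (xv j 1) = xv j (k + 1)" if "j < N" for j
    using that by (simp add: D_def theta_xv if_distrib[of "\<lambda>z. _ * z"] xv_mult cong: if_cong)
  have Dadd: "D (f - g) = D f - D g" for f g
  proof -
    have "D (f - g) + D g = D f" by (simp add: D_def sum.distrib[symmetric] distrib_left[symmetric] theta_add[symmetric])
    then show ?thesis by (simp add: algebra_simps)
  qed
  let ?f = "\<lambda>(i, j). xv j 1 - xv i 1"
  have "D (vdm N) = (\<Sum>p\<in>vdm_pairs N. D (?f p) * (\<Prod>t\<in>vdm_pairs N - {p}. ?f t))"
    unfolding vdm_def by (rule derivation_prod) (auto intro: leib)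
  also have "\<dots> = (\<Sum>p\<in>vdm_pairs N. (case p of (i, j) \<Rightarrow> divdiff (xv i) (xv j) k) * vdm N)"
  proof (rule sum.cong)
    fix p assume p: "p \<in> vdm_pairs N"
    obtain i j where ij: "p = (i, j)" by force
    then have "D (?f p) = xv j (k + 1) - xv i (k + 1)" using p by (simp add: Dadd Dx vdm_pairs_def)
    also have "\<dots> = ?f p * divdiff (xv j) (xv i) k"
      unfolding ij using divdiff_mult[of "xv j" "xv i" k] k by (simp add: xv_mult)
    also have "divdiff (xv j) (xv i) k = divdiff (xv i) (xv j) k" by (rule divdiff_swap)
    finally show "D (?f p) * (\<Prod>t\<in>vdm_pairs N - {p}. ?f t) = (case p of (i, j) \<Rightarrow> divdiff (xv i) (xv j) k) * vdm N"
      unfolding vdm_def prod.remove[OF finite_vdm_pairs p, of ?f] by (simp add: ij mult_ac)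
  qed simp
  also have "\<dots> = (\<Sum>(i, j)\<in>vdm_pairs N. divdiff (xv i) (xv j) k) * vdm N"
    by (simp add: sum_distrib_right)
  finally have "2 * D (vdm N) = (2 * (\<Sum>(i, j)\<in>vdm_pairs N. divdiff (xv i) (xv j) k)) * vdm N" by (simp add: mult.assoc)
  also have "2 * (\<Sum>(i, j)\<in>vdm_pairs N. divdiff (xv i) (xv j) k) =
      loopsum (psum N) k + of_nat N * psum N k - of_int (k + 1) * psum N k"
    using sum_pairs[of "\<lambda>i j. divdiff (xv i) (xv j) k" N, OF divdiff_swap] sum_divdiff[OF k] sum_divdiff_diag[OF k] by simp
  finally show ?thesis unfolding D_def by (simp add: algebra_simps)
qed

section \<open>Symmetric and antisymmetric Laurent polynomials\<close>

abbreviation tr :: "nat \<Rightarrow> nat \<Rightarrow> nat \<Rightarrow> nat" where "tr \<equiv> Transposition.transpose"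

lemma inj_comp_tr: "inj (\<lambda>\<alpha> :: nat \<Rightarrow> int. \<alpha> \<circ> tr i j)"
  by (rule inj_on_inverseI[where g = "\<lambda>\<alpha>. \<alpha> \<circ> tr i j"]) (simp add: comp_assoc)

definition sw :: "nat \<Rightarrow> nat \<Rightarrow> laurent \<Rightarrow> laurent" where
  "sw i j f = Poly_Mapping.map_key (\<lambda>\<alpha>. \<alpha> \<circ> tr i j) f"

lemma lcoeff_sw [simp]: "lcoeff (sw i j f) \<alpha> = lcoeff f (\<alpha> \<circ> tr i j)"
  by (simp add: sw_def Poly_Mapping.map_key.rep_eq[OF inj_comp_tr])

lemma sw_mult: "sw i j (f * g) = sw i j f * sw i j g"
proof (rule poly_mapping_eqI)
  fix \<alpha>
  let ?s = "\<lambda>\<alpha> :: nat \<Rightarrow> int. \<alpha> \<circ> tr i j"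
  have ss: "?s (?s \<beta>) = \<beta>" for \<beta> by (simp add: comp_assoc)
  have "lcoeff (sw i j (f * g)) \<alpha> = (\<Sum>\<beta>\<in>lkeys f. lcoeff f \<beta> * lcoeff g (?s \<alpha> - \<beta>))"
    by (simp add: lookup_mult)
  also have "\<dots> = (\<Sum>\<beta>\<in>lkeys (sw i j f). lcoeff (sw i j f) \<beta> * lcoeff (sw i j g) (\<alpha> - \<beta>))"
    by (rule sum.reindex_bij_witness[where i = ?s and j = ?s])
      (auto simp: ss in_keys_iff comp_assoc fun_eq_iff intro!: arg_cong[where f = "lcoeff g"])
  finally show "lcoeff (sw i j (f * g)) \<alpha> = lcoeff (sw i j f * sw i j g) \<alpha>" by (simp add: lookup_mult)
qed

lemma sw_add: "sw i j (f + g) = sw i j f + sw i j g"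
  by (rule poly_mapping_eqI) (simp add: lookup_add)

lemma sw_diff: "sw i j (f - g) = sw i j f - sw i j g"
  by (rule poly_mapping_eqI) (simp add: lookup_minus)

lemma sw_sum: "sw i j (\<Sum>s\<in>S. f s) = (\<Sum>s\<in>S. sw i j (f s))"
  by (rule poly_mapping_eqI) (simp add: lookup_sum)

lemma sw_cst [simp]: "sw i j (cst c) = cst c"
proof (rule poly_mapping_eqI)
  fix \<alpha> :: "nat \<Rightarrow> int"
  have "\<alpha> \<circ> tr i j = 0 \<longleftrightarrow> \<alpha> = 0" by (auto simp: fun_eq_iff) (metis transpose_involutory)
  then show "lcoeff (sw i j (cst c)) \<alpha> = lcoeff (cst c) \<alpha>" by (auto simp: cst_def lookup_single when_def)
qed

lemma sw_1 [simp]: "sw i j 1 = 1"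
  using sw_cst[of i j 1] by (simp add: cst_simps)

lemma sw_prod: "sw i j (\<Prod>s\<in>S. f s) = (\<Prod>s\<in>S. sw i j (f s))"
  by (induction S rule: infinite_finite_induct) (simp_all add: sw_mult)

lemma sw_xv: "sw i j (xv m k) = xv (tr i j m) k"
proof (rule poly_mapping_eqI)
  fix \<alpha> :: "nat \<Rightarrow> int"
  have "ev m k \<circ> tr i j = ev (tr i j m) k"
    by (auto simp: fun_eq_iff ev_def Transposition.transpose_def)
  then have "\<alpha> \<circ> tr i j = ev m k \<longleftrightarrow> \<alpha> = ev (tr i j m) k"
    by (metis comp_assoc comp_id transpose_comp_involutory)
  then show "lcoeff (sw i j (xv m k)) \<alpha> = lcoeff (xv (tr i j m) k) \<alpha>" by (auto simp: xv_def lookup_single when_def)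
qed

definition symm :: "nat \<Rightarrow> laurent \<Rightarrow> bool" where
  "symm N f \<longleftrightarrow> (\<forall>i<N. \<forall>j<N. sw i j f = f)"

definition asymm :: "nat \<Rightarrow> laurent \<Rightarrow> bool" where
  "asymm N f \<longleftrightarrow> (\<forall>i<N. \<forall>j<N. i \<noteq> j \<longrightarrow> sw i j f = - f)"

lemma symm_psum: "symm N (psum N k)"
  unfolding symm_def
proof (intro allI impI)
  fix i j assume "i < N" "j < N"
  then have *: "tr i j m < N" if "m < N" for m using that by (cases "m = i"; cases "m = j") auto
  show "sw i j (psum N k) = psum N k" unfolding psum_def sw_sum sw_xv
    by (rule sum.reindex_bij_witness[where i = "tr i j" and j = "tr i j"]) (auto simp: *)
qed

lemma asymm_mult: "symm N f \<Longrightarrow> asymm N g \<Longrightarrow> asymm N (f * g)"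
  by (simp add: symm_def asymm_def sw_mult)

lemma symm_mult: "symm N f \<Longrightarrow> symm N g \<Longrightarrow> symm N (f * g)"
  by (simp add: symm_def sw_mult)

lemma symm_add: "symm N f \<Longrightarrow> symm N g \<Longrightarrow> symm N (f + g)"
  by (simp add: symm_def sw_add)

lemma symm_cst [simp]: "symm N (cst c)" by (simp add: symm_def)

text \<open>A transposition of distant indices is the conjugate of a closer one by an adjacent
  transposition, and three sign changes make one.\<close>

lemma asymm_adjacent:
  assumes "\<And>a. Suc a < N \<Longrightarrow> sw a (Suc a) f = - f"
  shows "asymm N f"
proof -
  have uminus: "sw i j (- g) = - sw i j g" for i j g by (rule poly_mapping_eqI) simp
  have "sw i j f = - f" if "i < j" "j < N" for i j
    using that
  proof (induction j rule: less_induct)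
    case (less j)
    show ?case
    proof (cases "j = Suc i")
      case True
      then show ?thesis using assms less by simp
    next
      case False
      then obtain j' where j: "j = Suc j'" "i < j'" using less by (cases j) auto
      have "tr j' j \<circ> tr i j' \<circ> tr j' j = tr i j"
        using j by (auto simp: fun_eq_iff Transposition.transpose_def)
      then have "sw j' j (sw i j' (sw j' j f)) = sw i j f"
        by (intro poly_mapping_eqI) (simp add: comp_assoc)
      then show ?thesis using less j assms[of j'] by (simp add: uminus)
    qed
  qed
  moreover have "sw i j f = sw j i f" for i j by (simp add: sw_def transpose_commute)
  ultimately show ?thesis unfolding asymm_def by (metis linorder_neqE_nat)
qed

text \<open>Exchanging neighbours \<open>a\<close>, \<open>Suc a\<close> permutes the factors of all
  other pairs, preserving the order inside each pair, and negates the factor of this one. For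
  distant indices several factors would change sign.\<close>

lemma asymm_vdm: "asymm N (vdm N)"
proof (rule asymm_adjacent)
  fix a assume a: "Suc a < N"
  let ?f = "\<lambda>(i, j). xv j 1 - xv i 1"
  let ?t = "tr a (Suc a)"
  let ?P = "vdm_pairs N - {(a, Suc a)}"
  have m: "(a, Suc a) \<in> vdm_pairs N" using a by (simp add: vdm_pairs_iff)
  have mem: "(?t i, ?t j) \<in> ?P" if "(i, j) \<in> ?P" for i j
    using that a by (auto simp: vdm_pairs_iff Transposition.transpose_def)
  have "sw a (Suc a) (vdm N) = (\<Prod>(i, j)\<in>vdm_pairs N. xv (?t j) 1 - xv (?t i) 1)"
    unfolding vdm_def sw_prod by (intro prod.cong) (auto simp: sw_diff sw_xv)
  also have "\<dots> = (xv a 1 - xv (Suc a) 1) * (\<Prod>(i, j)\<in>?P. xv (?t j) 1 - xv (?t i) 1)"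
    by (subst prod.remove[OF _ m]) auto
  also have "(\<Prod>(i, j)\<in>?P. xv (?t j) 1 - xv (?t i) 1) = (\<Prod>(i, j)\<in>?P. xv j 1 - xv i 1)"
    by (rule prod.reindex_bij_witness[where i = "\<lambda>(i, j). (?t i, ?t j)" and j = "\<lambda>(i, j). (?t i, ?t j)"])
      (use mem in \<open>auto split: prod.splits\<close>)
  also have "(xv a 1 - xv (Suc a) 1) * \<dots> = - vdm N"
    unfolding vdm_def prod.remove[OF finite_vdm_pairs m, of ?f] by (simp add: algebra_simps)
  finally show "sw a (Suc a) (vdm N) = - vdm N" .
qed

text \<open>Exchanging two equal exponents fixes the exponent vector but negates the
  coefficient.\<close>

lemma asymm_inj:
  assumes "asymm N f" "lcoeff f \<alpha> \<noteq> 0"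
  shows "inj_on \<alpha> {..<N}"
proof (rule inj_onI, rule ccontr)
  fix i j assume *: "i \<in> {..<N}" "j \<in> {..<N}" "\<alpha> i = \<alpha> j" "i \<noteq> j"
  then have "\<alpha> \<circ> tr i j = \<alpha>" by (auto simp: fun_eq_iff Transposition.transpose_def)
  moreover have "lcoeff (sw i j f) \<alpha> = - lcoeff f \<alpha>" using assms(1) * by (auto simp: asymm_def)
  ultimately show False using assms(2) by simp
qed

lemma asymm_permute_0:
  assumes "asymm N f" "\<sigma> permutes {..<N}"
  shows "lcoeff f (\<alpha> \<circ> \<sigma>) = 0 \<longleftrightarrow> lcoeff f \<alpha> = 0"
  using finite_lessThan[of N] assms(2)
proof (induction \<sigma> rule: permutes_rev_induct)
  case id
  then show ?case by simp
next
  case (swap a b p)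
  have "lcoeff (sw a b f) (\<alpha> \<circ> p) = - lcoeff f (\<alpha> \<circ> p)" using assms(1) swap by (auto simp: asymm_def)
  then show ?case using swap by (simp add: comp_def)
qed

definition strict_dec :: "nat \<Rightarrow> (nat \<Rightarrow> int) \<Rightarrow> bool" where
  "strict_dec N \<alpha> \<longleftrightarrow> (\<forall>i j. i < j \<longrightarrow> j < N \<longrightarrow> \<alpha> j < \<alpha> i)"

lemma ex_sorting_perm:
  assumes "inj_on \<alpha> {..<N}"
  shows "\<exists>\<sigma>. \<sigma> permutes {..<N} \<and> strict_dec N (\<alpha> \<circ> \<sigma>)"
proof -
  let ?ys = "sort_key (\<lambda>i. - \<alpha> i) [0..<N]"
  have "mset ?ys = mset [0..<N]" by simp
  then obtain p where p: "p permutes {..<length [0..<N]}" "permute_list p [0..<N] = ?ys"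
    by (rule mset_eq_permutation)
  then have pp: "p permutes {..<N}" by simp
  have nth: "?ys ! i = p i" if "i < N" for i
    using that p permutes_in_image[OF pp, of i] by (simp add: p(2)[symmetric] permute_list_def)
  have "\<alpha> (p j) < \<alpha> (p i)" if "i < j" "j < N" for i j
  proof -
    have "sorted (map (\<lambda>i. - \<alpha> i) ?ys)" by simp
    then have "\<alpha> (p j) \<le> \<alpha> (p i)" using sorted_nth_mono[of "map (\<lambda>i. - \<alpha> i) ?ys" i j] that nth by simp
    moreover have "p i \<noteq> p j" using permutes_inj[OF pp] that by (auto dest: injD)
    then have "\<alpha> (p i) \<noteq> \<alpha> (p j)" using inj_onD[OF assms, of "p i" "p j"] permutes_in_image[OF pp] that by auto
    ultimately show ?thesis by simp
  qed
  then show ?thesis using pp by (auto simp: strict_dec_def)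
qed

definition supp :: "nat \<Rightarrow> laurent \<Rightarrow> bool" where
  "supp N f \<longleftrightarrow> (\<forall>\<alpha>. lcoeff f \<alpha> \<noteq> 0 \<longrightarrow> (\<forall>i\<ge>N. \<alpha> i = 0))"

lemma supp_mult: "supp N f \<Longrightarrow> supp N g \<Longrightarrow> supp N (f * g)"
  unfolding supp_def
proof (intro allI impI)
  fix \<alpha> i assume f: "\<forall>\<alpha>. lcoeff f \<alpha> \<noteq> 0 \<longrightarrow> (\<forall>i\<ge>N. \<alpha> i = 0)" and g: "\<forall>\<alpha>. lcoeff g \<alpha> \<noteq> 0 \<longrightarrow> (\<forall>i\<ge>N. \<alpha> i = 0)"
    and fg: "lcoeff (f * g) \<alpha> \<noteq> 0" and i: "N \<le> i"
  from fg have "(\<Sum>\<beta>\<in>lkeys f. lcoeff f \<beta> * lcoeff g (\<alpha> - \<beta>)) \<noteq> 0" unfolding lookup_mult .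
  then obtain \<beta> where "lcoeff f \<beta> * lcoeff g (\<alpha> - \<beta>) \<noteq> 0"
    by (rule sum.not_neutral_contains_not_neutral)
  then have "lcoeff f \<beta> \<noteq> 0" "lcoeff g (\<alpha> - \<beta>) \<noteq> 0" by simp_all
  from f[rule_format, OF this(1) i] g[rule_format, OF this(2) i] have "\<beta> i = 0" "(\<alpha> - \<beta>) i = 0" by auto
  then show "\<alpha> i = 0" by simp
qed

lemma supp_add: "supp N f \<Longrightarrow> supp N g \<Longrightarrow> supp N (f + g)"
  unfolding supp_def lookup_add by (metis add.right_neutral)

lemma supp_diff: "supp N f \<Longrightarrow> supp N g \<Longrightarrow> supp N (f - g)"
  unfolding supp_def lookup_minus by (metis diff_zero)

lemma supp_cst [simp]: "supp N (cst c)" by (auto simp: supp_def cst_def lookup_single when_def)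

lemma supp_1 [simp]: "supp N 1" using supp_cst[of N 1] by (simp add: cst_simps)

lemma supp_xv: "i < N \<Longrightarrow> supp N (xv i k)" by (auto simp: supp_def xv_def lookup_single when_def ev_def)

lemma supp_sum: "(\<And>s. s \<in> S \<Longrightarrow> supp N (f s)) \<Longrightarrow> supp N (\<Sum>s\<in>S. f s)"
  by (induction S rule: infinite_finite_induct) (auto intro: supp_add simp: supp_def[of N 0])

lemma supp_prod: "(\<And>s. s \<in> S \<Longrightarrow> supp N (f s)) \<Longrightarrow> supp N (\<Prod>s\<in>S. f s)"
  by (induction S rule: infinite_finite_induct) (auto intro: supp_mult)

lemma supp_psum [simp]: "supp N (psum N k)" unfolding psum_def by (auto intro: supp_sum supp_xv)

lemma supp_vdm: "supp N (vdm N)"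
  unfolding vdm_def by (intro supp_prod) (auto simp: vdm_pairs_iff intro!: supp_diff supp_xv)

text \<open>Each factor adds 1 to the exponent of one of its two indices, so the exponent at
  \<open>l\<close> is at most the number \<open>N - 1\<close> of factors that involve
  \<open>l\<close>.\<close>

lemma vdm_exponent:
  assumes "lcoeff (vdm N) \<alpha> \<noteq> 0" "l < N"
  shows "0 \<le> \<alpha> l \<and> \<alpha> l \<le> int N - 1"
proof -
  let ?f = "\<lambda>(i, j). xv j 1 - xv i 1"
  have *: "0 \<le> \<alpha> l \<and> \<alpha> l \<le> int (card {p \<in> S. fst p = l \<or> snd p = l})"
    if "finite S" "lcoeff (\<Prod>p\<in>S. ?f p) \<alpha> \<noteq> 0" "S \<subseteq> vdm_pairs N" for S \<alpha>
    using that
  proof (induction S arbitrary: \<alpha>)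
    case empty
    then have "\<alpha> = 0" by (auto simp: lookup_one when_def split: if_splits)
    then show ?case by simp
  next
    case (insert p S)
    obtain i j where p: "p = (i, j)" by force
    then have ij: "i < j" using insert by (auto simp: vdm_pairs_iff)
    have "lcoeff (\<Prod>p\<in>insert p S. ?f p) \<alpha> = lcoeff (\<Prod>p\<in>S. ?f p) (\<alpha> - ev j 1) - lcoeff (\<Prod>p\<in>S. ?f p) (\<alpha> - ev i 1)"
      using insert by (simp add: p left_diff_distrib lookup_minus lookup_xv_mult)
    then have "lcoeff (\<Prod>p\<in>S. ?f p) (\<alpha> - ev j 1) \<noteq> 0 \<or> lcoeff (\<Prod>p\<in>S. ?f p) (\<alpha> - ev i 1) \<noteq> 0"
      using insert.prems(1) by (metis diff_self)
    then obtain m where m: "m = i \<or> m = j" "lcoeff (\<Prod>p\<in>S. ?f p) (\<alpha> - ev m 1) \<noteq> 0"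
      by blast
    have IH: "0 \<le> \<alpha> l - ev m 1 l" "\<alpha> l - ev m 1 l \<le> int (card {p \<in> S. fst p = l \<or> snd p = l})"
      using insert.IH[OF m(2)] insert.prems by auto
    have "card {q \<in> insert p S. fst q = l \<or> snd q = l} =
        (if l = i \<or> l = j then 1 else 0) + card {p \<in> S. fst p = l \<or> snd p = l}"
    proof (cases "l = i \<or> l = j")
      case True
      then have "{q \<in> insert p S. fst q = l \<or> snd q = l} = insert p {p \<in> S. fst p = l \<or> snd p = l}"
        using p by auto
      then show ?thesis using True insert by simp
    next
      case False
      then have "{q \<in> insert p S. fst q = l \<or> snd q = l} = {p \<in> S. fst p = l \<or> snd p = l}"
        using p by auto
      then show ?thesis using False by simp
    qed
    then show ?case using IH m ij by (auto simp: ev_def split: if_splits)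
  qed
  have "{p \<in> vdm_pairs N. fst p = l \<or> snd p = l} \<subseteq> (\<lambda>m. (min l m, max l m)) ` ({..<N} - {l})"
  proof
    fix p assume "p \<in> {p \<in> vdm_pairs N. fst p = l \<or> snd p = l}"
    then obtain i j where "p = (i, j)" "i < j" "j < N" "i = l \<or> j = l" by (cases p) (auto simp: vdm_pairs_iff)
    then show "p \<in> (\<lambda>m. (min l m, max l m)) ` ({..<N} - {l})"
      by (auto intro!: image_eqI[where x = "if i = l then j else i"])
  qed
  then have "card {p \<in> vdm_pairs N. fst p = l \<or> snd p = l} \<le> card ((\<lambda>m. (min l m, max l m)) ` ({..<N} - {l}))"
    by (intro card_mono) auto
  also have "\<dots> \<le> card ({..<N} - {l})" by (rule card_image_le) simp
  also have "\<dots> = N - 1" using assms(2) by simp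
  finally show ?thesis using *[of "vdm_pairs N" \<alpha>] assms unfolding vdm_def by auto
qed

text \<open>The support is finite, while the translates of one exponent by multiples of
  \<open>\<gamma>\<close> are infinitely many. This makes \<open>x_j - x_i\<close> cancellable: if
  it annihilates \<open>f\<close>, the coefficients of \<open>f\<close> are constant along
  \<open>e_j - e_i\<close>.\<close>

lemma shift_invariant_eq_0:
  assumes "\<And>\<alpha>. lcoeff f (\<alpha> + \<gamma>) = lcoeff f \<alpha>" "\<gamma> l \<noteq> 0"
  shows "f = 0"
proof (rule ccontr)
  assume "f \<noteq> 0"
  then obtain \<alpha> where \<alpha>: "\<alpha> \<in> lkeys f" by (metis all_not_in_conv keys_eq_empty)
  define sh where "sh n = \<alpha> + (\<lambda>i. int n * \<gamma> i)" for n
  have "lcoeff f (sh n) = lcoeff f \<alpha>" for n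
  proof (induction n)
    case 0
    then show ?case by (simp add: sh_def plus_fun_def)
  next
    case (Suc n)
    have "sh (Suc n) = sh n + \<gamma>" by (auto simp: sh_def fun_eq_iff algebra_simps)
    then show ?case using Suc assms(1)[of "sh n"] by (simp only:)
  qed
  then have "range sh \<subseteq> lkeys f" using \<alpha> by (auto simp: in_keys_iff)
  moreover have "inj sh"
  proof (rule injI)
    fix m n assume "sh m = sh n"
    then have "sh m l = sh n l" by simp
    then show "m = n" using assms(2) by (simp add: sh_def)
  qed
  ultimately show False using finite_subset[OF _ finite_keys[of f]] finite_imageD[of sh UNIV] by (metis infinite_UNIV_nat)
qed

lemma vdm_cancel:
  assumes "vdm N * f = 0" shows "f = 0"
proof -
  let ?f = "\<lambda>(i, j). xv j 1 - xv i 1"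
  have "(\<Prod>p\<in>S. ?f p) * f = 0 \<Longrightarrow> f = 0" if "finite S" "S \<subseteq> vdm_pairs N" for S
    using that
  proof (induction S)
    case (insert p S)
    obtain i j where p: "p = (i, j)" by force
    then have ij: "i < j" using insert by (auto simp: vdm_pairs_iff)
    let ?g = "(\<Prod>p\<in>S. ?f p) * f"
    have "(xv j 1 - xv i 1) * ?g = 0" using insert by (simp add: p mult.assoc)
    then have "lcoeff (xv j 1 * ?g) \<alpha> = lcoeff (xv i 1 * ?g) \<alpha>" for \<alpha> by (simp add: left_diff_distrib)
    then have eq: "lcoeff ?g (\<alpha> - ev j 1) = lcoeff ?g (\<alpha> - ev i 1)" for \<alpha> by (simp only: lookup_xv_mult)
    have "?g = 0"
    proof (rule shift_invariant_eq_0[where \<gamma> = "ev j 1 - ev i 1" and l = j])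
      fix \<alpha>
      have 1: "\<alpha> + (ev j 1 - ev i 1) = (\<alpha> + ev j 1) - ev i 1" and 2: "\<alpha> + ev j 1 - ev j 1 = \<alpha>"
        by (simp_all add: add_diff_eq)
      show "lcoeff ?g (\<alpha> + (ev j 1 - ev i 1)) = lcoeff ?g \<alpha>" using eq[of "\<alpha> + ev j 1"] unfolding 1 2 by (rule sym)
    qed (use ij in \<open>simp add: ev_def\<close>)
    then show ?case using insert by simp
  qed simp
  from this[of "vdm_pairs N"] show ?thesis using assms by (simp add: vdm_def)
qed

text \<open>The eigenvalue on the monomial with exponent \<open>\<alpha>\<close> of the Casimir operator conjugated by the Vandermonde
  product. The quadratic \<open>t (t - N + 1)\<close> is positive on integers outside \<open>{0..N-1}\<close> and nonpositive inside, so for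
  distinct \<open>\<alpha>\<^sub>i\<close> the eigenvalue vanishes only on permutations of \<open>(0, \<dots>, N-1)\<close>.\<close>

definition bweight :: "nat \<Rightarrow> (nat \<Rightarrow> int) \<Rightarrow> int" where
  "bweight N \<alpha> = (\<Sum>i<N. \<alpha> i * (\<alpha> i - (int N - 1))) - (\<Sum>i<N. int i * (int i - (int N - 1)))"

text \<open>The decreasing exponent \<open>(N-1, ..., 1, 0)\<close> of the Vandermonde product,
  usually called \<delta>.\<close>

definition staircase :: "nat \<Rightarrow> nat \<Rightarrow> int" where
  "staircase N i = (if i < N then int (N - Suc i) else 0)"

lemma bweight_image:
  assumes "inj_on \<alpha> {..<N}"
  shows "bweight N \<alpha> = (\<Sum>t\<in>\<alpha> ` {..<N}. t * (t - (int N - 1))) - (\<Sum>t\<in>{0..<int N}. t * (t - (int N - 1)))"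
proof -
  have "{0..<int N} = int ` {..<N}" by (simp add: image_int_atLeastLessThan lessThan_atLeast0)
  then have "(\<Sum>t\<in>{0..<int N}. t * (t - (int N - 1))) = (\<Sum>i<N. int i * (int i - (int N - 1)))"
    by (simp add: sum.reindex)
  then show ?thesis using assms by (simp add: bweight_def sum.reindex)
qed

lemma bweight_0_image:
  assumes "inj_on \<alpha> {..<N}" "bweight N \<alpha> = 0"
  shows "\<alpha> ` {..<N} = {0..<int N}"
proof -
  let ?A = "\<alpha> ` {..<N}" and ?T = "{0..<int N}" and ?g = "\<lambda>t::int. t * (t - (int N - 1))"
  have A: "sum ?g ?A = sum ?g (?A - ?T) + sum ?g (?A \<inter> ?T)"
    by (subst sum.Int_Diff[of _ _ ?T]) auto
  have T: "sum ?g ?T = sum ?g (?T - ?A) + sum ?g (?A \<inter> ?T)"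
    by (subst sum.Int_Diff[of _ _ ?A]) (auto simp: Int_commute)
  have "sum ?g (?T - ?A) \<le> 0"
    by (rule sum_nonpos) (auto intro: mult_nonneg_nonpos)
  moreover have "sum ?g (?A - ?T) = sum ?g (?T - ?A)"
    using assms A T by (simp add: bweight_image)
  ultimately have le: "sum ?g (?A - ?T) \<le> 0" by simp
  have pos: "?g t > 0" if "t \<in> ?A - ?T" for t
    using that by (cases "t < 0") (auto intro: mult_pos_pos mult_neg_neg)
  have "?A - ?T = {}"
  proof (rule ccontr)
    assume "?A - ?T \<noteq> {}"
    then have "sum ?g (?A - ?T) > 0" using pos by (intro sum_pos) auto
    then show False using le by simp
  qed
  then show ?thesis using assms(1) by (intro card_seteq) (auto simp: card_image)
qed

lemma strict_dec_image_staircase: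
  assumes "strict_dec N \<alpha>" "\<alpha> ` {..<N} = {0..<int N}" "i < N"
  shows "\<alpha> i = int (N - Suc i)"
proof -
  have rng: "0 \<le> \<alpha> i" "\<alpha> i < int N" if "i < N" for i using assms(2) that by auto
  have "\<alpha> i \<le> int (N - Suc i)" if "i < N" for i
    using that
  proof (induction i)
    case (Suc i)
    then have "\<alpha> (Suc i) < \<alpha> i" using assms(1) by (simp add: strict_dec_def)
    then show ?case using Suc by simp
  qed (use rng[of 0] in auto)
  moreover have "int (N - Suc i) \<le> \<alpha> i" if "i < N" for i
  proof -
    have "int k \<le> \<alpha> (N - Suc k)" if "k < N" for k
      using that
    proof (induction k)
      case (Suc k)
      then have "\<alpha> (N - Suc k) < \<alpha> (N - Suc (Suc k))" using assms(1) by (simp add: strict_dec_def)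
      then show ?case using Suc by simp
    qed (use rng[of "N - 1"] in auto)
    from this[of "N - Suc i"] show ?thesis using that by simp
  qed
  ultimately show ?thesis using assms(3) by (metis order_antisym)
qed

text \<open>Up to order, only one exponent vector supported on the first \<open>N\<close> indices
  has distinct entries there and weight zero. Hence an antisymmetric polynomial in the kernel is
  determined by its staircase coefficient; applied to differences, this identifies multiples of
  \<open>vdm N\<close>.\<close>

lemma asymm_eq_0:
  assumes "asymm N g" "supp N g" "\<And>\<alpha>. lcoeff g \<alpha> \<noteq> 0 \<Longrightarrow> bweight N \<alpha> = 0"
    and "lcoeff g (staircase N) = 0"
  shows "g = 0"
proof (rule poly_mapping_eqI, rule ccontr)
  fix \<alpha> assume "lcoeff g \<alpha> \<noteq> lcoeff 0 \<alpha>"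
  then have nz: "lcoeff g \<alpha> \<noteq> 0" by simp
  have inj: "inj_on \<alpha> {..<N}" using asymm_inj[OF assms(1) nz] .
  then obtain \<sigma> where \<sigma>: "\<sigma> permutes {..<N}" "strict_dec N (\<alpha> \<circ> \<sigma>)" using ex_sorting_perm by blast
  have "(\<alpha> \<circ> \<sigma>) ` {..<N} = {0..<int N}"
    unfolding image_comp[symmetric] permutes_image[OF \<sigma>(1)] using bweight_0_image[OF inj assms(3)[OF nz]] .
  then have "(\<alpha> \<circ> \<sigma>) i = int (N - Suc i)" if "i < N" for i
    using strict_dec_image_staircase[OF \<sigma>(2) _ that] by simp
  moreover have "(\<alpha> \<circ> \<sigma>) i = 0" if "i \<ge> N" for i
    using assms(2) nz permutes_not_in[OF \<sigma>(1), of i] that by (auto simp: supp_def)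
  ultimately have "\<alpha> \<circ> \<sigma> = staircase N" by (auto simp: staircase_def fun_eq_iff)
  then show False using asymm_permute_0[OF assms(1) \<sigma>(1), of \<alpha>] nz assms(4) by simp
qed

lemma bweight_vdm: "lcoeff (vdm N) \<alpha> \<noteq> 0 \<Longrightarrow> bweight N \<alpha> = 0"
proof -
  assume nz: "lcoeff (vdm N) \<alpha> \<noteq> 0"
  have inj: "inj_on \<alpha> {..<N}" using asymm_inj[OF asymm_vdm nz] .
  have "\<alpha> ` {..<N} = {0..<int N}"
    using vdm_exponent[OF nz] inj by (intro card_seteq) (force simp: card_image)+
  then show ?thesis by (simp add: bweight_image[OF inj])
qed

text \<open>Otherwise \<open>asymm_eq_0\<close> would make the Vandermonde product zero, and
  cancelling it from \<open>vdm N * 1 = 0\<close> would give \<open>1 = 0\<close>. No coefficient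
  has to be computed.\<close>

lemma vdm_staircase: "lcoeff (vdm N) (staircase N) \<noteq> 0"
proof
  assume "lcoeff (vdm N) (staircase N) = 0"
  then have "vdm N = 0" by (intro asymm_eq_0[OF asymm_vdm supp_vdm bweight_vdm])
  then have "vdm N * 1 = 0" by simp
  then have "(1 :: laurent) = 0" by (rule vdm_cancel)
  then show False by simp
qed

lemma bweight_staircase: "bweight N (staircase N) = 0"
  using bweight_vdm vdm_staircase by blast

section \<open>Conjugation of the Casimir operator by the Vandermonde product\<close>

lemma lcoeff_of_int_mult [simp]: "lcoeff (of_int k * f) \<alpha> = of_int k * lcoeff f \<alpha>"
  by (simp flip: cst_of_int)

lemma theta_of_int_0: "theta i (of_int k) = 0"
  using theta_of_int[of i k 1] theta_xv[of i 0 0] by simp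

lemma wt_bweight:
  "wt (bweight N) g = (\<Sum>i<N. theta i (theta i g)) - of_int (int N - 1) * (\<Sum>i<N. theta i g)
     - of_int (\<Sum>i<N. int i * (int i - (int N - 1))) * g"
proof (rule poly_mapping_eqI)
  fix \<alpha>
  have "bweight N \<alpha> = (\<Sum>i<N. \<alpha> i * \<alpha> i) - (int N - 1) * (\<Sum>i<N. \<alpha> i) - (\<Sum>i<N. int i * (int i - (int N - 1)))"
    by (simp add: bweight_def right_diff_distrib sum_subtractf sum_distrib_left mult.commute)
  then show "lcoeff (wt (bweight N) g) \<alpha> = lcoeff ((\<Sum>i<N. theta i (theta i g)) - of_int (int N - 1) * (\<Sum>i<N. theta i g)
     - of_int (\<Sum>i<N. int i * (int i - (int N - 1))) * g) \<alpha>"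
    by (simp add: lookup_minus lookup_sum theta_def left_diff_distrib sum_distrib_right sum_distrib_left mult.assoc del: of_int_diff of_int_sum)
      (simp add: left_diff_distrib sum_distrib_right sum_distrib_left mult.assoc)
qed

text \<open>The Leibniz rule for a second order operator. The part in which \<open>f\<close> is not
  differentiated is \<open>f\<close> times the image of the Vandermonde product, which is
  zero.\<close>

lemma wt_bweight_mult_vdm:
  "wt (bweight N) (f * vdm N) =
     ((\<Sum>i<N. theta i (theta i f)) - of_int (int N - 1) * (\<Sum>i<N. theta i f)) * vdm N
     + 2 * (\<Sum>i<N. theta i f * theta i (vdm N))"
proof -
  have V0: "wt (bweight N) (vdm N) = 0"
    by (rule poly_mapping_eqI) (use bweight_vdm in auto)
  have 1: "theta i (theta i (f * vdm N)) = theta i (theta i f) * vdm N + 2 * (theta i f * theta i (vdm N))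
      + f * theta i (theta i (vdm N))" for i
    by (simp add: theta_leibniz theta_add algebra_simps)
  have 2: "(\<Sum>i<N. theta i (theta i (f * vdm N))) = (\<Sum>i<N. theta i (theta i f)) * vdm N
      + 2 * (\<Sum>i<N. theta i f * theta i (vdm N)) + f * (\<Sum>i<N. theta i (theta i (vdm N)))"
    unfolding 1 by (simp add: sum.distrib sum_distrib_left sum_distrib_right)
  have 3: "(\<Sum>i<N. theta i (f * vdm N)) = (\<Sum>i<N. theta i f) * vdm N + f * (\<Sum>i<N. theta i (vdm N))"
    by (simp add: theta_leibniz sum.distrib sum_distrib_left sum_distrib_right)
  have "wt (bweight N) (f * vdm N) =
     ((\<Sum>i<N. theta i (theta i f)) - of_int (int N - 1) * (\<Sum>i<N. theta i f)) * vdm N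
     + 2 * (\<Sum>i<N. theta i f * theta i (vdm N)) + f * wt (bweight N) (vdm N)"
    unfolding wt_bweight 2 3 by (simp add: algebra_simps)
  then show ?thesis by (simp add: V0)
qed

definition pprod :: "(int \<Rightarrow> 'a::comm_ring_1) \<Rightarrow> int list \<Rightarrow> 'a" where
  "pprod p ks = (\<Prod>s<length ks. p (ks ! s))"

text \<open>The summand of \<open>s\<close> is \<open>ks ! s\<close> times the integrand of the loop
  equation with \<open>k = ks ! s\<close> and the remaining factors as test function, so its
  integral vanishes summand by summand.\<close>

definition casimir :: "(int \<Rightarrow> 'a::comm_ring_1) \<Rightarrow> int list \<Rightarrow> 'a" where
  "casimir p ks = (\<Sum>s<length ks. of_int (ks ! s) *
     (loopsum p (ks ! s) * (\<Prod>t\<in>{..<length ks} - {s}. p (ks ! t)) +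
      (\<Sum>t\<in>{..<length ks} - {s}. of_int (ks ! t) * p (ks ! s + ks ! t) *
        (\<Prod>u\<in>{..<length ks} - {s} - {t}. p (ks ! u)))))"

text \<open>Two cancellations produce this identity. Differentiating the same factor twice gives
  \<open>k^2 p_k\<close>, which the summand \<open>- k p_k\<close> of \<open>radial_vdm\<close>
  removes; the first order part of the operator is removed by its summand
  \<open>(N - 1) p_k\<close>. The loop sums and the terms with two different factors differentiated
  survive.\<close>

lemma bweight_pprod:
  "wt (bweight N) (pprod (psum N) ks * vdm N) = casimir (psum N) ks * vdm N"
proof -
  let ?p = "psum N" and ?n = "length ks"
  let ?P = "\<lambda>s. \<Prod>t\<in>{..<?n} - {s}. ?p (ks ! t)"
  let ?PP = "\<lambda>s t. \<Prod>u\<in>{..<?n} - {s} - {t}. ?p (ks ! u)"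
  let ?k = "\<lambda>s. of_int (ks ! s) :: laurent"
  have th: "theta i (pprod ?p ks) = (\<Sum>s<?n. ?k s * xv i (ks ! s) * ?P s)" if "i < N" for i
    unfolding pprod_def using that by (simp add: theta_prod theta_psum)
  have thP: "theta i (?P s) = (\<Sum>t\<in>{..<?n} - {s}. ?k t * xv i (ks ! t) * ?PP s t)" if "i < N" for i s
    using that by (simp add: theta_prod theta_psum)
  have th2: "theta i (theta i (pprod ?p ks)) = (\<Sum>s<?n. ?k s * (?k s * xv i (ks ! s) * ?P s +
     (\<Sum>t\<in>{..<?n} - {s}. ?k t * xv i (ks ! s + ks ! t) * ?PP s t)))" if "i < N" for i
  proof -
    have "theta i (theta i (pprod ?p ks)) = (\<Sum>s<?n. ?k s * (theta i (xv i (ks ! s)) * ?P s + xv i (ks ! s) * theta i (?P s)))"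
      by (simp add: th[OF that] theta_sum mult.assoc theta_of_int_0 theta_leibniz)
    also have "\<dots> = (\<Sum>s<?n. ?k s * (?k s * xv i (ks ! s) * ?P s +
     (\<Sum>t\<in>{..<?n} - {s}. ?k t * xv i (ks ! s + ks ! t) * ?PP s t)))"
      by (intro sum.cong refl) (simp add: theta_xv thP[OF that] sum_distrib_left xv_mult[symmetric] mult_ac)
    finally show ?thesis .
  qed
  have A: "(\<Sum>i<N. theta i (theta i (pprod ?p ks))) = (\<Sum>s<?n. ?k s * (?k s * ?p (ks ! s) * ?P s +
     (\<Sum>t\<in>{..<?n} - {s}. ?k t * ?p (ks ! s + ks ! t) * ?PP s t)))"
  proof -
    have "(\<Sum>i<N. theta i (theta i (pprod ?p ks))) = (\<Sum>s<?n. \<Sum>i<N. ?k s * (?k s * xv i (ks ! s) * ?P s +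
     (\<Sum>t\<in>{..<?n} - {s}. ?k t * xv i (ks ! s + ks ! t) * ?PP s t)))"
      by (subst sum.swap) (intro sum.cong refl, simp add: th2)
    also have "\<dots> = (\<Sum>s<?n. ?k s * (?k s * ?p (ks ! s) * ?P s +
     (\<Sum>t\<in>{..<?n} - {s}. ?k t * ?p (ks ! s + ks ! t) * ?PP s t)))"
    proof (intro sum.cong refl)
      fix s
      have "(\<Sum>i<N. \<Sum>t\<in>{..<?n} - {s}. ?k t * xv i (ks ! s + ks ! t) * ?PP s t) =
          (\<Sum>t\<in>{..<?n} - {s}. ?k t * ?p (ks ! s + ks ! t) * ?PP s t)"
        by (subst sum.swap) (simp add: psum_def sum_distrib_left sum_distrib_right)
      then show "(\<Sum>i<N. ?k s * (?k s * xv i (ks ! s) * ?P s + (\<Sum>t\<in>{..<?n} - {s}. ?k t * xv i (ks ! s + ks ! t) * ?PP s t)))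
        = ?k s * (?k s * ?p (ks ! s) * ?P s + (\<Sum>t\<in>{..<?n} - {s}. ?k t * ?p (ks ! s + ks ! t) * ?PP s t))"
        by (simp add: sum_distrib_left[symmetric] sum.distrib) (simp add: psum_def sum_distrib_left sum_distrib_right)
    qed
    finally show ?thesis .
  qed
  have B: "(\<Sum>i<N. theta i (pprod ?p ks)) = (\<Sum>s<?n. ?k s * ?p (ks ! s) * ?P s)"
  proof -
    have "(\<Sum>i<N. theta i (pprod ?p ks)) = (\<Sum>s<?n. \<Sum>i<N. ?k s * xv i (ks ! s) * ?P s)"
      by (subst sum.swap) (simp add: th)
    then show ?thesis by (simp add: psum_def sum_distrib_left sum_distrib_right)
  qed
  have C: "2 * (\<Sum>i<N. theta i (pprod ?p ks) * theta i (vdm N)) =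
     (\<Sum>s<?n. ?k s * ?P s * (loopsum ?p (ks ! s) - ?k s * ?p (ks ! s) + of_int (int N - 1) * ?p (ks ! s))) * vdm N"
  proof -
    have "(\<Sum>i<N. theta i (pprod ?p ks) * theta i (vdm N)) =
       (\<Sum>s<?n. \<Sum>i<N. ?k s * ?P s * (xv i (ks ! s) * theta i (vdm N)))"
      by (subst sum.swap) (intro sum.cong refl, simp add: th sum_distrib_right sum_distrib_left mult_ac)
    then have "2 * (\<Sum>i<N. theta i (pprod ?p ks) * theta i (vdm N)) =
       (\<Sum>s<?n. ?k s * ?P s * (2 * (\<Sum>i<N. xv i (ks ! s) * theta i (vdm N))))"
      by (simp add: sum_distrib_left mult.left_commute)
    also have "\<dots> = (\<Sum>s<?n. ?k s * ?P s * ((loopsum ?p (ks ! s) - ?k s * ?p (ks ! s) + of_int (int N - 1) * ?p (ks ! s)) * vdm N))"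
    proof (intro sum.cong refl)
      fix s
      \<comment> \<open>\<open>radial_vdm\<close> excludes the exponent 0, but then the coefficient
        \<open>?k s\<close> is zero.\<close>
      show "?k s * ?P s * (2 * (\<Sum>i<N. xv i (ks ! s) * theta i (vdm N))) =
        ?k s * ?P s * ((loopsum ?p (ks ! s) - ?k s * ?p (ks ! s) + of_int (int N - 1) * ?p (ks ! s)) * vdm N)"
        by (cases "ks ! s = 0") (simp_all only: radial_vdm of_int_0 mult_zero_left not_False_eq_True)
    qed
    finally show ?thesis by (simp add: sum_distrib_right mult.assoc)
  qed
  have "wt (bweight N) (pprod ?p ks * vdm N) = ((\<Sum>s<?n. ?k s * (?k s * ?p (ks ! s) * ?P s +
     (\<Sum>t\<in>{..<?n} - {s}. ?k t * ?p (ks ! s + ks ! t) * ?PP s t))) - of_int (int N - 1) * (\<Sum>s<?n. ?k s * ?p (ks ! s) * ?P s)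
     + (\<Sum>s<?n. ?k s * ?P s * (loopsum ?p (ks ! s) - ?k s * ?p (ks ! s) + of_int (int N - 1) * ?p (ks ! s)))) * vdm N"
    unfolding wt_bweight_mult_vdm A B C by (simp only: distrib_right)
  also have "(\<Sum>s<?n. ?k s * (?k s * ?p (ks ! s) * ?P s +
     (\<Sum>t\<in>{..<?n} - {s}. ?k t * ?p (ks ! s + ks ! t) * ?PP s t))) - of_int (int N - 1) * (\<Sum>s<?n. ?k s * ?p (ks ! s) * ?P s)
     + (\<Sum>s<?n. ?k s * ?P s * (loopsum ?p (ks ! s) - ?k s * ?p (ks ! s) + of_int (int N - 1) * ?p (ks ! s))) = casimir ?p ks"
    unfolding casimir_def sum_distrib_left[of "of_int (int N - 1)"] sum_subtractf[symmetric] sum.distrib[symmetric]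
    by (intro sum.cong refl) (simp only: algebra_simps)
  finally show ?thesis .
qed

section \<open>The span of products of power sums\<close>

inductive_set pspan :: "nat \<Rightarrow> laurent set" for N where
  pprod: "pprod (psum N) ks \<in> pspan N"
| add: "f \<in> pspan N \<Longrightarrow> g \<in> pspan N \<Longrightarrow> f + g \<in> pspan N"
| scale: "f \<in> pspan N \<Longrightarrow> cst c * f \<in> pspan N"

lemma pprod_Nil [simp]: "pprod p [] = 1" by (simp add: pprod_def)

lemma pprod_Cons: "pprod p (k # ks) = p k * pprod p ks"
  by (simp add: pprod_def prod.lessThan_Suc_shift del: prod.lessThan_Suc)

lemma pprod_append: "pprod p (ks @ ls) = pprod p ks * pprod p ls"
  by (induction ks) (simp_all add: pprod_Cons mult.assoc)

lemma pspan_mult: "f \<in> pspan N \<Longrightarrow> g \<in> pspan N \<Longrightarrow> f * g \<in> pspan N"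
proof (induction f rule: pspan.induct)
  case (pprod ks)
  from pprod show ?case
    by (induction g rule: pspan.induct)
      (auto simp: distrib_left mult.left_commute[of "pprod _ _"] pprod_append[symmetric] intro: pspan.intros)
qed (auto simp: distrib_right mult.assoc intro: pspan.intros)

lemma pspan_1 [simp]: "1 \<in> pspan N" using pspan.pprod[of N "[]"] by simp

lemma pspan_cst: "cst c \<in> pspan N" using pspan.scale[OF pspan_1, of c] by simp

lemma pspan_0 [simp]: "0 \<in> pspan N" using pspan_cst[of 0] by (simp add: cst_simps)

lemma pspan_of_int: "of_int k \<in> pspan N" using pspan_cst[of "of_int k"] by (simp add: cst_of_int)

lemma pspan_uminus: "f \<in> pspan N \<Longrightarrow> - f \<in> pspan N"
  using pspan.scale[of f N "-1"] by (simp add: cst_simps)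

lemma pspan_diff: "f \<in> pspan N \<Longrightarrow> g \<in> pspan N \<Longrightarrow> f - g \<in> pspan N"
  using pspan.add[of f N "- g"] pspan_uminus by simp

lemma pspan_psum: "psum N k \<in> pspan N" using pspan.pprod[of N "[k]"] by (simp add: pprod_Cons)

lemma pspan_sum: "(\<And>s. s \<in> S \<Longrightarrow> f s \<in> pspan N) \<Longrightarrow> (\<Sum>s\<in>S. f s) \<in> pspan N"
  by (induction S rule: infinite_finite_induct) (auto intro: pspan.add)

lemma pspan_prod: "(\<And>s. s \<in> S \<Longrightarrow> f s \<in> pspan N) \<Longrightarrow> (\<Prod>s\<in>S. f s) \<in> pspan N"
  by (induction S rule: infinite_finite_induct) (auto intro: pspan_mult)

lemma casimir_pspan: "casimir (psum N) ks \<in> pspan N"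
  unfolding casimir_def loopsum_def
  by (intro pspan_sum pspan_mult pspan_of_int pspan.add pspan_prod pspan_psum)
    (auto intro!: pspan_sum pspan_mult pspan_psum pspan_uminus)

lemma pspan_symm: "f \<in> pspan N \<Longrightarrow> symm N f \<and> supp N f"
proof (induction f rule: pspan.induct)
  case (pprod ks)
  have "symm N (pprod (psum N) ks) \<and> supp N (pprod (psum N) ks)"
    by (induction ks) (auto simp: pprod_Cons symm_def[of N 1] intro: symm_mult symm_psum supp_mult)
  then show ?case .
qed (auto intro: symm_add supp_add symm_mult supp_mult)

text \<open>The images of the Casimir operator are killed by \<open>L\<close>, so the components of \<open>f V\<close> with nonzero eigenvalue can
  be removed one eigenvalue at a time without changing \<open>L f\<close>; what remains is a multiple of \<open>V\<close>.\<close>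

theorem symmetric_functional:
  fixes L :: "laurent \<Rightarrow> complex"
  assumes add: "\<And>f g. f \<in> pspan N \<Longrightarrow> g \<in> pspan N \<Longrightarrow> L (f + g) = L f + L g"
    and scale: "\<And>f c. f \<in> pspan N \<Longrightarrow> L (cst c * f) = c * L f"
    and one: "L 1 = 1"
    and cas: "\<And>ks. L (casimir (psum N) ks) = 0"
    and f: "f \<in> pspan N"
  shows "L f * lcoeff (vdm N) (staircase N) = lcoeff (f * vdm N) (staircase N)"
proof -
  have ex: "\<exists>q\<in>pspan N. wt (bweight N) (f * vdm N) = q * vdm N \<and> L q = 0" if "f \<in> pspan N" for f
    using that
  proof induction
    case (pprod ks)
    then show ?case using bweight_pprod casimir_pspan cas by blast
  next
    case (add f g)
    then obtain q r where "q \<in> pspan N" "r \<in> pspan N" "wt (bweight N) (f * vdm N) = q * vdm N" "L q = 0"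
      "wt (bweight N) (g * vdm N) = r * vdm N" "L r = 0" by blast
    then show ?case
      by (intro bexI[of _ "q + r"]) (auto simp: distrib_right wt_add assms(1) intro: pspan.add)
  next
    case (scale f c)
    then obtain q where q: "q \<in> pspan N" "wt (bweight N) (f * vdm N) = q * vdm N" "L q = 0" by blast
    have "wt (bweight N) (cst c * (f * vdm N)) = cst c * wt (bweight N) (f * vdm N)"
      by (rule poly_mapping_eqI) simp
    then show ?case using q
      by (intro bexI[of _ "cst c * q"]) (auto simp: mult.assoc assms(2) intro: pspan.scale)
  qed
  show ?thesis using f
  proof (induction "card (bweight N ` lkeys (f * vdm N) - {0})" arbitrary: f rule: less_induct)
    case less
    note asym = asymm_mult[OF pspan_symm[OF less.prems, THEN conjunct1] asymm_vdm]
    note sup = supp_mult[OF pspan_symm[OF less.prems, THEN conjunct2] supp_vdm]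
    show ?case
    proof (cases "bweight N ` lkeys (f * vdm N) \<subseteq> {0}")
      case True
      define c where "c = lcoeff (f * vdm N) (staircase N) / lcoeff (vdm N) (staircase N)"
      have "(f - cst c) * vdm N = 0"
      proof (rule asymm_eq_0)
        have "symm N (f - cst c)" "supp N (f - cst c)"
          using pspan_symm[OF pspan_diff[OF less.prems pspan_cst]] by auto
        then show "asymm N ((f - cst c) * vdm N)" "supp N ((f - cst c) * vdm N)"
          by (auto intro: asymm_mult asymm_vdm supp_mult supp_vdm)
        show "lcoeff ((f - cst c) * vdm N) (staircase N) = 0"
          using vdm_staircase[of N] by (simp add: left_diff_distrib lookup_minus c_def)
        show "bweight N \<alpha> = 0" if "lcoeff ((f - cst c) * vdm N) \<alpha> \<noteq> 0" for \<alpha>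
        proof -
          have "lcoeff (f * vdm N) \<alpha> \<noteq> 0 \<or> lcoeff (vdm N) \<alpha> \<noteq> 0"
            using that by (auto simp: left_diff_distrib lookup_minus)
          then show ?thesis using True bweight_vdm[of N \<alpha>] by (metis image_subset_iff in_keys_iff singletonD)
        qed
      qed
      then have "f = cst c" using vdm_cancel[of N "f - cst c"] by (simp add: mult.commute)
      then have "L f = c" using scale[OF pspan_1, of c] one by simp
      then show ?thesis using vdm_staircase[of N] by (simp add: c_def)
    next
      case False
      then obtain \<alpha>0 where \<alpha>0: "\<alpha>0 \<in> lkeys (f * vdm N)" "bweight N \<alpha>0 \<noteq> 0" by auto
      define b where "b = bweight N \<alpha>0"
      obtain q where q: "q \<in> pspan N" "wt (bweight N) (f * vdm N) = q * vdm N" "L q = 0"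
        using ex[OF less.prems] by blast
      \<comment> \<open>A coefficient of eigenvalue \<open>w\<close> is multiplied by
        \<open>1 - w / b\<close>: the eigenvalue \<open>b\<close> disappears, while eigenvalue 0,
        and with it the staircase coefficient, is unchanged.\<close>
      define g where "g = f - cst (1 / of_int b) * q"
      have g: "g \<in> pspan N" unfolding g_def using q less.prems by (intro pspan_diff pspan.scale)
      have lg: "lcoeff (g * vdm N) \<alpha> = (1 - of_int (bweight N \<alpha>) / of_int b) * lcoeff (f * vdm N) \<alpha>" for \<alpha>
      proof -
        have "g * vdm N = f * vdm N - cst (1 / of_int b) * wt (bweight N) (f * vdm N)"
          by (simp add: g_def q left_diff_distrib mult.assoc)
        then show ?thesis by (simp add: lookup_minus left_diff_distrib)
      qed
      have "bweight N ` lkeys (g * vdm N) - {0} \<subset> bweight N ` lkeys (f * vdm N) - {0}"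
      proof
        show "bweight N ` lkeys (g * vdm N) - {0} \<subseteq> bweight N ` lkeys (f * vdm N) - {0}"
          using lg by (auto simp: in_keys_iff)
        have "b \<notin> bweight N ` lkeys (g * vdm N)" using lg \<alpha>0 by (auto simp: in_keys_iff b_def)
        then show "bweight N ` lkeys (g * vdm N) - {0} \<noteq> bweight N ` lkeys (f * vdm N) - {0}"
          using \<alpha>0 by (auto simp: b_def)
      qed
      then have "card (bweight N ` lkeys (g * vdm N) - {0}) < card (bweight N ` lkeys (f * vdm N) - {0})"
        by (intro psubset_card_mono) auto
      from less.hyps[OF this g] have "L g * lcoeff (vdm N) (staircase N) = lcoeff (f * vdm N) (staircase N)"
        by (simp add: lg bweight_staircase)
      moreover have "f = g + cst (1 / of_int b) * q" by (simp add: g_def)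
      then have "L f = L g" using add[OF g pspan.scale[OF q(1)]] scale[OF q(1)] q(3) by simp
      ultimately show ?thesis by simp
    qed
  qed
qed

subsection \<open>The scalar product\<close>

lemma asymm_pair_perm:
  assumes "asymm N f" "asymm N g" "\<sigma> permutes {..<N}"
  shows "lcoeff f (\<alpha> \<circ> \<sigma>) * lcoeff g (\<alpha> \<circ> \<sigma>) = lcoeff f \<alpha> * lcoeff g \<alpha>"
  using finite_lessThan[of N] assms(3)
proof (induction \<sigma> rule: permutes_rev_induct)
  case id
  then show ?case by simp
next
  case (swap a b p)
  have "lcoeff (sw a b f) (\<alpha> \<circ> p) = - lcoeff f (\<alpha> \<circ> p)" "lcoeff (sw a b g) (\<alpha> \<circ> p) = - lcoeff g (\<alpha> \<circ> p)"
    using assms swap by (auto simp: asymm_def)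
  then show ?case using swap.IH by (simp add: comp_def)
qed

lemma strict_dec_inj: "strict_dec N \<alpha> \<Longrightarrow> inj_on \<alpha> {..<N}"
  by (intro linorder_inj_onI') (fastforce simp: strict_dec_def)

lemma strict_dec_perm_id:
  assumes "strict_dec N \<alpha>" "strict_dec N (\<alpha> \<circ> \<sigma>)" "\<sigma> permutes {..<N}"
  shows "\<sigma> = id"
proof -
  have mono: "\<sigma> i < \<sigma> j" if "i < j" "j < N" for i j
  proof (rule ccontr)
    assume "\<not> \<sigma> i < \<sigma> j"
    then have "\<sigma> j \<le> \<sigma> i" "\<sigma> i < N" using permutes_in_image[OF assms(3)] that by auto
    moreover have "\<alpha> (\<sigma> j) < \<alpha> (\<sigma> i)" using assms(2) that by (simp add: strict_dec_def)
    moreover have "\<alpha> (\<sigma> i) \<le> \<alpha> (\<sigma> j)"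
      using assms(1) calculation(1,2) unfolding strict_dec_def by (metis le_less)
    ultimately show False by simp
  qed
  have "\<forall>i\<in>{..<N}. i \<le> \<sigma> i"
  proof
    fix i assume "i \<in> {..<N}"
    then show "i \<le> \<sigma> i"
    proof (induction i)
      case (Suc i)
      then show ?case using mono[of i "Suc i"] by simp
    qed simp
  qed
  then show ?thesis using permutes_natset_ge[OF assms(3)] by blast
qed

text \<open>Exponents in the support have distinct entries, so their orbits under permutations are
  free and contain exactly one strictly decreasing member each. The product of the two coefficients
  is constant on an orbit, as the signs cancel.\<close>

lemma asymm_pair_sum:
  assumes f: "asymm N f" and g: "asymm N g"
  shows "(\<Sum>\<alpha>\<in>lkeys f. lcoeff f \<alpha> * lcoeff g \<alpha>) =
    fact N * (\<Sum>\<alpha>\<in>{\<alpha>\<in>lkeys f. strict_dec N \<alpha>}. lcoeff f \<alpha> * lcoeff g \<alpha>)"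
proof -
  let ?F = "\<lambda>\<alpha>. lcoeff f \<alpha> * lcoeff g \<alpha>"
  let ?K = "{\<alpha>\<in>lkeys f. strict_dec N \<alpha>}" and ?P = "{\<sigma>. \<sigma> permutes {..<N}}"
  have inj: "inj_on (\<lambda>(\<alpha>, \<sigma>). \<alpha> \<circ> \<sigma>) (?K \<times> ?P)"
  proof (rule inj_onI, clarify)
    fix \<alpha> \<sigma> \<alpha>' \<sigma>' assume *: "strict_dec N \<alpha>" "strict_dec N \<alpha>'" "\<sigma> permutes {..<N}" "\<sigma>' permutes {..<N}"
      and eq: "\<alpha> \<circ> \<sigma> = \<alpha>' \<circ> \<sigma>'"
    have p: "\<sigma>' \<circ> inv \<sigma> permutes {..<N}" using * by (simp add: permutes_compose permutes_inv)
    have "\<alpha> \<circ> \<sigma> \<circ> inv \<sigma> = \<alpha>' \<circ> \<sigma>' \<circ> inv \<sigma>" using eq by simp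
    then have a: "\<alpha> = \<alpha>' \<circ> (\<sigma>' \<circ> inv \<sigma>)" using permutes_inv_o(1)[OF *(3)] by (simp add: comp_assoc)
    then have id: "\<sigma>' \<circ> inv \<sigma> = id" using strict_dec_perm_id[OF *(2) _ p] *(1) by simp
    then have "\<sigma>' \<circ> inv \<sigma> \<circ> \<sigma> = \<sigma>" by simp
    then have "\<sigma>' = \<sigma>" using permutes_inv_o(2)[OF *(3)] by (simp add: comp_assoc)
    then show "\<alpha> = \<alpha>' \<and> \<sigma> = \<sigma>'" using a id by simp
  qed
  have img: "(\<lambda>(\<alpha>, \<sigma>). \<alpha> \<circ> \<sigma>) ` (?K \<times> ?P) = lkeys f"
  proof (rule equalityI; rule subsetI)
    fix \<beta> assume "\<beta> \<in> (\<lambda>(\<alpha>, \<sigma>). \<alpha> \<circ> \<sigma>) ` (?K \<times> ?P)"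
    then obtain p where p: "\<beta> = (case p of (\<alpha>, \<sigma>) \<Rightarrow> \<alpha> \<circ> \<sigma>)" "p \<in> ?K \<times> ?P" by (rule imageE)
    then have *: "\<beta> = fst p \<circ> snd p" "fst p \<in> lkeys f" "snd p permutes {..<N}"
      by (simp_all only: case_prod_unfold mem_Times_iff mem_Collect_eq)
    show "\<beta> \<in> lkeys f" using *(2) asymm_permute_0[OF f *(3), of "fst p"] unfolding *(1) in_keys_iff by blast
  next
    fix \<beta> assume \<beta>: "\<beta> \<in> lkeys f"
    then have "inj_on \<beta> {..<N}" by (intro asymm_inj[OF f]) (simp add: in_keys_iff)
    then obtain \<sigma> where \<sigma>: "\<sigma> permutes {..<N}" "strict_dec N (\<beta> \<circ> \<sigma>)"
      using ex_sorting_perm by blast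
    have "\<beta> = (\<beta> \<circ> \<sigma>) \<circ> inv \<sigma>" using permutes_inv_o(1)[OF \<sigma>(1)] by (simp add: comp_assoc)
    moreover have "\<beta> \<circ> \<sigma> \<in> lkeys f" using asymm_permute_0[OF f \<sigma>(1), of \<beta>] \<beta> unfolding in_keys_iff by blast
    ultimately show "\<beta> \<in> (\<lambda>(\<alpha>, \<sigma>). \<alpha> \<circ> \<sigma>) ` (?K \<times> ?P)"
      using \<sigma> permutes_inv[OF \<sigma>(1)] by (intro image_eqI[where x = "(\<beta> \<circ> \<sigma>, inv \<sigma>)"]) auto
  qed
  have "(\<Sum>\<alpha>\<in>lkeys f. ?F \<alpha>) = sum ?F ((\<lambda>(\<alpha>, \<sigma>). \<alpha> \<circ> \<sigma>) ` (?K \<times> ?P))"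
    by (simp only: img)
  also have "\<dots> = (\<Sum>(\<alpha>, \<sigma>)\<in>?K \<times> ?P. ?F (\<alpha> \<circ> \<sigma>))"
    by (subst sum.reindex[OF inj]) (simp add: case_prod_unfold)
  also have "\<dots> = (\<Sum>(\<alpha>, \<sigma>)\<in>?K \<times> ?P. ?F \<alpha>)"
    by (intro sum.cong refl) (auto simp: asymm_pair_perm[OF f g])
  also have "\<dots> = fact N * (\<Sum>\<alpha>\<in>?K. ?F \<alpha>)"
    by (simp add: sum.cartesian_product[symmetric] card_permutations[of _ N] sum_distrib_left)
  finally show ?thesis .
qed

lemma inj_uminus_fun: "inj (uminus :: (nat \<Rightarrow> int) \<Rightarrow> _)" by (rule inj_uminus)

text \<open>Inverts the variables and keeps the coefficients. On the unit circle this is complex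
  conjugation for polynomials with real coefficients, and it represents the conjugated factors of
  the integrand.\<close>

definition bar :: "laurent \<Rightarrow> laurent" where "bar f = Poly_Mapping.map_key uminus f"

lemma lcoeff_bar [simp]: "lcoeff (bar f) \<alpha> = lcoeff f (- \<alpha>)"
  by (simp add: bar_def Poly_Mapping.map_key.rep_eq[OF inj_uminus_fun])

lemma bar_mult: "bar (f * g) = bar f * bar g"
proof (rule poly_mapping_eqI)
  fix \<alpha>
  have "lcoeff (bar (f * g)) \<alpha> = (\<Sum>\<beta>\<in>lkeys f. lcoeff f \<beta> * lcoeff g (- \<alpha> - \<beta>))"
    by (simp add: lookup_mult)
  also have "\<dots> = (\<Sum>\<beta>\<in>lkeys (bar f). lcoeff (bar f) \<beta> * lcoeff (bar g) (\<alpha> - \<beta>))"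
    by (rule sum.reindex_bij_witness[where i = uminus and j = uminus]) (auto simp: in_keys_iff minus_diff_commute)
  finally show "lcoeff (bar (f * g)) \<alpha> = lcoeff (bar f * bar g) \<alpha>" by (simp add: lookup_mult)
qed

lemma lcoeff_mult_bar_0: "lcoeff (f * bar g) 0 = (\<Sum>\<alpha>\<in>lkeys f. lcoeff f \<alpha> * lcoeff g \<alpha>)"
  by (simp add: lookup_mult)

lemma strict_dec_vdm:
  assumes "strict_dec N \<alpha>" "lcoeff (vdm N) \<alpha> \<noteq> 0" shows "\<alpha> = staircase N"
proof
  fix i
  note inj = strict_dec_inj[OF assms(1)]
  show "\<alpha> i = staircase N i"
    using strict_dec_image_staircase[OF assms(1) bweight_0_image[OF inj bweight_vdm[OF assms(2)]], of i]
      supp_vdm[of N] assms(2) by (auto simp: supp_def staircase_def)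
qed

lemma strict_dec_staircase: "strict_dec N (staircase N)"
  by (auto simp: strict_dec_def staircase_def)

text \<open>With \<open>V = vdm N\<close>, the constant term of \<open>f V\<close> times
  \<open>bar (g V)\<close> is read in two groupings: as the pairing of \<open>f V\<close> with
  \<open>g V\<close>, and as the pairing of \<open>f * bar g * V\<close> with \<open>V\<close>. Both
  are \<open>fact N\<close> times a sum over decreasing exponents, and in the second sum only the
  staircase remains.\<close>

theorem coefficient_pairing:
  assumes f: "f \<in> pspan N" and g: "g \<in> pspan N" and bg: "bar g \<in> pspan N"
  shows "lcoeff (f * bar g * vdm N) (staircase N) * lcoeff (vdm N) (staircase N) =
    (\<Sum>\<alpha>\<in>{\<alpha>\<in>lkeys (f * vdm N). strict_dec N \<alpha>}. lcoeff (f * vdm N) \<alpha> * lcoeff (g * vdm N) \<alpha>)"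
proof -
  let ?V = "vdm N" and ?W = "f * bar g * vdm N" and ?d = "staircase N"
  have as: "asymm N (q * ?V)" if "q \<in> pspan N" for q
    using pspan_symm[OF that] asymm_vdm by (blast intro: asymm_mult)
  have "fact N * (\<Sum>\<alpha>\<in>{\<alpha>\<in>lkeys (f * ?V). strict_dec N \<alpha>}. lcoeff (f * ?V) \<alpha> * lcoeff (g * ?V) \<alpha>)
      = lcoeff (f * ?V * bar (g * ?V)) 0"
    unfolding lcoeff_mult_bar_0 by (rule asymm_pair_sum[symmetric]) (intro as f g)+
  also have "f * ?V * bar (g * ?V) = ?W * bar ?V" by (simp add: bar_mult mult_ac)
  also have "lcoeff (?W * bar ?V) 0 = fact N * (\<Sum>\<alpha>\<in>{\<alpha>\<in>lkeys ?W. strict_dec N \<alpha>}. lcoeff ?W \<alpha> * lcoeff ?V \<alpha>)"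
    unfolding lcoeff_mult_bar_0 by (rule asymm_pair_sum) (intro as asymm_vdm pspan_mult f bg)+
  also have "(\<Sum>\<alpha>\<in>{\<alpha>\<in>lkeys ?W. strict_dec N \<alpha>}. lcoeff ?W \<alpha> * lcoeff ?V \<alpha>) = (\<Sum>\<alpha>\<in>{?d}. lcoeff ?W \<alpha> * lcoeff ?V \<alpha>)"
    by (rule sum.mono_neutral_cong) (use strict_dec_staircase strict_dec_vdm in \<open>auto simp: in_keys_iff\<close>)
  finally show ?thesis by simp
qed

subsection \<open>Pieri rules\<close>

definition comps :: "nat \<Rightarrow> nat \<Rightarrow> (nat \<Rightarrow> int) set" where
  "comps N r = {\<beta>. (\<forall>i. 0 \<le> \<beta> i) \<and> (\<forall>i\<ge>N. \<beta> i = 0) \<and> (\<Sum>i<N. \<beta> i) = int r}"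

lemma finite_comps [simp]: "finite (comps N r)"
proof -
  have "finite {\<beta>. \<forall>i. (i \<in> {..<N} \<longrightarrow> \<beta> i \<in> {0..int r}) \<and> (i \<notin> {..<N} \<longrightarrow> \<beta> i = 0)}"
    by (rule finite_set_of_finite_funs) auto
  moreover have "\<beta> i \<le> int r" if "\<beta> \<in> comps N r" "i < N" for \<beta> i
    using that member_le_sum[of i "{..<N}" \<beta>] by (auto simp: comps_def)
  ultimately show ?thesis by (elim rev_finite_subset) (auto simp: comps_def)
qed

definition hsum :: "nat \<Rightarrow> nat \<Rightarrow> laurent" where
  "hsum N r = (\<Sum>\<beta>\<in>comps N r. Poly_Mapping.single \<beta> 1)"

text \<open>The terms violating the strip condition cancel in pairs: swap the exponents \<open>i\<close> and \<open>i + 1\<close> of \<open>\<alpha> - \<beta>\<close> at the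
  first place \<open>i\<close> of violation.\<close>

lemma pieri_h:
  assumes g: "asymm N g" and \<alpha>: "strict_dec N \<alpha>"
  shows "lcoeff (hsum N r * g) \<alpha> =
    (\<Sum>\<beta>\<in>{\<beta>\<in>comps N r. \<forall>i. Suc i < N \<longrightarrow> \<alpha> (Suc i) < \<alpha> i - \<beta> i}. lcoeff g (\<alpha> - \<beta>))"
proof -
  let ?bad = "\<lambda>\<beta> i. Suc i < N \<and> \<alpha> i - \<beta> i \<le> \<alpha> (Suc i)"
  let ?B = "{\<beta>\<in>comps N r. \<exists>i. ?bad \<beta> i}"
  let ?i = "\<lambda>\<beta>. LEAST i. ?bad \<beta> i"
  define \<iota> where "\<iota> \<beta> = \<alpha> - ((\<alpha> - \<beta>) \<circ> tr (?i \<beta>) (Suc (?i \<beta>)))" for \<beta>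
  have key: "\<iota> \<beta> \<in> ?B \<and> ?i (\<iota> \<beta>) = ?i \<beta> \<and> lcoeff g (\<alpha> - \<iota> \<beta>) = - lcoeff g (\<alpha> - \<beta>)" if "\<beta> \<in> ?B" for \<beta>
  proof -
    define i where "i = ?i \<beta>"
    have "\<exists>i. ?bad \<beta> i" using that by blast
    from LeastI_ex[OF this] have bad: "?bad \<beta> i" unfolding i_def .
    have least: "\<not> ?bad \<beta> j" if "j < i" for j
      using not_less_Least[of j "?bad \<beta>"] that unfolding i_def by blast
    have b: "\<beta> \<in> comps N r" using that by simp
    have \<iota>: "\<iota> \<beta> = \<alpha> - ((\<alpha> - \<beta>) \<circ> tr i (Suc i))" by (simp add: \<iota>_def i_def)
    have v: "\<iota> \<beta> i = \<alpha> i - (\<alpha> (Suc i) - \<beta> (Suc i))" "\<iota> \<beta> (Suc i) = \<alpha> (Suc i) - (\<alpha> i - \<beta> i)"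
      "\<And>j. j \<noteq> i \<Longrightarrow> j \<noteq> Suc i \<Longrightarrow> \<iota> \<beta> j = \<beta> j"
      by (simp_all add: \<iota>)
    have dec: "\<alpha> (Suc i) < \<alpha> i" using \<alpha> bad by (simp add: strict_dec_def)
    have pos: "0 \<le> \<beta> j" for j using b by (simp add: comps_def)
    have "0 \<le> \<iota> \<beta> j" for j
      using v bad dec pos[of j] pos[of "Suc i"] by (cases "j = i"; cases "j = Suc i") auto
    moreover have "\<iota> \<beta> j = 0" if "j \<ge> N" for j
      using v(3)[of j] bad that b by (auto simp: comps_def)
    moreover have "(\<Sum>j<N. \<iota> \<beta> j) = (\<Sum>j<N. \<beta> j)"
    proof -
      have s: "(\<Sum>j<N. f j) = f i + f (Suc i) + (\<Sum>j\<in>{..<N} - {i} - {Suc i}. f j)" for f :: "nat \<Rightarrow> int"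
        using bad by (subst sum.remove[of _ i], simp, simp, subst sum.remove[of _ "Suc i"]) auto
      show ?thesis unfolding s using v by simp
    qed
    ultimately have c: "\<iota> \<beta> \<in> comps N r" using b by (simp add: comps_def)
    have badi: "?bad (\<iota> \<beta>) i" using v bad pos[of "Suc i"] by simp
    have nb: "\<not> ?bad (\<iota> \<beta>) j" if "j < i" for j using least[OF that] v(3)[of j] that by auto
    have "?i (\<iota> \<beta>) = i"
      by (rule Least_equality) (use badi nb in \<open>auto simp: not_less[symmetric] simp del: not_less\<close>)
    moreover have "lcoeff (sw i (Suc i) g) (\<alpha> - \<beta>) = - lcoeff g (\<alpha> - \<beta>)"
      using g bad by (auto simp: asymm_def)
    then have "lcoeff g (\<alpha> - \<iota> \<beta>) = - lcoeff g (\<alpha> - \<beta>)" by (simp add: \<iota>)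
    ultimately show ?thesis using c badi unfolding i_def[symmetric] by auto
  qed
  have inv: "\<iota> (\<iota> \<beta>) = \<beta>" if "\<beta> \<in> ?B" for \<beta>
    unfolding \<iota>_def[of "\<iota> \<beta>"] using key[OF that] by (simp add: \<iota>_def comp_assoc)
  have "(\<Sum>\<beta>\<in>?B. lcoeff g (\<alpha> - \<beta>)) = (\<Sum>\<beta>\<in>?B. - lcoeff g (\<alpha> - \<beta>))"
    by (rule sum.reindex_bij_witness[where i = \<iota> and j = \<iota>]) (use key inv in auto)
  then have 0: "(\<Sum>\<beta>\<in>?B. lcoeff g (\<alpha> - \<beta>)) = 0" by (simp add: sum_negf)
  let ?G = "{\<beta>\<in>comps N r. \<forall>i. Suc i < N \<longrightarrow> \<alpha> (Suc i) < \<alpha> i - \<beta> i}"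
  have "lcoeff (hsum N r * g) \<alpha> = (\<Sum>\<beta>\<in>comps N r. lcoeff g (\<alpha> - \<beta>))"
    by (simp add: hsum_def sum_distrib_right lookup_sum lookup_single_mult)
  also have "comps N r = ?G \<union> ?B" by (auto simp: not_less[symmetric] simp del: not_less)
  also have "(\<Sum>\<beta>\<in>?G \<union> ?B. lcoeff g (\<alpha> - \<beta>)) = (\<Sum>\<beta>\<in>?G. lcoeff g (\<alpha> - \<beta>)) + (\<Sum>\<beta>\<in>?B. lcoeff g (\<alpha> - \<beta>))"
    by (rule sum.union_disjoint) force+
  finally show ?thesis using 0 by simp
qed

definition indi :: "nat set \<Rightarrow> nat \<Rightarrow> int" where "indi S i = (if i \<in> S then 1 else 0)"

definition esum :: "nat \<Rightarrow> nat \<Rightarrow> laurent" where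
  "esum N r = (\<Sum>S | S \<subseteq> {..<N} \<and> card S = r. Poly_Mapping.single (indi S) 1)"

lemma lcoeff_esum_mult:
  "lcoeff (esum N r * g) \<alpha> = (\<Sum>S | S \<subseteq> {..<N} \<and> card S = r. lcoeff g (\<alpha> - indi S))"
  by (simp add: esum_def sum_distrib_right lookup_sum lookup_single_mult)

subsection \<open>Newton's identities\<close>

text \<open>The complete homogeneous polynomial in \<open>x 0, ..., x (N - 1)\<close>: a monomial
  either avoids the last variable or is divisible by it. It is defined over any commutative ring, so
  that inversion, evaluation and conjugation can be moved inside by induction.\<close>

fun hrec :: "(nat \<Rightarrow> 'a::comm_ring_1) \<Rightarrow> nat \<Rightarrow> nat \<Rightarrow> 'a" where
  "hrec x 0 r = (if r = 0 then 1 else 0)"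
| "hrec x (Suc N) 0 = 1"
| "hrec x (Suc N) (Suc r) = hrec x N (Suc r) + x N * hrec x (Suc N) r"

fun erec :: "(nat \<Rightarrow> 'a::comm_ring_1) \<Rightarrow> nat \<Rightarrow> nat \<Rightarrow> 'a" where
  "erec x 0 r = (if r = 0 then 1 else 0)"
| "erec x (Suc N) 0 = 1"
| "erec x (Suc N) (Suc r) = erec x N (Suc r) + x N * erec x N r"

lemma hrec_0 [simp]: "hrec x N 0 = 1" by (cases N) auto
lemma erec_0 [simp]: "erec x N 0 = 1" by (cases N) auto

lemma hrec_closed: "hrec x (Suc N) r = (\<Sum>s\<le>r. x N ^ s * hrec x N (r - s))"
proof (induction r)
  case (Suc r)
  have "(\<Sum>s\<le>Suc r. x N ^ s * hrec x N (Suc r - s)) =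
      hrec x N (Suc r) + x N * (\<Sum>s\<le>r. x N ^ s * hrec x N (r - s))"
    by (subst sum.atMost_Suc_shift) (simp add: sum_distrib_left mult.assoc)
  then show ?case using Suc by simp
qed simp

text \<open>\<open>split\<close> removes the last variable from the complete polynomials, and
  \<open>xs\<close> sums up the powers of that variable by \<open>hrec_closed\<close>. What remains
  is the identity for fewer variables and the one for smaller degree, hence the nested
  induction.\<close>

lemma newton_hrec: "of_nat r * hrec x N r = (\<Sum>s<r. (\<Sum>i<N. x i ^ Suc s) * hrec x N (r - Suc s))"
proof (induction N arbitrary: r)
  case 0
  then show ?case by simp
next
  case (Suc N)
  note outer = Suc.IH
  define P where "P s = (\<Sum>i<N. x i ^ Suc s)" for s
  show ?case
  proof (induction r)
    case (Suc r)
    have split: "(\<Sum>s<Suc r. Q s * hrec x (Suc N) (Suc r - Suc s)) =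
        (\<Sum>s<Suc r. Q s * hrec x N (Suc r - Suc s)) + x N * (\<Sum>s<r. Q s * hrec x (Suc N) (r - Suc s))" for Q :: "nat \<Rightarrow> 'a"
    proof -
      have "hrec x (Suc N) (r - s) = hrec x N (r - s) + x N * hrec x (Suc N) (r - Suc s)" if "s < r" for s
      proof -
        have "r - s = Suc (r - Suc s)" using that by simp
        then show ?thesis by (simp only: hrec.simps(3))
      qed
      then have "(\<Sum>s<r. Q s * hrec x (Suc N) (r - s)) =
          (\<Sum>s<r. Q s * hrec x N (r - s) + x N * (Q s * hrec x (Suc N) (r - Suc s)))"
        by (intro sum.cong) (auto simp: algebra_simps)
      then show ?thesis by (simp add: sum.distrib sum_distrib_left)
    qed
    have xs: "(\<Sum>s<Suc r. x N ^ Suc s * hrec x N (Suc r - Suc s)) = x N * hrec x (Suc N) r"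
      unfolding hrec_closed by (simp add: sum_distrib_left mult.assoc lessThan_Suc_atMost del: sum.lessThan_Suc)
    have "(\<Sum>s<Suc r. (\<Sum>i<Suc N. x i ^ Suc s) * hrec x (Suc N) (Suc r - Suc s)) =
        (\<Sum>s<Suc r. (\<Sum>i<Suc N. x i ^ Suc s) * hrec x N (Suc r - Suc s)) + x N * (of_nat r * hrec x (Suc N) r)"
      unfolding split Suc by simp
    also have "(\<Sum>s<Suc r. (\<Sum>i<Suc N. x i ^ Suc s) * hrec x N (Suc r - Suc s)) =
        of_nat (Suc r) * hrec x N (Suc r) + x N * hrec x (Suc N) r"
      unfolding outer xs[symmetric] by (simp add: distrib_right sum.distrib del: sum.lessThan_Suc)
        (simp add: distrib_right sum.distrib)
    finally show ?case by (simp add: algebra_simps)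
  qed simp
qed

text \<open>The recursion of \<open>erec\<close> lowers the number of variables in both terms, so
  one induction suffices. The alternating powers of the last variable telescope.\<close>

lemma newton_erec: "of_nat r * erec x N r = (\<Sum>s<r. (- 1) ^ s * (\<Sum>i<N. x i ^ Suc s) * erec x N (r - Suc s))"
proof (induction N arbitrary: r)
  case 0
  then show ?case by simp
next
  case (Suc N)
  show ?case
  proof (cases r)
    case 0
    then show ?thesis by simp
  next
    case (Suc q)
    have split: "(\<Sum>s<Suc q. Q s * erec x (Suc N) (Suc q - Suc s)) =
        (\<Sum>s<Suc q. Q s * erec x N (Suc q - Suc s)) + x N * (\<Sum>s<q. Q s * erec x N (q - Suc s))" for Q :: "nat \<Rightarrow> 'a"
    proof -
      have "erec x (Suc N) (q - s) = erec x N (q - s) + x N * erec x N (q - Suc s)" if "s < q" for s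
      proof -
        have "q - s = Suc (q - Suc s)" using that by simp
        then show ?thesis by (simp only: erec.simps(3))
      qed
      then have "(\<Sum>s<q. Q s * erec x (Suc N) (q - s)) =
          (\<Sum>s<q. Q s * erec x N (q - s) + x N * (Q s * erec x N (q - Suc s)))"
        by (intro sum.cong) (auto simp: algebra_simps)
      then show ?thesis by (simp add: sum.distrib sum_distrib_left)
    qed
    have tele: "(\<Sum>s<Suc q. (- 1) ^ s * x N ^ Suc s * erec x (Suc N) (Suc q - Suc s)) = x N * erec x N q"
    proof -
      have "(\<Sum>s<Suc q. (- 1) ^ s * x N ^ Suc s * erec x N (Suc q - Suc s)) =
          x N * erec x N q + (\<Sum>s<q. (- 1) ^ Suc s * x N ^ Suc (Suc s) * erec x N (q - Suc s))"
        by (subst sum.lessThan_Suc_shift) simp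
      also have "(\<Sum>s<q. (- 1) ^ Suc s * x N ^ Suc (Suc s) * erec x N (q - Suc s)) =
          - (x N * (\<Sum>s<q. (- 1) ^ s * x N ^ Suc s * erec x N (q - Suc s)))"
        by (simp add: sum_distrib_left sum_negf mult_ac)
      finally show ?thesis unfolding split by simp
    qed
    have "(\<Sum>s<Suc q. (- 1) ^ s * (\<Sum>i<Suc N. x i ^ Suc s) * erec x (Suc N) (Suc q - Suc s)) =
        (\<Sum>s<Suc q. (- 1) ^ s * (\<Sum>i<N. x i ^ Suc s) * erec x (Suc N) (Suc q - Suc s)) + x N * erec x N q"
      unfolding tele[symmetric] sum.distrib[symmetric] by (intro sum.cong) (simp_all add: algebra_simps)
    also have "(\<Sum>s<Suc q. (- 1) ^ s * (\<Sum>i<N. x i ^ Suc s) * erec x (Suc N) (Suc q - Suc s)) =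
        of_nat (Suc q) * erec x N (Suc q) + x N * (of_nat q * erec x N q)"
      unfolding split Suc.IH by simp
    finally show ?thesis unfolding Suc by (simp add: algebra_simps)
  qed
qed

lemma pspan_divide:
  assumes "of_nat r * f \<in> pspan N" "r > 0" shows "f \<in> pspan N"
proof -
  have "(of_nat r :: laurent) = cst (of_nat r)" using cst_of_int[of "int r"] by simp
  then have "cst (1 / of_nat r) * of_nat r = 1" using assms(2) by (simp add: cst_simps(2) flip: cst_simps(4))
  then have "cst (1 / of_nat r) * (of_nat r * f) = f" by (simp flip: mult.assoc)
  then show ?thesis using pspan.scale[OF assms(1), of "1 / of_nat r"] by simp
qed

text \<open>The integral is controlled only on the span of power sums, and Newton's identity places
  the complete polynomials there by division by \<open>r\<close>. The hypothesis on \<open>x\<close>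
  covers the variables as well as their inverses.\<close>

lemma pspan_hrec:
  assumes "\<And>s. (\<Sum>i<N. x i ^ Suc s) \<in> pspan N"
  shows "hrec x N r \<in> pspan N"
proof (induction r rule: less_induct)
  case (less r)
  show ?case
  proof (cases "r = 0")
    case False
    have "of_nat r * hrec x N r \<in> pspan N" unfolding newton_hrec
      by (rule pspan_sum, rule pspan_mult, rule assms, rule less.IH) simp
    from pspan_divide[OF this] False show ?thesis by simp
  qed simp
qed

lemma pspan_erec:
  assumes "\<And>s. (\<Sum>i<N. x i ^ Suc s) \<in> pspan N"
  shows "erec x N r \<in> pspan N"
proof (induction r rule: less_induct)
  case (less r)
  have pow: "(- 1) ^ s \<in> pspan N" for s :: nat
    by (induction s) (auto intro: pspan_mult pspan_uminus)
  show ?case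
  proof (cases "r = 0")
    case False
    have "of_nat r * erec x N r \<in> pspan N" unfolding newton_erec
      by (rule pspan_sum, rule pspan_mult, rule pspan_mult, rule pow, rule assms, rule less.IH) simp
    from pspan_divide[OF this] False show ?thesis by simp
  qed simp
qed

lemma xv_power: "xv i k ^ s = xv i (int s * k)"
  by (induction s) (simp_all add: xv_mult algebra_simps)

lemma sum_xv_power: "(\<Sum>i<N. xv i k ^ s) = psum N (int s * k)"
  by (simp add: xv_power psum_def)

lemma pspan_hrec_xv: "hrec (\<lambda>i. xv i k) N r \<in> pspan N"
  by (rule pspan_hrec) (simp only: sum_xv_power pspan_psum)

lemma pspan_erec_xv: "erec (\<lambda>i. xv i k) N r \<in> pspan N"
  by (rule pspan_erec) (simp only: sum_xv_power pspan_psum)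

lemma comps_0: "comps 0 r = (if r = 0 then {0} else {})"
  by (auto simp: comps_def)

lemma comps_r0: "comps N 0 = {0}"
proof (rule equalityI; rule subsetI)
  fix \<beta> assume b: "\<beta> \<in> comps N 0"
  then have "\<forall>i\<in>{..<N}. \<beta> i = 0" using sum_nonneg_eq_0_iff[of "{..<N}" \<beta>] by (simp add: comps_def)
  then have "\<beta> i = 0" for i using b by (cases "i < N") (auto simp: comps_def)
  then show "\<beta> \<in> {0}" by auto
qed (auto simp: comps_def)

lemma comps_Suc:
  "comps (Suc N) (Suc r) = comps N (Suc r) \<union> (\<lambda>\<beta>. \<beta> + ev N 1) ` comps (Suc N) r"
proof (rule equalityI; rule subsetI)
  fix \<beta> assume b: "\<beta> \<in> comps (Suc N) (Suc r)"
  show "\<beta> \<in> comps N (Suc r) \<union> (\<lambda>\<beta>. \<beta> + ev N 1) ` comps (Suc N) r"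
  proof (cases "\<beta> N = 0")
    case True
    have "\<beta> i = 0" if "N \<le> i" for i using b True that by (cases "i = N") (auto simp: comps_def)
    then show ?thesis using b True by (auto simp: comps_def)
  next
    case False
    have "0 \<le> \<beta> N" using b by (simp add: comps_def)
    with False have "1 \<le> \<beta> N" by simp
    then have "\<beta> - ev N 1 \<in> comps (Suc N) r" using b False by (auto simp: comps_def ev_def)
    then show ?thesis by (intro UnI2 image_eqI[where x = "\<beta> - ev N 1"]) (auto simp: fun_eq_iff)
  qed
next
  fix \<beta> assume "\<beta> \<in> comps N (Suc r) \<union> (\<lambda>\<beta>. \<beta> + ev N 1) ` comps (Suc N) r"
  then show "\<beta> \<in> comps (Suc N) (Suc r)"
    by (auto simp: comps_def ev_def)
qed

lemma hsum_hrec: "hsum N r = hrec (\<lambda>i. xv i 1) N r"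
proof (induction "\<lambda>i. xv i 1" N r rule: hrec.induct)
  case (1 r)
  then show ?case by (simp add: hsum_def comps_0)
next
  case (2 N)
  then show ?case by (simp add: hsum_def comps_r0)
next
  case (3 N r)
  have "comps N (Suc r) \<inter> (\<lambda>\<beta>. \<beta> + ev N 1) ` comps (Suc N) r = {}"
  proof -
    have "(\<beta> + ev N 1) N \<noteq> 0" if "\<beta> \<in> comps (Suc N) r" for \<beta>
    proof -
      have "0 \<le> \<beta> N" using that by (simp add: comps_def)
      then show ?thesis by (simp add: ev_def)
    qed
    moreover have "\<beta> N = 0" if "\<beta> \<in> comps N (Suc r)" for \<beta> using that by (simp add: comps_def)
    ultimately show ?thesis by blast
  qed
  then have "hsum (Suc N) (Suc r) = hsum N (Suc r) + (\<Sum>\<beta>\<in>(\<lambda>\<beta>. \<beta> + ev N 1) ` comps (Suc N) r. Poly_Mapping.single \<beta> 1)"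
    unfolding hsum_def comps_Suc by (intro sum.union_disjoint) auto
  also have "(\<Sum>\<beta>\<in>(\<lambda>\<beta>. \<beta> + ev N 1) ` comps (Suc N) r. Poly_Mapping.single \<beta> 1) = xv N 1 * hsum (Suc N) r"
    by (subst sum.reindex) (auto simp: hsum_def xv_def mult_single sum_distrib_left inj_on_def add.commute)
  finally show ?case using 3 by simp
qed

lemma subsets_Suc:
  "{S. S \<subseteq> {..<Suc N} \<and> card S = Suc r} =
   {S. S \<subseteq> {..<N} \<and> card S = Suc r} \<union> insert N ` {S. S \<subseteq> {..<N} \<and> card S = r}"
proof (rule equalityI; rule subsetI)
  fix S assume "S \<in> {S. S \<subseteq> {..<Suc N} \<and> card S = Suc r}"
  then have S: "S \<subseteq> {..<Suc N}" "card S = Suc r" by auto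
  have fin: "finite S" using S(1) finite_subset by blast
  show "S \<in> {S. S \<subseteq> {..<N} \<and> card S = Suc r} \<union> insert N ` {S. S \<subseteq> {..<N} \<and> card S = r}"
  proof (cases "N \<in> S")
    case True
    then have "S = insert N (S - {N})" "S - {N} \<subseteq> {..<N}" "card (S - {N}) = r"
      using S fin by (auto simp: lessThan_Suc)
    then show ?thesis by blast
  next
    case False
    then show ?thesis using S by (auto simp: lessThan_Suc)
  qed
next
  fix S assume "S \<in> {S. S \<subseteq> {..<N} \<and> card S = Suc r} \<union> insert N ` {S. S \<subseteq> {..<N} \<and> card S = r}"
  then show "S \<in> {S. S \<subseteq> {..<Suc N} \<and> card S = Suc r}"
  proof
    assume "S \<in> insert N ` {S. S \<subseteq> {..<N} \<and> card S = r}"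
    then obtain T where T: "S = insert N T" "T \<subseteq> {..<N}" "card T = r" by blast
    then have "finite T" "N \<notin> T" using finite_subset[of T "{..<N}"] by auto
    then show ?thesis using T by (auto simp: lessThan_Suc)
  qed (auto simp: lessThan_Suc)
qed

lemma sum_subsets_erec:
  fixes x :: "nat \<Rightarrow> 'a::comm_ring_1"
  shows "(\<Sum>S | S \<subseteq> {..<N} \<and> card S = r. \<Prod>i\<in>S. x i) = erec x N r"
proof (induction x N r rule: erec.induct)
  case (1 x r)
  have "{S. S \<subseteq> {..<0::nat} \<and> card S = r} = (if r = 0 then {{}} else {})" by auto
  then show ?case by simp
next
  case (2 x N)
  have "{S. S \<subseteq> {..<Suc N} \<and> card S = 0} = {{}}" by (auto dest: finite_subset)
  then show ?case by simp
next
  case (3 x N r)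
  let ?A = "\<lambda>r. {S. S \<subseteq> {..<N} \<and> card S = r}"
  have fin: "finite (?A r)" for r by (rule finite_subset[of _ "Pow {..<N}"]) auto
  have "(\<Sum>S\<in>?A (Suc r) \<union> insert N ` ?A r. \<Prod>i\<in>S. x i) =
      (\<Sum>S\<in>?A (Suc r). \<Prod>i\<in>S. x i) + (\<Sum>S\<in>insert N ` ?A r. \<Prod>i\<in>S. x i)"
    using fin by (intro sum.union_disjoint) auto
  also have "(\<Sum>S\<in>insert N ` ?A r. \<Prod>i\<in>S. x i) = (\<Sum>S\<in>?A r. x N * (\<Prod>i\<in>S. x i))"
  proof (subst sum.reindex)
    show "inj_on (insert N) (?A r)" by (rule inj_onI) (metis (no_types, lifting) Diff_insert_absorb lessThan_iff less_irrefl mem_Collect_eq subsetD)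
    show "sum ((\<lambda>S. \<Prod>i\<in>S. x i) \<circ> insert N) (?A r) = (\<Sum>S\<in>?A r. x N * (\<Prod>i\<in>S. x i))"
    proof (intro sum.cong refl)
      fix S assume "S \<in> ?A r"
      then have "finite S" "N \<notin> S" using finite_subset[of S "{..<N}"] by auto
      then show "((\<lambda>S. \<Prod>i\<in>S. x i) \<circ> insert N) S = x N * (\<Prod>i\<in>S. x i)" by simp
    qed
  qed
  finally show ?case using 3 by (simp add: subsets_Suc sum_distrib_left[symmetric])
qed

lemma prod_xv: "finite S \<Longrightarrow> (\<Prod>i\<in>S. xv i 1) = Poly_Mapping.single (indi S) 1"
proof (induction S rule: finite_induct)
  case empty
  have "indi {} = 0" by (auto simp: indi_def)
  then show ?case by (simp only: prod.empty single_one)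
next
  case (insert i S)
  then have "ev i 1 + indi S = indi (insert i S)" by (auto simp: fun_eq_iff ev_def indi_def)
  then show ?case using insert by (simp add: xv_def mult_single)
qed

lemma esum_erec: "esum N r = erec (\<lambda>i. xv i 1) N r"
  unfolding esum_def sum_subsets_erec[symmetric]
  by (intro sum.cong refl) (auto intro!: prod_xv[symmetric] dest: finite_subset)

lemma bar_add: "bar (f + g) = bar f + bar g" by (rule poly_mapping_eqI) (simp add: lookup_add)

lemma bar_1 [simp]: "bar 1 = 1"
proof (rule poly_mapping_eqI)
  fix \<alpha> :: "nat \<Rightarrow> int"
  show "lcoeff (bar 1) \<alpha> = lcoeff 1 \<alpha>" by (simp add: lookup_one when_def)
qed

lemma bar_0 [simp]: "bar 0 = 0" by (rule poly_mapping_eqI) simp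

lemma bar_xv: "bar (xv i k) = xv i (- k)"
proof (rule poly_mapping_eqI)
  fix \<alpha> :: "nat \<Rightarrow> int"
  have "ev i k = - \<alpha> \<longleftrightarrow> ev i (- k) = \<alpha>" by (auto simp: ev_def fun_eq_iff)
  then show "lcoeff (bar (xv i k)) \<alpha> = lcoeff (xv i (- k)) \<alpha>" by (simp add: xv_def lookup_single when_def)
qed

lemma bar_hrec: "bar (hrec x N r) = hrec (\<lambda>i. bar (x i)) N r"
  by (induction x N r rule: hrec.induct) (simp_all add: bar_add bar_mult)

lemma bar_erec: "bar (erec x N r) = erec (\<lambda>i. bar (x i)) N r"
  by (induction x N r rule: erec.induct) (simp_all add: bar_add bar_mult)

lemma bar_prod: "bar (\<Prod>s\<in>S. f s) = (\<Prod>s\<in>S. bar (f s))"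
  by (induction S rule: infinite_finite_induct) (simp_all add: bar_mult)

lemma pspan_hsum: "hsum N r \<in> pspan N" "bar (hsum N r) \<in> pspan N"
  by (simp_all add: hsum_hrec bar_hrec bar_xv pspan_hrec_xv)

lemma pspan_esum: "esum N r \<in> pspan N" "bar (esum N r) \<in> pspan N"
  by (simp_all add: esum_erec bar_erec bar_xv pspan_erec_xv)

section \<open>Pieri coefficients in terms of partitions\<close>

definition shift :: "nat \<Rightarrow> (nat \<Rightarrow> nat) \<Rightarrow> nat \<Rightarrow> int" where
  "shift N \<rho> i = (if i < N then int (\<rho> i) + int (N - Suc i) else 0)"

text \<open>A strictly decreasing exponent of \<open>N\<close> entries has the form
  \<open>shift N \<rho>\<close> only if its last entry is not negative; this property provides
  that.\<close>

definition nonneg :: "laurent \<Rightarrow> bool" where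
  "nonneg f \<longleftrightarrow> (\<forall>\<alpha>. lcoeff f \<alpha> \<noteq> 0 \<longrightarrow> (\<forall>i. 0 \<le> \<alpha> i))"

lemma nonneg_mult: assumes "nonneg f" "nonneg g" shows "nonneg (f * g)"
  unfolding nonneg_def
proof (intro allI impI)
  fix \<alpha> i assume "lcoeff (f * g) \<alpha> \<noteq> 0"
  then have "(\<Sum>\<beta>\<in>lkeys f. lcoeff f \<beta> * lcoeff g (\<alpha> - \<beta>)) \<noteq> 0" unfolding lookup_mult .
  then obtain \<beta> where "lcoeff f \<beta> * lcoeff g (\<alpha> - \<beta>) \<noteq> 0"
    by (rule sum.not_neutral_contains_not_neutral)
  then have "lcoeff f \<beta> \<noteq> 0" "lcoeff g (\<alpha> - \<beta>) \<noteq> 0" by simp_all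
  then have "0 \<le> \<beta> i" "0 \<le> (\<alpha> - \<beta>) i" using assms unfolding nonneg_def by blast+
  then show "0 \<le> \<alpha> i" by simp
qed

lemma nonneg_vdm: "nonneg (vdm N)"
  unfolding nonneg_def
proof (intro allI impI)
  fix \<alpha> i assume nz: "lcoeff (vdm N) \<alpha> \<noteq> 0"
  show "0 \<le> \<alpha> i"
  proof (cases "i < N")
    case True
    then show ?thesis using vdm_exponent[OF nz] by blast
  next
    case False
    then show ?thesis using supp_vdm[of N] nz by (auto simp: supp_def)
  qed
qed

lemma nonneg_sum_single:
  assumes "\<And>s i. s \<in> S \<Longrightarrow> 0 \<le> b s i"
  shows "nonneg (\<Sum>s\<in>S. Poly_Mapping.single (b s) 1)"
  unfolding nonneg_def
proof (intro allI impI)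
  fix \<alpha> i assume "lcoeff (\<Sum>s\<in>S. Poly_Mapping.single (b s) 1) \<alpha> \<noteq> 0"
  then have "(\<Sum>s\<in>S. lcoeff (Poly_Mapping.single (b s) 1) \<alpha>) \<noteq> 0" by (simp add: lookup_sum)
  then obtain s where "s \<in> S" "lcoeff (Poly_Mapping.single (b s) 1) \<alpha> \<noteq> 0"
    by (rule sum.not_neutral_contains_not_neutral)
  then show "0 \<le> \<alpha> i" using assms by (auto simp: lookup_single when_def split: if_splits)
qed

lemma nonneg_hsum: "nonneg (hsum N r)"
  unfolding hsum_def by (rule nonneg_sum_single) (simp add: comps_def)

lemma nonneg_esum: "nonneg (esum N r)"
  unfolding esum_def by (rule nonneg_sum_single) (simp add: indi_def)

lemma nonneg_prod: "(\<And>s. s \<in> S \<Longrightarrow> nonneg (f s)) \<Longrightarrow> nonneg (\<Prod>s\<in>S. f s)"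
proof (induction S rule: infinite_finite_induct)
  case (insert x F)
  then show ?case by (simp add: nonneg_mult)
qed (auto simp: nonneg_def lookup_one when_def split: if_splits)

lemma strict_dec_shift: "antimono \<rho> \<Longrightarrow> strict_dec N (shift N \<rho>)"
  unfolding strict_dec_def
proof (intro allI impI)
  fix i j assume "antimono \<rho>" "i < j" "j < N"
  then show "shift N \<rho> j < shift N \<rho> i" using antimonoD[of \<rho> i j] by (simp add: shift_def)
qed

lemma lcoeff_vdm_shift:
  assumes "antimono \<rho>" "\<And>k. k \<ge> N \<Longrightarrow> \<rho> k = 0"
  shows "lcoeff (vdm N) (shift N \<rho>) = (if \<rho> = (\<lambda>_. 0) then lcoeff (vdm N) (staircase N) else 0)"
proof (cases "\<rho> = (\<lambda>_. 0)")
  case True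
  then have "shift N \<rho> = staircase N" by (auto simp: shift_def staircase_def fun_eq_iff)
  then show ?thesis using True by simp
next
  case False
  have "lcoeff (vdm N) (shift N \<rho>) = 0"
  proof (rule ccontr)
    assume "lcoeff (vdm N) (shift N \<rho>) \<noteq> 0"
    then have eq: "shift N \<rho> = staircase N" by (intro strict_dec_vdm strict_dec_shift assms)
    have "\<rho> k = 0" for k
    proof (cases "k < N")
      case True
      then show ?thesis using fun_cong[OF eq, of k] by (simp add: shift_def staircase_def)
    qed (use assms(2) in simp)
    then show False using False by auto
  qed
  then show ?thesis using False by simp
qed

lemma pieri_h_shift:
  assumes g: "asymm N g" "nonneg g" and \<rho>: "antimono \<rho>" "\<And>k. k \<ge> N \<Longrightarrow> \<rho> k = 0"
  shows "lcoeff (hsum N r * g) (shift N \<rho>) =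
    (\<Sum>\<kappa> | hstrip \<kappa> \<rho> \<and> psize \<rho> = psize \<kappa> + r. lcoeff g (shift N \<kappa>))"
proof -
  let ?a = "shift N \<rho>"
  let ?G = "{\<beta>\<in>comps N r. \<forall>i. Suc i < N \<longrightarrow> ?a (Suc i) < ?a i - \<beta> i}"
  let ?G' = "{\<beta>\<in>?G. \<forall>i. \<beta> i \<le> int (\<rho> i)}"
  let ?H = "{\<kappa>. hstrip \<kappa> \<rho> \<and> psize \<rho> = psize \<kappa> + r}"
  have good: "?a (Suc i) < ?a i - \<beta> i \<longleftrightarrow> int (\<rho> (Suc i)) \<le> int (\<rho> i) - \<beta> i" if "Suc i < N" for i \<beta>
  proof -
    have "int (N - Suc i) = int (N - Suc (Suc i)) + 1" using that by simp
    then show ?thesis using that by (auto simp: shift_def)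
  qed
  have "lcoeff (hsum N r * g) ?a = (\<Sum>\<beta>\<in>?G. lcoeff g (?a - \<beta>))"
    by (rule pieri_h[OF g(1) strict_dec_shift[OF \<rho>(1)]])
  also have "\<dots> = (\<Sum>\<beta>\<in>?G'. lcoeff g (?a - \<beta>))"
  proof (rule sum.mono_neutral_right)
    show "\<forall>\<beta>\<in>?G - ?G'. lcoeff g (?a - \<beta>) = 0"
    proof
      fix \<beta> assume b: "\<beta> \<in> ?G - ?G'"
      then obtain i where i: "\<not> \<beta> i \<le> int (\<rho> i)" by blast
      have "i < N" using i b by (auto simp: comps_def not_le intro: ccontr)
      \<comment> \<open>Before the last index, the inequality with the next exponent bounds
        \<open>\<beta> i\<close>. At the last index only nonnegativity of the exponents of
        \<open>g\<close> does.\<close>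
      moreover have "\<not> Suc i < N" using i b good[of i \<beta>] by auto
      ultimately have "(?a - \<beta>) i < 0" using i by (simp add: shift_def)
      then show "lcoeff g (?a - \<beta>) = 0" using g(2) unfolding nonneg_def by (meson not_le)
    qed
  qed auto
  also have "\<dots> = (\<Sum>\<kappa>\<in>?H. lcoeff g (shift N \<kappa>))"
  proof (rule sum.reindex_bij_witness[where j = "\<lambda>\<beta> i. \<rho> i - nat (\<beta> i)" and i = "\<lambda>\<kappa> i. int (\<rho> i) - int (\<kappa> i)"])
    fix \<beta> assume b: "\<beta> \<in> ?G'"
    then have pos: "0 \<le> \<beta> i" "\<beta> i \<le> int (\<rho> i)" "i \<ge> N \<Longrightarrow> \<beta> i = 0" for i by (auto simp: comps_def)
    let ?k = "\<lambda>i. \<rho> i - nat (\<beta> i)"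
    have k: "int (?k i) = int (\<rho> i) - \<beta> i" for i using pos[of i] by (simp add: of_nat_diff nat_le_iff)
    show "(\<lambda>i. int (\<rho> i) - int (?k i)) = \<beta>" by (simp only: k) auto
    have "\<rho> (Suc i) \<le> ?k i" for i
    proof (cases "Suc i < N")
      case True
      then have "int (\<rho> (Suc i)) \<le> int (?k i)" using b good[OF True, of \<beta>] unfolding k by auto
      then show ?thesis by simp
    next
      case False
      then show ?thesis using \<rho>(2)[of "Suc i"] by simp
    qed
    then have h: "hstrip ?k \<rho>" by (simp add: hstrip_def)
    have "int (psize \<rho>) = int (psize ?k) + int r"
    proof -
      have "int (psize ?k) = (\<Sum>i<N. int (?k i))" using \<rho>(2) by (subst psize_eq[of N]) auto
      also have "\<dots> = (\<Sum>i<N. int (\<rho> i)) - (\<Sum>i<N. \<beta> i)" by (simp only: k sum_subtractf)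
      also have "(\<Sum>i<N. \<beta> i) = int r" using b by (simp add: comps_def)
      also have "(\<Sum>i<N. int (\<rho> i)) = int (psize \<rho>)" using \<rho>(2) by (subst psize_eq[of N]) auto
      finally show ?thesis by simp
    qed
    then have "psize \<rho> = psize ?k + r" by linarith
    with h show "?k \<in> ?H" by simp
    have "shift N ?k = ?a - \<beta>"
    proof
      fix i show "shift N ?k i = (?a - \<beta>) i" using k[of i] pos(3)[of i] by (simp add: shift_def)
    qed
    then show "lcoeff g (shift N ?k) = lcoeff g (?a - \<beta>)" by simp
  next
    fix \<kappa> assume h: "\<kappa> \<in> ?H"
    then have le: "\<rho> (Suc i) \<le> \<kappa> i" "\<kappa> i \<le> \<rho> i" for i by (auto simp: hstrip_def)
    let ?b = "\<lambda>i. int (\<rho> i) - int (\<kappa> i)"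
    have k0: "\<kappa> i = 0" if "i \<ge> N" for i using le(2)[of i] \<rho>(2)[OF that] by simp
    have "(\<Sum>i<N. ?b i) = int (psize \<rho>) - int (psize \<kappa>)"
      using psize_eq[of N \<rho>, OF \<rho>(2)] psize_eq[of N \<kappa>, OF k0] by (simp add: sum_subtractf)
    then have "?b \<in> comps N r" using le h k0 \<rho>(2) by (auto simp: comps_def)
    then show "?b \<in> ?G'" using good[of _ ?b] le by auto
    show "(\<lambda>i. \<rho> i - nat (?b i)) = \<kappa>"
    proof
      fix i show "\<rho> i - nat (?b i) = \<kappa> i" using le(2)[of i] by (simp flip: of_nat_diff)
    qed
  qed
  finally show ?thesis .
qed

text \<open>No cancellation occurs here: lowering some exponents by 1 keeps a strictly decreasing
  sequence weakly decreasing. A result that is not of partition form therefore has two equal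
  exponents or a negative one, and its coefficient is zero.\<close>

lemma pieri_e_shift:
  assumes g: "asymm N g" "nonneg g" and \<rho>: "antimono \<rho>" "\<And>k. k \<ge> N \<Longrightarrow> \<rho> k = 0"
  shows "lcoeff (esum N r * g) (shift N \<rho>) =
    (\<Sum>\<kappa> | vstrip \<kappa> \<rho> \<and> antimono \<kappa> \<and> psize \<rho> = psize \<kappa> + r. lcoeff g (shift N \<kappa>))"
proof -
  let ?a = "shift N \<rho>"
  let ?G = "{S. S \<subseteq> {..<N} \<and> card S = r}"
  let ?G' = "{S\<in>?G. (\<forall>i\<in>S. 0 < \<rho> i) \<and> antimono (\<lambda>i. \<rho> i - (if i \<in> S then 1 else 0))}"
  let ?H = "{\<kappa>. vstrip \<kappa> \<rho> \<and> antimono \<kappa> \<and> psize \<rho> = psize \<kappa> + r}"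
  have "lcoeff (esum N r * g) ?a = (\<Sum>S\<in>?G. lcoeff g (?a - indi S))"
    by (rule lcoeff_esum_mult)
  also have "\<dots> = (\<Sum>S\<in>?G'. lcoeff g (?a - indi S))"
  proof (rule sum.mono_neutral_right)
    show "finite ?G" by (rule finite_subset[of _ "Pow {..<N}"]) auto
    show "\<forall>S\<in>?G - ?G'. lcoeff g (?a - indi S) = 0"
    proof
      fix S assume S: "S \<in> ?G - ?G'"
      show "lcoeff g (?a - indi S) = 0"
      proof (rule ccontr)
        assume nz: "lcoeff g (?a - indi S) \<noteq> 0"
        have inj: "inj_on (?a - indi S) {..<N}" by (rule asymm_inj[OF g(1) nz])
        have nn: "0 \<le> (?a - indi S) i" for i using g(2) nz unfolding nonneg_def by blast
        have am: "(if Suc i \<in> S then 0 else 1) + \<rho> (Suc i) \<le> \<rho> i + (if i \<in> S then 0 else 1)" for i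
        proof (cases "Suc i < N")
          case True
          have "\<rho> (Suc i) \<le> \<rho> i" using \<rho>(1) by (simp add: antimonoD)
          moreover have "(?a - indi S) i \<noteq> (?a - indi S) (Suc i)" using inj_onD[OF inj, of i "Suc i"] True by auto
          moreover have "int (N - Suc i) = int (N - Suc (Suc i)) + 1" using True by simp
          ultimately show ?thesis using True by (auto simp: shift_def indi_def split: if_splits)
        next
          case False
          have r: "\<rho> (Suc i) = 0" using \<rho>(2) False by simp
          have "i \<notin> S" if "\<rho> i = 0"
          proof
            assume "i \<in> S"
            then have "i < N" using S by auto
            then have "N - Suc i = 0" using False by simp
            then have "(?a - indi S) i < 0" using \<open>i \<in> S\<close> that \<open>i < N\<close> by (simp add: shift_def indi_def)
            then show False using nn[of i] by simp
          qed
          then show ?thesis using r by (cases "\<rho> i = 0") auto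
        qed
        have pos: "0 < \<rho> i" if "i \<in> S" for i
        proof (rule ccontr)
          assume "\<not> 0 < \<rho> i"
          then have z: "\<rho> i = 0" by simp
          have iN: "i < N" using S that by auto
          \<comment> \<open>A zero part in \<open>S\<close> forces the next part to be a zero part
            in \<open>S\<close>, and so on to the last index, whose exponent would be -1.\<close>
          have "\<rho> j = 0 \<and> j \<in> S" if "i \<le> j" "j < N" for j
            using that
          proof (induction j rule: dec_induct)
            case base
            then show ?case using z \<open>i \<in> S\<close> by simp
          next
            case (step j)
            then have j: "\<rho> j = 0" "j \<in> S" by auto
            then have "\<rho> (Suc j) = 0" "Suc j \<in> S" using am[of j] by (auto split: if_splits)
            then show ?case by simp
          qed
          from this[of "N - 1"] have "\<rho> (N - 1) = 0" "N - 1 \<in> S" using iN by auto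
          then have "(?a - indi S) (N - 1) < 0" using iN by (simp add: shift_def indi_def)
          then show False using nn[of "N - 1"] by simp
        qed
        have "antimono (\<lambda>i. \<rho> i - (if i \<in> S then 1 else 0))"
          unfolding antimono_iff_le_Suc
        proof
          fix i show "\<rho> (Suc i) - (if Suc i \<in> S then 1 else 0) \<le> \<rho> i - (if i \<in> S then 1 else 0)"
            using am[of i] pos[of i] pos[of "Suc i"] by (auto split: if_splits)
        qed
        then show False using S pos by auto
      qed
    qed
  qed auto
  also have "\<dots> = (\<Sum>\<kappa>\<in>?H. lcoeff g (shift N \<kappa>))"
  proof (rule sum.reindex_bij_witness[where j = "\<lambda>S i. \<rho> i - (if i \<in> S then 1 else 0)" and i = "\<lambda>\<kappa>. {i. \<kappa> i \<noteq> \<rho> i}"])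
    fix S assume S: "S \<in> ?G'"
    let ?k = "\<lambda>i. \<rho> i - (if i \<in> S then 1 else 0)"
    have pos: "0 < \<rho> i" "i < N" if "i \<in> S" for i using S that by auto
    show "{i. ?k i \<noteq> \<rho> i} = S" using pos by (auto split: if_splits) (metis diff_is_0_eq' less_irrefl less_numeral_extra(3) nat_less_le One_nat_def diff_less zero_less_one)
    have v: "vstrip ?k \<rho>" by (auto simp: vstrip_def)
    have "(\<Sum>i<N. ?k i + (if i \<in> S then 1 else 0)) = (\<Sum>i<N. \<rho> i)"
      using pos by (intro sum.cong) (auto simp: Suc_leI)
    moreover have "(\<Sum>i<N. if i \<in> S then 1 else 0) = r"
    proof -
      have "{..<N} \<inter> S = S" "card S = r" using S by auto
      then show ?thesis by (simp add: sum.If_cases)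
    qed
    moreover have "psize ?k = (\<Sum>i<N. ?k i)" using \<rho>(2) by (intro psize_eq) auto
    moreover have "psize \<rho> = (\<Sum>i<N. \<rho> i)" using \<rho>(2) by (intro psize_eq) auto
    ultimately have "psize \<rho> = psize ?k + r" by (simp add: sum.distrib)
    then show "?k \<in> ?H" using v S by simp
    have "shift N ?k = ?a - indi S"
    proof
      fix i show "shift N ?k i = (?a - indi S) i" using pos[of i] by (auto simp: shift_def indi_def of_nat_diff)
    qed
    then show "lcoeff g (shift N ?k) = lcoeff g (?a - indi S)" by simp
  next
    fix \<kappa> assume h: "\<kappa> \<in> ?H"
    let ?S = "{i. \<kappa> i \<noteq> \<rho> i}"
    have le: "\<kappa> i \<le> \<rho> i" "\<rho> i \<le> Suc (\<kappa> i)" for i using h by (auto simp: vstrip_def)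
    have k: "(\<lambda>i. \<rho> i - (if i \<in> ?S then 1 else 0)) = \<kappa>"
    proof
      fix i show "\<rho> i - (if i \<in> ?S then 1 else 0) = \<kappa> i" using le[of i] by auto
    qed
    then show "(\<lambda>i. \<rho> i - (if i \<in> ?S then 1 else 0)) = \<kappa>" .
    have k0: "\<kappa> i = 0" if "i \<ge> N" for i using le(1)[of i] \<rho>(2)[OF that] by simp
    have sub: "?S \<subseteq> {..<N}" using k0 \<rho>(2) by (auto intro: ccontr)
    have "(\<Sum>i<N. \<kappa> i + (if i \<in> ?S then 1 else 0)) = (\<Sum>i<N. \<rho> i)"
    proof (rule sum.cong[OF refl])
      fix i show "\<kappa> i + (if i \<in> ?S then 1 else 0) = \<rho> i" using le[of i] by auto
    qed
    moreover have "(\<Sum>i<N. if i \<in> ?S then 1 else 0) = card ?S"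
      using sub by (simp add: sum.If_cases Int_absorb1)
    moreover have "psize \<kappa> = (\<Sum>i<N. \<kappa> i)" using k0 by (intro psize_eq) auto
    moreover have "psize \<rho> = (\<Sum>i<N. \<rho> i)" using \<rho>(2) by (intro psize_eq) auto
    ultimately have "card ?S = r" using h by (simp add: sum.distrib)
    moreover have "0 < \<rho> i" if "i \<in> ?S" for i using that le[of i] by auto
    ultimately show "?S \<in> ?G'" using sub h k by auto
  qed
  finally show ?thesis .
qed

text \<open>\<open>a\<close> and \<open>b\<close> are the Schur coefficients of \<open>f\<close> and
  \<open>g\<close>, read off at the exponents \<open>shift N \<rho>\<close>. Nonnegativity of
  \<open>f\<close> makes every decreasing exponent of \<open>f * vdm N\<close> come from a
  partition, and \<open>sz\<close> leaves only partitions of \<open>s\<close>.\<close>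

lemma coefficient_pairing_parts:
  assumes f: "f \<in> pspan N" and g: "g \<in> pspan N" and bg: "bar g \<in> pspan N" and nn: "nonneg f"
    and cf: "\<And>\<rho>. antimono \<rho> \<Longrightarrow> (\<And>k. k \<ge> N \<Longrightarrow> \<rho> k = 0) \<Longrightarrow>
      lcoeff (f * vdm N) (shift N \<rho>) = of_nat (a \<rho>) * lcoeff (vdm N) (staircase N)"
    and cg: "\<And>\<rho>. antimono \<rho> \<Longrightarrow> (\<And>k. k \<ge> N \<Longrightarrow> \<rho> k = 0) \<Longrightarrow>
      lcoeff (g * vdm N) (shift N \<rho>) = of_nat (b \<rho>) * lcoeff (vdm N) (staircase N)"
    and sz: "\<And>\<rho>. a \<rho> \<noteq> 0 \<Longrightarrow> psize \<rho> = s"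
  shows "lcoeff (f * bar g * vdm N) (staircase N) =
    of_nat (\<Sum>\<rho>\<in>{\<rho> \<in> parts_of s. \<rho> N = 0}. a \<rho> * b \<rho>) * lcoeff (vdm N) (staircase N)"
proof -
  let ?V = "vdm N" and ?v = "lcoeff (vdm N) (staircase N)"
  let ?R = "{\<rho> \<in> parts_of s. \<rho> N = 0}" and ?K = "{\<alpha>\<in>lkeys (f * vdm N). strict_dec N \<alpha>}"
  have R: "antimono \<rho>" "k \<ge> N \<Longrightarrow> \<rho> k = 0" if "\<rho> \<in> ?R" for \<rho> k
    using that antimonoD[of \<rho> N k] by (auto simp: parts_of_def)
  have inj: "inj_on (shift N) ?R"
  proof (rule inj_onI, rule ext)
    fix \<rho> \<rho>' k assume *: "\<rho> \<in> ?R" "\<rho>' \<in> ?R" "shift N \<rho> = shift N \<rho>'"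
    show "\<rho> k = \<rho>' k"
    proof (cases "k < N")
      case True
      then show ?thesis using fun_cong[OF *(3), of k] by (simp add: shift_def)
    next
      case False
      then show ?thesis using R(2)[OF *(1)] R(2)[OF *(2)] by simp
    qed
  qed
  have sub: "?K \<subseteq> shift N ` ?R"
  proof
    fix \<alpha> assume \<alpha>: "\<alpha> \<in> ?K"
    then have nz: "lcoeff (f * ?V) \<alpha> \<noteq> 0" and sd: "strict_dec N \<alpha>" by (auto simp: in_keys_iff)
    have pos: "0 \<le> \<alpha> i" for i using nonneg_mult[OF nn nonneg_vdm[of N]] nz unfolding nonneg_def by blast
    have sup: "\<alpha> i = 0" if "i \<ge> N" for i
      using supp_mult[OF conjunct2[OF pspan_symm[OF f]] supp_vdm] nz that unfolding supp_def by blast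
    have lower: "int (N - Suc i) \<le> \<alpha> i" if "i < N" for i
    proof -
      have "int k \<le> \<alpha> (N - Suc k)" if "k < N" for k
        using that
      proof (induction k)
        case (Suc k)
        then have "\<alpha> (N - Suc k) < \<alpha> (N - Suc (Suc k))" using sd by (simp add: strict_dec_def)
        then show ?case using Suc by simp
      qed (use pos in auto)
      from this[of "N - Suc i"] show ?thesis using that by simp
    qed
    define \<rho> where "\<rho> i = (if i < N then nat (\<alpha> i - int (N - Suc i)) else 0)" for i
    have sh: "shift N \<rho> = \<alpha>"
    proof
      fix i show "shift N \<rho> i = \<alpha> i" using lower[of i] sup[of i] by (simp add: shift_def \<rho>_def)
    qed
    have am: "antimono \<rho>" unfolding antimono_iff_le_Suc
    proof
      fix i show "\<rho> (Suc i) \<le> \<rho> i"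
      proof (cases "Suc i < N")
        case True
        then have "\<alpha> (Suc i) < \<alpha> i" using sd by (simp add: strict_dec_def)
        moreover have "int (N - Suc i) = int (N - Suc (Suc i)) + 1" using True by simp
        ultimately show ?thesis using True by (simp add: \<rho>_def)
      qed (simp add: \<rho>_def)
    qed
    have r0: "\<rho> k = 0" if "k \<ge> N" for k using that by (simp add: \<rho>_def)
    have "a \<rho> \<noteq> 0" using cf[OF am r0] nz unfolding sh by (metis mult_zero_left of_nat_0)
    moreover have "finite {k. \<rho> k \<noteq> 0}" by (rule finite_subset[of _ "{..<N}"]) (auto simp: \<rho>_def)
    ultimately have "\<rho> \<in> ?R" using am sz r0[of N] by (simp add: parts_of_def)
    then show "\<alpha> \<in> shift N ` ?R" using sh by force
  qed
  have "lcoeff (f * bar g * ?V) (staircase N) * ?v = (\<Sum>\<alpha>\<in>?K. lcoeff (f * ?V) \<alpha> * lcoeff (g * ?V) \<alpha>)"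
    by (rule coefficient_pairing[OF f g bg])
  also have "\<dots> = (\<Sum>\<alpha>\<in>shift N ` ?R. lcoeff (f * ?V) \<alpha> * lcoeff (g * ?V) \<alpha>)"
  proof (rule sum.mono_neutral_left[OF _ sub])
    show "\<forall>\<alpha>\<in>shift N ` ?R - ?K. lcoeff (f * ?V) \<alpha> * lcoeff (g * ?V) \<alpha> = 0"
      using strict_dec_shift R(1) by (auto simp: in_keys_iff)
  qed simp
  also have "\<dots> = (\<Sum>\<rho>\<in>?R. lcoeff (f * ?V) (shift N \<rho>) * lcoeff (g * ?V) (shift N \<rho>))"
    by (subst sum.reindex[OF inj]) simp
  also have "\<dots> = (\<Sum>\<rho>\<in>?R. of_nat (a \<rho> * b \<rho>) * (?v * ?v))"
  proof (intro sum.cong refl)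
    fix \<rho> assume r: "\<rho> \<in> ?R"
    show "lcoeff (f * ?V) (shift N \<rho>) * lcoeff (g * ?V) (shift N \<rho>) = of_nat (a \<rho> * b \<rho>) * (?v * ?v)"
      by (simp add: cf[OF R(1)[OF r] R(2)[OF r]] cg[OF R(1)[OF r] R(2)[OF r]])
  qed
  also have "\<dots> = of_nat (\<Sum>\<rho>\<in>?R. a \<rho> * b \<rho>) * ?v * ?v"
    by (simp add: sum_distrib_right mult.assoc)
  finally show ?thesis using vdm_staircase[of N] by simp
qed

lemma pspan_hprod: "(\<Prod>i<m. hsum N (\<mu> i)) \<in> pspan N" "bar (\<Prod>i<m. hsum N (\<mu> i)) \<in> pspan N"
  unfolding bar_prod by (intro pspan_prod pspan_hsum)+

lemma pspan_eprod: "(\<Prod>i<m. esum N (\<mu> i)) \<in> pspan N" "bar (\<Prod>i<m. esum N (\<mu> i)) \<in> pspan N"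
  unfolding bar_prod by (intro pspan_prod pspan_esum)+

lemma asymm_pspan: "f \<in> pspan N \<Longrightarrow> asymm N (f * vdm N)"
  using pspan_symm asymm_vdm by (blast intro: asymm_mult)

text \<open>The Pieri rule and \<open>kostka\<close> follow the same recursion, one factor for each
  strip. The empty product leaves \<open>vdm N\<close>, whose only exponent of the form
  \<open>shift N \<rho>\<close> belongs to the zero partition.\<close>

lemma lcoeff_hprod:
  "antimono \<rho> \<Longrightarrow> (\<And>k. k \<ge> N \<Longrightarrow> \<rho> k = 0) \<Longrightarrow>
    lcoeff ((\<Prod>i<m. hsum N (\<mu> i)) * vdm N) (shift N \<rho>) = of_nat (kostka \<mu> m \<rho>) * lcoeff (vdm N) (staircase N)"
proof (induction m arbitrary: \<rho>)
  case 0
  then show ?case by (simp add: lcoeff_vdm_shift)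
next
  case (Suc m)
  let ?g = "(\<Prod>i<m. hsum N (\<mu> i)) * vdm N"
  have "lcoeff ((\<Prod>i<Suc m. hsum N (\<mu> i)) * vdm N) (shift N \<rho>) = lcoeff (hsum N (\<mu> m) * ?g) (shift N \<rho>)"
    by (simp add: mult_ac)
  also have "\<dots> = (\<Sum>\<kappa> | hstrip \<kappa> \<rho> \<and> psize \<rho> = psize \<kappa> + \<mu> m. lcoeff ?g (shift N \<kappa>))"
    by (rule pieri_h_shift) (auto intro!: asymm_pspan pspan_hprod nonneg_mult nonneg_prod nonneg_hsum nonneg_vdm Suc.prems)
  also have "\<dots> = (\<Sum>\<kappa> | hstrip \<kappa> \<rho> \<and> psize \<rho> = psize \<kappa> + \<mu> m. of_nat (kostka \<mu> m \<kappa>) * lcoeff (vdm N) (staircase N))"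
  proof (rule sum.cong[OF refl], rule Suc.IH)
    fix \<kappa> assume k: "\<kappa> \<in> {\<kappa>. hstrip \<kappa> \<rho> \<and> psize \<rho> = psize \<kappa> + \<mu> m}"
    then show "antimono \<kappa>" using antimono_hstrip_lower by blast
    show "\<kappa> i = 0" if "i \<ge> N" for i
    proof -
      have "\<kappa> i \<le> \<rho> i" using k by (simp add: hstrip_def)
      then show ?thesis using Suc.prems(2)[OF that] by simp
    qed
  qed
  finally show ?case by (simp add: sum_distrib_right)
qed

lemma lcoeff_eprod:
  "antimono \<rho> \<Longrightarrow> (\<And>k. k \<ge> N \<Longrightarrow> \<rho> k = 0) \<Longrightarrow>
    lcoeff ((\<Prod>i<m. esum N (\<mu> i)) * vdm N) (shift N \<rho>) = of_nat (vkostka \<mu> m \<rho>) * lcoeff (vdm N) (staircase N)"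
proof (induction m arbitrary: \<rho>)
  case 0
  then show ?case by (simp add: lcoeff_vdm_shift)
next
  case (Suc m)
  let ?g = "(\<Prod>i<m. esum N (\<mu> i)) * vdm N"
  have "lcoeff ((\<Prod>i<Suc m. esum N (\<mu> i)) * vdm N) (shift N \<rho>) = lcoeff (esum N (\<mu> m) * ?g) (shift N \<rho>)"
    by (simp add: mult_ac)
  also have "\<dots> = (\<Sum>\<kappa> | vstrip \<kappa> \<rho> \<and> antimono \<kappa> \<and> psize \<rho> = psize \<kappa> + \<mu> m. lcoeff ?g (shift N \<kappa>))"
    by (rule pieri_e_shift) (auto intro!: asymm_pspan pspan_eprod nonneg_mult nonneg_prod nonneg_esum nonneg_vdm Suc.prems)
  also have "\<dots> = (\<Sum>\<kappa> | vstrip \<kappa> \<rho> \<and> antimono \<kappa> \<and> psize \<rho> = psize \<kappa> + \<mu> m. of_nat (vkostka \<mu> m \<kappa>) * lcoeff (vdm N) (staircase N))"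
  proof (rule sum.cong[OF refl], rule Suc.IH)
    fix \<kappa> assume k: "\<kappa> \<in> {\<kappa>. vstrip \<kappa> \<rho> \<and> antimono \<kappa> \<and> psize \<rho> = psize \<kappa> + \<mu> m}"
    then show "antimono \<kappa>" by blast
    show "\<kappa> i = 0" if "i \<ge> N" for i
    proof -
      have "\<kappa> i \<le> \<rho> i" using k by (simp add: vstrip_def)
      then show ?thesis using Suc.prems(2)[OF that] by simp
    qed
  qed
  finally show ?case by (simp add: sum_distrib_right)
qed

lemma kostka_psize: "kostka \<mu> m \<rho> \<noteq> 0 \<Longrightarrow> psize \<rho> = (\<Sum>i<m. \<mu> i)"
proof (induction m arbitrary: \<rho>)
  case 0
  then show ?case by (auto split: if_splits)
next
  case (Suc m)
  from Suc.prems have "(\<Sum>\<kappa> | hstrip \<kappa> \<rho> \<and> psize \<rho> = psize \<kappa> + \<mu> m. kostka \<mu> m \<kappa>) \<noteq> 0" by simp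
  then obtain \<kappa> where "\<kappa> \<in> {\<kappa>. hstrip \<kappa> \<rho> \<and> psize \<rho> = psize \<kappa> + \<mu> m}" "kostka \<mu> m \<kappa> \<noteq> 0"
    by (rule sum.not_neutral_contains_not_neutral)
  then show ?case using Suc.IH[of \<kappa>] by simp
qed

lemma vkostka_psize: "vkostka \<mu> m \<rho> \<noteq> 0 \<Longrightarrow> psize \<rho> = (\<Sum>i<m. \<mu> i)"
proof (induction m arbitrary: \<rho>)
  case 0
  then show ?case by (auto split: if_splits)
next
  case (Suc m)
  from Suc.prems have "(\<Sum>\<kappa> | vstrip \<kappa> \<rho> \<and> antimono \<kappa> \<and> psize \<rho> = psize \<kappa> + \<mu> m. vkostka \<mu> m \<kappa>) \<noteq> 0" by simp
  then obtain \<kappa> where "\<kappa> \<in> {\<kappa>. vstrip \<kappa> \<rho> \<and> antimono \<kappa> \<and> psize \<rho> = psize \<kappa> + \<mu> m}" "vkostka \<mu> m \<kappa> \<noteq> 0"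
    by (rule sum.not_neutral_contains_not_neutral)
  then show ?case using Suc.IH[of \<kappa>] by simp
qed

theorem pairing_hsum:
  "lcoeff ((\<Prod>i<m. hsum N (\<mu> i)) * bar (\<Prod>j<n. hsum N (\<nu> j)) * vdm N) (staircase N) =
   of_nat (\<Sum>\<rho>\<in>{\<rho> \<in> parts_of (\<Sum>i<m. \<mu> i). \<rho> N = 0}. kostka \<mu> m \<rho> * kostka \<nu> n \<rho>) * lcoeff (vdm N) (staircase N)"
  by (rule coefficient_pairing_parts)
    (auto intro!: pspan_hprod nonneg_prod nonneg_hsum lcoeff_hprod kostka_psize)

theorem pairing_esum:
  "lcoeff ((\<Prod>i<m. esum N (\<mu> i)) * bar (\<Prod>j<n. esum N (\<nu> j)) * vdm N) (staircase N) =
   of_nat (\<Sum>\<rho>\<in>{\<rho> \<in> parts_of (\<Sum>i<m. \<mu> i). \<rho> N = 0}. vkostka \<mu> m \<rho> * vkostka \<nu> n \<rho>) * lcoeff (vdm N) (staircase N)"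
  by (rule coefficient_pairing_parts)
    (auto intro!: pspan_eprod nonneg_prod nonneg_esum lcoeff_eprod vkostka_psize)

subsection \<open>Evaluation\<close>

text \<open>Integer powers obey the exponent law only at nonzero numbers; hence the hypothesis in
  the lemmas on products.\<close>

definition leval :: "(nat \<Rightarrow> complex) \<Rightarrow> nat \<Rightarrow> laurent \<Rightarrow> complex" where
  "leval x N f = (\<Sum>\<alpha>\<in>lkeys f. lcoeff f \<alpha> * (\<Prod>i<N. x i powi \<alpha> i))"

lemma leval_superset:
  "finite K \<Longrightarrow> lkeys f \<subseteq> K \<Longrightarrow> leval x N f = (\<Sum>\<alpha>\<in>K. lcoeff f \<alpha> * (\<Prod>i<N. x i powi \<alpha> i))"
  unfolding leval_def by (rule sum.mono_neutral_left) (auto simp: in_keys_iff)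

lemma leval_add: "leval x N (f + g) = leval x N f + leval x N g"
proof -
  have "leval x N h = (\<Sum>\<alpha>\<in>lkeys f \<union> lkeys g. lcoeff h \<alpha> * (\<Prod>i<N. x i powi \<alpha> i))"
    if "h \<in> {f, g, f + g}" for h
    using that keys_add[of f g] by (intro leval_superset) auto
  then show ?thesis by (simp add: lookup_add distrib_right sum.distrib)
qed

lemma leval_single: "leval x N (Poly_Mapping.single \<beta> c) = c * (\<Prod>i<N. x i powi \<beta> i)"
  by (subst leval_superset[of "{\<beta>}"]) auto

lemma leval_0 [simp]: "leval x N 0 = 0" by (simp add: leval_def)

lemma leval_sum: "leval x N (\<Sum>s\<in>S. f s) = (\<Sum>s\<in>S. leval x N (f s))"
  by (induction S rule: infinite_finite_induct) (simp_all add: leval_add)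

lemma sum_monomials: "(\<Sum>\<beta>\<in>lkeys f. Poly_Mapping.single \<beta> (lcoeff f \<beta>)) = f"
proof (rule poly_mapping_eqI)
  fix \<alpha>
  have "(\<Sum>\<beta>\<in>lkeys f. lcoeff (Poly_Mapping.single \<beta> (lcoeff f \<beta>)) \<alpha>) = (\<Sum>\<beta>\<in>lkeys f. if \<beta> = \<alpha> then lcoeff f \<beta> else 0)"
    by (intro sum.cong) (auto simp: lookup_single when_def)
  then show "lcoeff (\<Sum>\<beta>\<in>lkeys f. Poly_Mapping.single \<beta> (lcoeff f \<beta>)) \<alpha> = lcoeff f \<alpha>"
    by (simp add: lookup_sum in_keys_iff)
qed

lemma leval_single_mult:
  assumes "\<And>i. i < N \<Longrightarrow> x i \<noteq> 0"
  shows "leval x N (Poly_Mapping.single \<beta> c * g) = leval x N (Poly_Mapping.single \<beta> c) * leval x N g"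
proof -
  have "Poly_Mapping.single \<beta> c * g = (\<Sum>\<gamma>\<in>lkeys g. Poly_Mapping.single (\<beta> + \<gamma>) (c * lcoeff g \<gamma>))"
    by (subst (1) sum_monomials[symmetric]) (simp add: sum_distrib_left mult_single)
  then show ?thesis
    using assms by (simp add: leval_sum leval_single power_int_add prod.distrib sum_distrib_left leval_def[of x N g] mult_ac)
qed

lemma leval_mult:
  assumes "\<And>i. i < N \<Longrightarrow> x i \<noteq> 0"
  shows "leval x N (f * g) = leval x N f * leval x N g"
proof -
  have "f * g = (\<Sum>\<beta>\<in>lkeys f. Poly_Mapping.single \<beta> (lcoeff f \<beta>) * g)"
    by (subst (1) sum_monomials[symmetric]) (simp add: sum_distrib_right)
  then have "leval x N (f * g) = (\<Sum>\<beta>\<in>lkeys f. leval x N (Poly_Mapping.single \<beta> (lcoeff f \<beta>))) * leval x N g"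
    using assms by (simp add: leval_sum leval_single_mult sum_distrib_right)
  also have "(\<Sum>\<beta>\<in>lkeys f. leval x N (Poly_Mapping.single \<beta> (lcoeff f \<beta>))) = leval x N f"
    unfolding leval_single by (simp add: leval_def)
  finally show ?thesis .
qed

lemma leval_cst: "leval x N (cst c) = c" by (simp add: cst_def leval_single)

lemma leval_1 [simp]: "leval x N 1 = 1" using leval_cst[of x N 1] by (simp add: cst_simps)

lemma leval_of_int [simp]: "leval x N (of_int k) = of_int k"
  by (simp add: leval_cst flip: cst_of_int)

lemma leval_xv: "i < N \<Longrightarrow> leval x N (xv i k) = x i powi k"
proof -
  assume i: "i < N"
  have "(\<Prod>j<N. x j powi ev i k j) = (\<Prod>j<N. if j = i then x i powi k else 1)"
    by (intro prod.cong) (auto simp: ev_def)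
  then show ?thesis using i by (simp add: xv_def leval_single)
qed

lemma leval_psum: "leval x N (psum N k) = (\<Sum>i<N. x i powi k)"
  by (simp add: psum_def leval_sum leval_xv)

lemma leval_prod:
  assumes "\<And>i. i < N \<Longrightarrow> x i \<noteq> 0"
  shows "leval x N (\<Prod>s\<in>S. f s) = (\<Prod>s\<in>S. leval x N (f s))"
  by (induction S rule: infinite_finite_induct) (simp_all add: leval_mult assms)

lemma leval_uminus: "leval x N (- f) = - leval x N f"
  using leval_add[of x N f "- f"] by (simp add: add_eq_0_iff)

lemma hrec_hom:
  assumes "h 0 = 0" "h 1 = 1" "\<And>f g. h (f + g) = h f + h g" "\<And>f g. h (f * g) = h f * h g"
  shows "h (hrec x N r) = hrec (\<lambda>i. h (x i)) N r" "h (erec x N r) = erec (\<lambda>i. h (x i)) N r"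
proof -
  show "h (hrec x N r) = hrec (\<lambda>i. h (x i)) N r" by (induction x N r rule: hrec.induct) (simp_all add: assms)
  show "h (erec x N r) = erec (\<lambda>i. h (x i)) N r" by (induction x N r rule: erec.induct) (simp_all add: assms)
qed

lemma hrec_cong: "(\<And>i. i < N \<Longrightarrow> x i = y i) \<Longrightarrow> hrec x N r = hrec y N r"
  by (induction x N r rule: hrec.induct) auto

lemma erec_cong: "(\<And>i. i < N \<Longrightarrow> x i = y i) \<Longrightarrow> erec x N r = erec y N r"
  by (induction x N r rule: erec.induct) auto

lemma leval_hsum:
  assumes "\<And>i. i < N \<Longrightarrow> x i \<noteq> 0"
  shows "leval x N (hsum N r) = hrec x N r" "leval x N (bar (hsum N r)) = hrec (\<lambda>i. inverse (x i)) N r"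
proof -
  have hom: "leval x N (hrec y N r) = hrec (\<lambda>i. leval x N (y i)) N r" for y
    by (rule hrec_hom) (simp_all add: leval_add leval_mult assms)
  show "leval x N (hsum N r) = hrec x N r" unfolding hsum_hrec hom
    by (rule hrec_cong) (simp add: leval_xv)
  show "leval x N (bar (hsum N r)) = hrec (\<lambda>i. inverse (x i)) N r" unfolding hsum_hrec bar_hrec bar_xv hom
    by (rule hrec_cong) (simp add: leval_xv power_int_minus)
qed

lemma leval_esum:
  assumes "\<And>i. i < N \<Longrightarrow> x i \<noteq> 0"
  shows "leval x N (esum N r) = erec x N r" "leval x N (bar (esum N r)) = erec (\<lambda>i. inverse (x i)) N r"
proof -
  have hom: "leval x N (erec y N r) = erec (\<lambda>i. leval x N (y i)) N r" for y
    by (rule hrec_hom) (simp_all add: leval_add leval_mult assms)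
  show "leval x N (esum N r) = erec x N r" unfolding esum_erec hom
    by (rule erec_cong) (simp add: leval_xv)
  show "leval x N (bar (esum N r)) = erec (\<lambda>i. inverse (x i)) N r" unfolding esum_erec bar_erec bar_xv hom
    by (rule erec_cong) (simp add: leval_xv power_int_minus)
qed

section \<open>Derivatives along left translations of the unitary group\<close>

lemma unitary_group_iff: "U \<in> unitary_group \<longleftrightarrow> adjoint_matrix U ** U = mat 1 \<and> U ** adjoint_matrix U = mat 1"
  by (simp add: unitary_group_def)

lemma adjoint_matrix_mult: "adjoint_matrix (A ** B) = adjoint_matrix B ** adjoint_matrix A"
  by (simp add: adjoint_matrix_def matrix_matrix_mult_def vec_eq_iff mult.commute)

lemma unitary_group_mult: "U \<in> unitary_group \<Longrightarrow> V \<in> unitary_group \<Longrightarrow> U ** V \<in> unitary_group"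
  unfolding unitary_group_iff adjoint_matrix_mult by (metis matrix_mul_assoc matrix_mul_lid)

lemma unitary_entry_le_1:
  assumes "U \<in> unitary_group" shows "norm (U $ i $ j) \<le> 1"
proof -
  have "(adjoint_matrix U ** U) $ j $ j = 1" using assms by (simp add: unitary_group_iff mat_def)
  then have "(\<Sum>k\<in>UNIV. cnj (U $ k $ j) * U $ k $ j) = 1" by (simp add: adjoint_matrix_def matrix_matrix_mult_def)
  moreover have "cnj z * z = complex_of_real ((norm z)\<^sup>2)" for z by (metis complex_norm_square mult.commute)
  ultimately have "complex_of_real (\<Sum>k\<in>UNIV. (norm (U $ k $ j))\<^sup>2) = 1" by simp
  then have "(\<Sum>k\<in>UNIV. (norm (U $ k $ j))\<^sup>2) = 1" using of_real_eq_1_iff by blast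
  moreover have "(norm (U $ i $ j))\<^sup>2 \<le> (\<Sum>k\<in>UNIV. (norm (U $ k $ j))\<^sup>2)"
    by (rule member_le_sum) auto
  ultimately have "(norm (U $ i $ j))\<^sup>2 \<le> 1\<^sup>2" by simp
  then show ?thesis by (rule power2_le_imp_le) simp
qed

lemma continuous_matrix_entry: "continuous_on S (\<lambda>U::complex^'n^'m. U $ i $ j)"
  by (intro continuous_intros)

lemma continuous_matrix_mult:
  fixes f g :: "'a::topological_space \<Rightarrow> complex^'n^'n"
  assumes "continuous_on S f" "continuous_on S g"
  shows "continuous_on S (\<lambda>x. f x ** g x)"
  unfolding matrix_matrix_mult_def using assms by (intro continuous_intros)

lemma continuous_adjoint: "continuous_on S (adjoint_matrix :: complex^'n^'n \<Rightarrow> _)"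
  unfolding adjoint_matrix_def by (intro continuous_intros)

lemma compact_unitary_group: "compact (unitary_group :: (complex^'n^'n) set)"
proof -
  have "closed {U :: complex^'n^'n. adjoint_matrix U ** U = mat 1}" "closed {U :: complex^'n^'n. U ** adjoint_matrix U = mat 1}"
    by (intro closed_Collect_eq continuous_matrix_mult continuous_adjoint continuous_on_id continuous_on_const)+
  then have "closed (unitary_group :: (complex^'n^'n) set)"
    unfolding unitary_group_def Collect_conj_eq by (rule closed_Int)
  moreover have "bounded (unitary_group :: (complex^'n^'n) set)"
  proof (rule boundedI)
    fix U :: "complex^'n^'n" assume U: "U \<in> unitary_group"
    have row: "norm (U $ i) \<le> real CARD('n)" for i
    proof -
      have "norm (U $ i) \<le> (\<Sum>j\<in>UNIV. norm (U $ i $ j))" unfolding norm_vec_def by (rule L2_set_le_sum) simp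
      also have "\<dots> \<le> (\<Sum>j\<in>(UNIV::'n set). 1)" by (intro sum_mono unitary_entry_le_1 U)
      finally show ?thesis by simp
    qed
    have "norm U \<le> (\<Sum>i\<in>UNIV. norm (U $ i))" unfolding norm_vec_def[of U] by (rule L2_set_le_sum) simp
    also have "\<dots> \<le> (\<Sum>i\<in>(UNIV::'n set). real CARD('n))" by (intro sum_mono row)
    finally show "norm U \<le> real CARD('n) * real CARD('n)" by simp
  qed
  ultimately show ?thesis by (simp add: compact_eq_bounded_closed)
qed

lemma bounded_on_unitary:
  fixes F :: "complex^'n^'n \<Rightarrow> complex"
  assumes "continuous_on UNIV F"
  obtains B where "B \<ge> 0" "\<And>U. U \<in> unitary_group \<Longrightarrow> norm (F U) \<le> B"
proof -
  have "bounded (F ` unitary_group)"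
    using compact_continuous_image[OF continuous_on_subset[OF assms subset_UNIV] compact_unitary_group]
    by (rule compact_imp_bounded)
  then obtain B where "\<forall>x\<in>F ` unitary_group. norm x \<le> B" unfolding bounded_iff by blast
  then have "norm (F U) \<le> max B 0" if "U \<in> unitary_group" for U using that by (simp add: le_max_iff_disj)
  then show thesis using that[of "max B 0"] by simp
qed

text \<open>A rational parametrisation of the unit circle keeps the remainder estimates elementary.\<close>

definition cayley :: "real \<Rightarrow> complex" where
  "cayley t = (1 + \<i> * (t / 2)) / (1 - \<i> * (t / 2))"

text \<open>The identity plus a multiple of the projection to \<open>v\<close>: for a unit vector
  this is the unitary map with eigenvalue \<open>cayley t\<close> on \<open>v\<close> and 1 on its
  orthogonal complement. Its derivative at \<open>t = 0\<close> is \<open>\<i>\<close> times the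
  projection.\<close>

definition reflection :: "('n \<Rightarrow> complex) \<Rightarrow> real \<Rightarrow> complex^'n^'n" where
  "reflection v t = (\<chi> i j. (if i = j then 1 else 0) + (cayley t - 1) * (v i * cnj (v j)))"

lemma cayley_denom: "1 - \<i> * (complex_of_real t / 2) \<noteq> 0" "1 + \<i> * (complex_of_real t / 2) \<noteq> 0"
  by (auto simp: complex_eq_iff)

lemma cayley_unit: "cayley t * cnj (cayley t) = 1"
  using cayley_denom[of t] by (simp add: cayley_def)

text \<open>The error is exactly \<open>- (t^2 / 2)\<close> divided by the denominator of
  \<open>cayley t\<close>, whose real part is 1.\<close>

lemma cayley_approx: "norm (cayley t - 1 - \<i> * t) \<le> t\<^sup>2"
proof -
  define d where "d = 1 - \<i> * (complex_of_real t / 2)"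
  have "d \<noteq> 0" using cayley_denom[of t] by (simp add: d_def)
  then have "(cayley t - 1 - \<i> * t) * d = - (complex_of_real (t\<^sup>2 / 2))"
    unfolding cayley_def d_def[symmetric] by (simp add: left_diff_distrib) (simp add: d_def field_simps power2_eq_square)
  then have "norm (cayley t - 1 - \<i> * t) * norm d = norm (- complex_of_real (t\<^sup>2 / 2))" by (metis norm_mult)
  then have "norm (cayley t - 1 - \<i> * t) = t\<^sup>2 / 2 / norm (1 - \<i> * (complex_of_real t / 2))"
    using \<open>d \<noteq> 0\<close> unfolding norm_minus_cancel norm_of_real d_def[symmetric] by (subst nonzero_eq_divide_eq) auto
  moreover have "1 \<le> norm (1 - \<i> * (complex_of_real t / 2))"
    using complex_Re_le_cmod[of "1 - \<i> * (complex_of_real t / 2)"] by simp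
  then have "t\<^sup>2 / 2 / norm (1 - \<i> * (complex_of_real t / 2)) \<le> t\<^sup>2 / 2 / 1"
    by (intro divide_left_mono) auto
  moreover have "t\<^sup>2 / 2 / 1 \<le> t\<^sup>2" by simp
  ultimately show ?thesis by linarith
qed

lemma reflection_unitary:
  fixes v :: "'n::finite \<Rightarrow> complex"
  assumes v: "(\<Sum>a\<in>UNIV. v a * cnj (v a)) = 1"
  shows "reflection v t \<in> unitary_group"
proof -
  define c where "c = cayley t - 1"
  have c: "c + cnj c + c * cnj c = 0" using cayley_unit[of t] by (simp add: c_def algebra_simps)
  have *: "(\<Sum>k\<in>UNIV. ((if i = k then 1 else 0) + d * (v i * cnj (v k))) * ((if k = j then 1 else 0) + e * (v k * cnj (v j))))
      = (if i = j then 1 else 0) + (d + e + d * e) * (v i * cnj (v j))" for i j :: 'n and d e :: complex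
  proof -
    have "(\<Sum>k\<in>UNIV. ((if i = k then 1 else 0) + d * (v i * cnj (v k))) * ((if k = j then 1 else 0) + e * (v k * cnj (v j))))
      = (\<Sum>k\<in>UNIV. (if i = k then (if i = j then 1 else 0) + e * (v i * cnj (v j)) else 0)
         + (if k = j then d * (v i * cnj (v j)) else 0) + d * e * v i * cnj (v j) * (v k * cnj (v k)))"
      by (intro sum.cong refl) (auto simp: algebra_simps)
    also have "\<dots> = (if i = j then 1 else 0) + e * (v i * cnj (v j)) + d * (v i * cnj (v j)) + d * e * v i * cnj (v j)"
      by (simp add: sum.distrib sum_distrib_left[symmetric] v)
    finally show ?thesis by (simp add: algebra_simps)
  qed
  have adj: "adjoint_matrix (reflection v t) = (\<chi> i j. (if i = j then 1 else 0) + cnj c * (v i * cnj (v j)))"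
    by (auto simp: adjoint_matrix_def reflection_def c_def vec_eq_iff mult.commute)
  show ?thesis unfolding unitary_group_iff adj
    using *[where d = "cnj c" and e = c] *[where d = c and e = "cnj c"] c
    by (auto simp: reflection_def c_def[symmetric] matrix_matrix_mult_def mat_def vec_eq_iff add_ac mult.commute)
qed

text \<open>\<open>D a b\<close> is the derivative of \<open>F\<close> along the vector field \<open>U \<mapsto> E\<^sub>a\<^sub>b U\<close>, extended linearly over \<open>\<complex>\<close>.
  It suffices to test it on \<open>i v v\<^sup>*\<close> for unit vectors \<open>v\<close>, which span by polarisation, and the uniform remainder
  makes differentiation commute with the integral.\<close>

definition has_ld :: "(complex^'n^'n \<Rightarrow> complex) \<Rightarrow> ('n \<Rightarrow> 'n \<Rightarrow> complex^'n^'n \<Rightarrow> complex) \<Rightarrow> bool" where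
  "has_ld F D \<longleftrightarrow> continuous_on UNIV F \<and> (\<forall>a b. continuous_on UNIV (D a b)) \<and>
     (\<forall>v. (\<Sum>a\<in>UNIV. v a * cnj (v a)) = 1 \<longrightarrow> (\<exists>C. \<forall>U\<in>unitary_group. \<forall>t. \<bar>t\<bar> \<le> 1 \<longrightarrow>
        norm (F (reflection v t ** U) - F U - \<i> * t * (\<Sum>a\<in>UNIV. \<Sum>b\<in>UNIV. v a * cnj (v b) * D a b U)) \<le> C * t\<^sup>2))"

lemma has_ldI:
  assumes "continuous_on UNIV F" "\<And>a b. continuous_on UNIV (D a b)"
    and "\<And>v. (\<Sum>a\<in>UNIV. v a * cnj (v a)) = 1 \<Longrightarrow> \<exists>C. \<forall>U\<in>unitary_group. \<forall>t. \<bar>t\<bar> \<le> 1 \<longrightarrow>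
        norm (F (reflection v t ** U) - F U - \<i> * t * (\<Sum>a\<in>UNIV. \<Sum>b\<in>UNIV. v a * cnj (v b) * D a b U)) \<le> C * t\<^sup>2"
  shows "has_ld F D"
  using assms unfolding has_ld_def by blast

lemma has_ld_const: "has_ld (\<lambda>_. c) (\<lambda>_ _ _. 0)"
  by (rule has_ldI) (auto intro: exI[of _ 0])

lemma has_ld_entry:
  fixes i j :: "'n::finite"
  shows "has_ld (\<lambda>U. U $ i $ j) (\<lambda>a b U. if a = i then U $ b $ j else 0)"
proof (rule has_ldI)
  show "continuous_on UNIV (\<lambda>U. if a = i then U $ b $ j else (0::complex))" for a b :: 'n
    by (cases "a = i") (simp_all add: continuous_matrix_entry)
  fix v :: "'n \<Rightarrow> complex"
  let ?C = "norm (v i) * (\<Sum>b\<in>UNIV. norm (v b))"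
  show "\<exists>C. \<forall>U\<in>unitary_group. \<forall>t. \<bar>t\<bar> \<le> 1 \<longrightarrow>
     norm ((reflection v t ** U) $ i $ j - U $ i $ j -
       \<i> * t * (\<Sum>a\<in>UNIV. \<Sum>b\<in>UNIV. v a * cnj (v b) * (if a = i then U $ b $ j else 0))) \<le> C * t\<^sup>2"
  proof (intro exI[of _ ?C] ballI allI impI)
    fix U :: "complex^'n^'n" and t :: real assume U: "U \<in> unitary_group"
    let ?S = "v i * (\<Sum>b\<in>UNIV. cnj (v b) * U $ b $ j)"
    have 1: "(reflection v t ** U) $ i $ j = U $ i $ j + (cayley t - 1) * ?S"
    proof -
      have "(reflection v t ** U) $ i $ j =
        (\<Sum>k\<in>UNIV. (if i = k then U $ i $ j else 0) + (cayley t - 1) * (v i * (cnj (v k) * U $ k $ j)))"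
        unfolding reflection_def matrix_matrix_mult_def by (auto intro!: sum.cong simp: algebra_simps)
      then show ?thesis by (simp add: sum.distrib sum_distrib_left)
    qed
    have 2: "(\<Sum>a\<in>UNIV. \<Sum>b\<in>UNIV. v a * cnj (v b) * (if a = i then U $ b $ j else 0)) = ?S"
    proof -
      have "(\<Sum>b\<in>UNIV. v a * cnj (v b) * (if a = i then U $ b $ j else 0)) = (if a = i then ?S else 0)" for a
        by (simp add: sum_distrib_left mult.assoc)
      then show ?thesis by simp
    qed
    have "norm ?S \<le> norm (v i) * (\<Sum>b\<in>UNIV. norm (v b) * 1)"
      unfolding norm_mult by (intro mult_left_mono sum_norm_le order.refl)
        (auto simp: norm_mult intro!: mult_left_le unitary_entry_le_1[OF U])
    then have "norm ((cayley t - 1 - \<i> * t) * ?S) \<le> t\<^sup>2 * ?C"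
      unfolding norm_mult[of "cayley t - 1 - \<i> * t"] using cayley_approx[of t] by (intro mult_mono) auto
    moreover have "(reflection v t ** U) $ i $ j - U $ i $ j -
       \<i> * t * (\<Sum>a\<in>UNIV. \<Sum>b\<in>UNIV. v a * cnj (v b) * (if a = i then U $ b $ j else 0)) = (cayley t - 1 - \<i> * t) * ?S"
      unfolding 1 2 by (simp add: algebra_simps)
    ultimately show "norm ((reflection v t ** U) $ i $ j - U $ i $ j -
       \<i> * t * (\<Sum>a\<in>UNIV. \<Sum>b\<in>UNIV. v a * cnj (v b) * (if a = i then U $ b $ j else 0))) \<le> ?C * t\<^sup>2"
      by (simp add: mult.commute)
  qed
qed (rule continuous_matrix_entry)

text \<open>Conjugation turns \<open>\<i>\<close> into \<open>- \<i>\<close> and exchanges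
  \<open>v a\<close> with \<open>cnj (v a)\<close>. Writing the result again as a form in
  \<open>v a * cnj (v b)\<close> exchanges the indices and changes the sign.\<close>

lemma has_ld_cnj:
  fixes F :: "complex^'n^'n \<Rightarrow> complex"
  assumes "has_ld F D" shows "has_ld (\<lambda>U. cnj (F U)) (\<lambda>a b U. - cnj (D b a U))"
proof (rule has_ldI)
  show "continuous_on UNIV (\<lambda>U. cnj (F U))" using assms by (auto simp: has_ld_def intro: continuous_intros)
  show "continuous_on UNIV (\<lambda>U. - cnj (D b a U))" for a b using assms by (auto simp: has_ld_def intro!: continuous_intros)
  fix v :: "'n \<Rightarrow> complex" assume "(\<Sum>a\<in>UNIV. v a * cnj (v a)) = 1"
  then obtain C where C: "\<And>U t. U \<in> unitary_group \<Longrightarrow> \<bar>t\<bar> \<le> 1 \<Longrightarrow>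
        norm (F (reflection v t ** U) - F U - \<i> * t * (\<Sum>a\<in>UNIV. \<Sum>b\<in>UNIV. v a * cnj (v b) * D a b U)) \<le> C * t\<^sup>2"
    using assms unfolding has_ld_def by blast
  show "\<exists>C. \<forall>U\<in>unitary_group. \<forall>t. \<bar>t\<bar> \<le> 1 \<longrightarrow>
     norm (cnj (F (reflection v t ** U)) - cnj (F U) -
       \<i> * t * (\<Sum>a\<in>UNIV. \<Sum>b\<in>UNIV. v a * cnj (v b) * (- cnj (D b a U)))) \<le> C * t\<^sup>2"
  proof (intro exI[of _ C] ballI allI impI)
    fix U :: "complex^'n^'n" and t :: real assume *: "U \<in> unitary_group" "\<bar>t\<bar> \<le> 1"
    have "(\<Sum>a\<in>UNIV. \<Sum>b\<in>UNIV. v a * cnj (v b) * (- cnj (D b a U))) =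
        - (\<Sum>b\<in>UNIV. \<Sum>a\<in>UNIV. v a * cnj (v b) * cnj (D b a U))"
      by (subst sum.swap) (simp add: sum_negf)
    also have "\<dots> = - cnj (\<Sum>b\<in>UNIV. \<Sum>a\<in>UNIV. v b * cnj (v a) * D b a U)" by (simp add: mult.commute mult.left_commute)
    finally have "cnj (F (reflection v t ** U)) - cnj (F U) -
       \<i> * t * (\<Sum>a\<in>UNIV. \<Sum>b\<in>UNIV. v a * cnj (v b) * (- cnj (D b a U))) =
      cnj (F (reflection v t ** U) - F U - \<i> * t * (\<Sum>a\<in>UNIV. \<Sum>b\<in>UNIV. v a * cnj (v b) * D a b U))"
      by simp
    then show "norm (cnj (F (reflection v t ** U)) - cnj (F U) -
       \<i> * t * (\<Sum>a\<in>UNIV. \<Sum>b\<in>UNIV. v a * cnj (v b) * (- cnj (D b a U)))) \<le> C * t\<^sup>2"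
      using C[OF *] by (simp only: complex_mod_cnj)
  qed
qed

lemma has_ld_add:
  fixes F :: "complex^'n^'n \<Rightarrow> complex"
  assumes "has_ld F D" "has_ld G E" shows "has_ld (\<lambda>U. F U + G U) (\<lambda>a b U. D a b U + E a b U)"
proof (rule has_ldI)
  show "continuous_on UNIV (\<lambda>U. F U + G U)" using assms by (auto simp: has_ld_def intro: continuous_intros)
  show "continuous_on UNIV (\<lambda>U. D a b U + E a b U)" for a b using assms by (auto simp: has_ld_def intro!: continuous_intros)
  fix v :: "'n \<Rightarrow> complex" assume v: "(\<Sum>a\<in>UNIV. v a * cnj (v a)) = 1"
  let ?D = "\<lambda>U. \<Sum>a\<in>UNIV. \<Sum>b\<in>UNIV. v a * cnj (v b) * D a b U" and ?E = "\<lambda>U. \<Sum>a\<in>UNIV. \<Sum>b\<in>UNIV. v a * cnj (v b) * E a b U"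
  obtain C where C: "\<And>U t. U \<in> unitary_group \<Longrightarrow> \<bar>t\<bar> \<le> 1 \<Longrightarrow>
        norm (F (reflection v t ** U) - F U - \<i> * t * ?D U) \<le> C * t\<^sup>2"
    using assms(1) v unfolding has_ld_def by blast
  obtain C' where C': "\<And>U t. U \<in> unitary_group \<Longrightarrow> \<bar>t\<bar> \<le> 1 \<Longrightarrow>
        norm (G (reflection v t ** U) - G U - \<i> * t * ?E U) \<le> C' * t\<^sup>2"
    using assms(2) v unfolding has_ld_def by blast
  have DE: "(\<Sum>a\<in>UNIV. \<Sum>b\<in>UNIV. v a * cnj (v b) * (D a b U + E a b U)) = ?D U + ?E U" for U
    by (simp add: distrib_left sum.distrib)
  show "\<exists>C. \<forall>U\<in>unitary_group. \<forall>t. \<bar>t\<bar> \<le> 1 \<longrightarrow>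
     norm (F (reflection v t ** U) + G (reflection v t ** U) - (F U + G U) -
       \<i> * t * (\<Sum>a\<in>UNIV. \<Sum>b\<in>UNIV. v a * cnj (v b) * (D a b U + E a b U))) \<le> C * t\<^sup>2"
    unfolding DE
  proof (intro exI[of _ "C + C'"] ballI allI impI)
    fix U :: "complex^'n^'n" and t :: real assume *: "U \<in> unitary_group" "\<bar>t\<bar> \<le> 1"
    have "F (reflection v t ** U) + G (reflection v t ** U) - (F U + G U) - \<i> * t * (?D U + ?E U) =
       (F (reflection v t ** U) - F U - \<i> * t * ?D U) + (G (reflection v t ** U) - G U - \<i> * t * ?E U)"
      by (simp add: algebra_simps)
    also have "norm \<dots> \<le> C * t\<^sup>2 + C' * t\<^sup>2" by (rule norm_triangle_le[OF add_mono[OF C[OF *] C'[OF *]]])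
    finally show "norm (F (reflection v t ** U) + G (reflection v t ** U) - (F U + G U) - \<i> * t * (?D U + ?E U)) \<le> (C + C') * t\<^sup>2"
      by (simp add: distrib_right)
  qed
qed

lemma has_ld_mult:
  fixes F :: "complex^'n^'n \<Rightarrow> complex"
  assumes "has_ld F D" "has_ld G E"
  shows "has_ld (\<lambda>U. F U * G U) (\<lambda>a b U. D a b U * G U + F U * E a b U)"
proof (rule has_ldI)
  have cont: "continuous_on UNIV F" "continuous_on UNIV G" "\<And>a b. continuous_on UNIV (D a b)" "\<And>a b. continuous_on UNIV (E a b)"
    using assms by (auto simp: has_ld_def)
  show "continuous_on UNIV (\<lambda>U. F U * G U)" using cont by (auto intro: continuous_intros)
  show "continuous_on UNIV (\<lambda>U. D a b U * G U + F U * E a b U)" for a b using cont by (auto intro!: continuous_intros)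
  fix v :: "'n \<Rightarrow> complex" assume v: "(\<Sum>a\<in>UNIV. v a * cnj (v a)) = 1"
  let ?D = "\<lambda>U. \<Sum>a\<in>UNIV. \<Sum>b\<in>UNIV. v a * cnj (v b) * D a b U" and ?E = "\<lambda>U. \<Sum>a\<in>UNIV. \<Sum>b\<in>UNIV. v a * cnj (v b) * E a b U"
  obtain C where C: "\<And>U t. U \<in> unitary_group \<Longrightarrow> \<bar>t\<bar> \<le> 1 \<Longrightarrow>
        norm (F (reflection v t ** U) - F U - \<i> * t * ?D U) \<le> C * t\<^sup>2"
    using assms(1) v unfolding has_ld_def by blast
  obtain C' where C': "\<And>U t. U \<in> unitary_group \<Longrightarrow> \<bar>t\<bar> \<le> 1 \<Longrightarrow>
        norm (G (reflection v t ** U) - G U - \<i> * t * ?E U) \<le> C' * t\<^sup>2"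
    using assms(2) v unfolding has_ld_def by blast
  have "continuous_on UNIV ?D" using cont by (intro continuous_intros)
  then obtain BD where BD: "BD \<ge> 0" "\<And>U. U \<in> unitary_group \<Longrightarrow> norm (?D U) \<le> BD"
    by (rule bounded_on_unitary) blast
  have "continuous_on UNIV ?E" using cont by (intro continuous_intros)
  then obtain BE where BE: "BE \<ge> 0" "\<And>U. U \<in> unitary_group \<Longrightarrow> norm (?E U) \<le> BE"
    by (rule bounded_on_unitary) blast
  obtain BF where BF: "BF \<ge> 0" "\<And>U. U \<in> unitary_group \<Longrightarrow> norm (F U) \<le> BF"
    using bounded_on_unitary[OF cont(1)] by blast
  obtain BG where BG: "BG \<ge> 0" "\<And>U. U \<in> unitary_group \<Longrightarrow> norm (G U) \<le> BG"
    using bounded_on_unitary[OF cont(2)] by blast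
  have DE: "(\<Sum>a\<in>UNIV. \<Sum>b\<in>UNIV. v a * cnj (v b) * (D a b U * G U + F U * E a b U)) = ?D U * G U + F U * ?E U" for U
    by (simp add: distrib_left sum.distrib sum_distrib_left sum_distrib_right mult_ac)
  show "\<exists>C. \<forall>U\<in>unitary_group. \<forall>t. \<bar>t\<bar> \<le> 1 \<longrightarrow>
     norm (F (reflection v t ** U) * G (reflection v t ** U) - F U * G U -
       \<i> * t * (\<Sum>a\<in>UNIV. \<Sum>b\<in>UNIV. v a * cnj (v b) * (D a b U * G U + F U * E a b U))) \<le> C * t\<^sup>2"
    unfolding DE
  proof (intro exI[of _ "C * BG + (BF + BD) * C' + BD * BE"] ballI allI impI)
    fix U :: "complex^'n^'n" and t :: real assume *: "U \<in> unitary_group" "\<bar>t\<bar> \<le> 1"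
    define F1 where "F1 = F (reflection v t ** U)"
    define G1 where "G1 = G (reflection v t ** U)"
    define R where "R = F1 - F U - \<i> * t * ?D U"
    define S where "S = G1 - G U - \<i> * t * ?E U"
    have RU: "reflection v t ** U \<in> unitary_group" by (intro unitary_group_mult reflection_unitary v *)
    have nR: "norm R \<le> C * t\<^sup>2" unfolding R_def F1_def by (rule C[OF *])
    have nS: "norm S \<le> C' * t\<^sup>2" unfolding S_def G1_def by (rule C'[OF *])
    have C0: "0 \<le> C * t\<^sup>2" using nR norm_ge_zero[of R] by linarith
    \<comment> \<open>Both factors are split into value, linear term and remainder. Each error term
      contains a remainder times a bounded quantity, except the product of the two linear terms,
      which is itself of order \<open>t^2\<close>.\<close>
    have eq: "F1 * G1 - F U * G U - \<i> * t * (?D U * G U + F U * ?E U) =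
       R * G1 + (F U + \<i> * t * ?D U) * S + (\<i> * t * ?D U) * (\<i> * t * ?E U)"
      unfolding R_def S_def by (simp add: algebra_simps)
    have tD: "norm (\<i> * t * ?D U) \<le> \<bar>t\<bar> * BD" unfolding norm_mult using BD(2)[OF *(1)] by (simp add: mult_left_mono)
    have tE: "norm (\<i> * t * ?E U) \<le> \<bar>t\<bar> * BE" unfolding norm_mult using BE(2)[OF *(1)] by (simp add: mult_left_mono)
    have "\<bar>t\<bar> * BD \<le> 1 * BD" using *(2) BD(1) by (rule mult_right_mono)
    then have FD: "norm (F U + \<i> * t * ?D U) \<le> BF + BD"
      using norm_triangle_le[OF add_mono[OF BF(2)[OF *(1)] tD]] by simp
    have "norm (R * G1) \<le> C * t\<^sup>2 * BG" unfolding norm_mult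
      using nR BG(2)[OF RU] C0 by (intro mult_mono) (auto simp: G1_def)
    moreover have "norm ((F U + \<i> * t * ?D U) * S) \<le> (BF + BD) * (C' * t\<^sup>2)" unfolding norm_mult[of "F U + \<i> * t * ?D U"]
      using FD nS BF(1) BD(1) by (intro mult_mono) auto
    moreover have "norm ((\<i> * t * ?D U) * (\<i> * t * ?E U)) \<le> (\<bar>t\<bar> * BD) * (\<bar>t\<bar> * BE)"
      unfolding norm_mult[of "\<i> * t * ?D U"] using tD tE BD(1) by (intro mult_mono) auto
    ultimately have "norm (R * G1 + (F U + \<i> * t * ?D U) * S + (\<i> * t * ?D U) * (\<i> * t * ?E U)) \<le>
        C * t\<^sup>2 * BG + (BF + BD) * (C' * t\<^sup>2) + (\<bar>t\<bar> * BD) * (\<bar>t\<bar> * BE)"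
      by (intro norm_triangle_le add_mono) auto
    also have "(\<bar>t\<bar> * BD) * (\<bar>t\<bar> * BE) = BD * BE * t\<^sup>2" 
    proof -
      have "(\<bar>t\<bar> * BD) * (\<bar>t\<bar> * BE) = (BD * BE) * (\<bar>t\<bar> * \<bar>t\<bar>)" by (simp only: mult_ac)
      also have "\<bar>t\<bar> * \<bar>t\<bar> = t\<^sup>2" by (simp add: power2_eq_square)
      finally show ?thesis .
    qed
    also have "C * t\<^sup>2 * BG + (BF + BD) * (C' * t\<^sup>2) + BD * BE * t\<^sup>2 = (C * BG + (BF + BD) * C' + BD * BE) * t\<^sup>2"
      by (simp add: algebra_simps)
    finally show "norm (F (reflection v t ** U) * G (reflection v t ** U) - F U * G U - \<i> * t * (?D U * G U + F U * ?E U))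
        \<le> (C * BG + (BF + BD) * C' + BD * BE) * t\<^sup>2"
      unfolding F1_def[symmetric] G1_def[symmetric] eq .
  qed
qed

lemma has_ld_cong:
  assumes "has_ld F D" "\<And>U. F U = F' U" "\<And>a b U. D a b U = D' a b U"
  shows "has_ld F' D'"
proof -
  have "F = F'" "D = D'" using assms by (auto intro!: ext)
  then show ?thesis using assms(1) by simp
qed

lemma has_ld_sum:
  "(\<And>s. s \<in> S \<Longrightarrow> has_ld (F s) (D s)) \<Longrightarrow> has_ld (\<lambda>U. \<Sum>s\<in>S. F s U) (\<lambda>a b U. \<Sum>s\<in>S. D s a b U)"
  by (induction S rule: infinite_finite_induct) (auto intro: has_ld_const has_ld_add)

lemma has_ld_prod:
  assumes "finite S" "\<And>s. s \<in> S \<Longrightarrow> has_ld (F s) (D s)"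
  shows "has_ld (\<lambda>U. \<Prod>s\<in>S. F s U) (\<lambda>a b U. \<Sum>s\<in>S. D s a b U * (\<Prod>t\<in>S - {s}. F t U))"
  using assms
proof (induction S rule: finite_induct)
  case empty
  then show ?case using has_ld_const by simp
next
  case (insert x S)
  have 1: "(\<Prod>t\<in>insert x S - {s}. F t U) = F x U * (\<Prod>t\<in>S - {s}. F t U)" if "s \<in> S" for s U
  proof -
    have "insert x S - {s} = insert x (S - {s})" using that insert by auto
    then show ?thesis using insert by simp
  qed
  have 2: "insert x S - {x} = S" using insert by auto
  have "has_ld (\<lambda>U. F x U * (\<Prod>s\<in>S. F s U))
      (\<lambda>a b U. D x a b U * (\<Prod>s\<in>S. F s U) + F x U * (\<Sum>s\<in>S. D s a b U * (\<Prod>t\<in>S - {s}. F t U)))"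
    using insert by (intro has_ld_mult) auto
  then show ?case
    by (rule has_ld_cong) (use insert 1 2 in \<open>auto simp: sum_distrib_left mult_ac intro!: sum.cong\<close>)
qed

section \<open>Integer powers of a matrix, their derivatives and traces\<close>

fun mpow :: "nat \<Rightarrow> complex^'n^'n \<Rightarrow> complex^'n^'n" where
  "mpow 0 U = mat 1"
| "mpow (Suc k) U = U ** mpow k U"

text \<open>Negative powers are powers of the adjoint. This is continuous on all matrices and gives
  the powers of the inverse on the unitary group.\<close>

definition zpow :: "int \<Rightarrow> complex^'n^'n \<Rightarrow> complex^'n^'n" where
  "zpow k U = (if k \<ge> 0 then mpow (nat k) U else mpow (nat (- k)) (adjoint_matrix U))"

definition ptrace :: "complex^'n^'n \<Rightarrow> int \<Rightarrow> complex" where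
  "ptrace U k = trace (zpow k U)"

lemma mpow_add: "mpow (k + l) U = mpow k U ** mpow l U"
  by (induction k) (simp_all add: matrix_mul_assoc[symmetric])

lemma has_ld_mat_1: "has_ld (\<lambda>U. (mat 1 :: complex^'n^'n) $ i $ j) (\<lambda>a b U. 0)"
  by (rule has_ld_const)

text \<open>Along \<open>U \<mapsto> E_ab U\<close> the derivative of the power is the sum of
  \<open>U^r E_ab U^(n-r)\<close>, one summand for each differentiated factor.\<close>

lemma has_ld_mpow:
  fixes i j :: "'n::finite"
  shows "has_ld (\<lambda>U. mpow n U $ i $ j) (\<lambda>a b U. \<Sum>r<n. mpow r U $ i $ a * mpow (n - r) U $ b $ j)"
proof (induction n arbitrary: i j)
  case 0
  then show ?case by (simp add: has_ld_mat_1)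
next
  case (Suc n)
  have "has_ld (\<lambda>U. \<Sum>l\<in>UNIV. U $ i $ l * mpow n U $ l $ j)
    (\<lambda>a b U. \<Sum>l\<in>UNIV. (if a = i then U $ b $ l else 0) * mpow n U $ l $ j +
       U $ i $ l * (\<Sum>r<n. mpow r U $ l $ a * mpow (n - r) U $ b $ j))"
    by (intro has_ld_sum has_ld_mult has_ld_entry Suc)
  then show ?case
  proof (rule has_ld_cong)
    fix U :: "complex^'n^'n"
    show "(\<Sum>l\<in>UNIV. U $ i $ l * mpow n U $ l $ j) = mpow (Suc n) U $ i $ j"
      by (simp add: matrix_matrix_mult_def)
    fix a b :: 'n
    have 1: "(\<Sum>l\<in>UNIV. (if a = i then U $ b $ l else 0) * mpow n U $ l $ j) = mpow 0 U $ i $ a * mpow (Suc n) U $ b $ j"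
      by (simp add: matrix_matrix_mult_def mat_def)
    have 2: "(\<Sum>l\<in>UNIV. U $ i $ l * (\<Sum>r<n. mpow r U $ l $ a * mpow (n - r) U $ b $ j)) =
       (\<Sum>r<n. mpow (Suc r) U $ i $ a * mpow (Suc n - Suc r) U $ b $ j)"
    proof -
      have "(\<Sum>l\<in>UNIV. U $ i $ l * (\<Sum>r<n. mpow r U $ l $ a * mpow (n - r) U $ b $ j)) =
         (\<Sum>r<n. \<Sum>l\<in>UNIV. U $ i $ l * mpow r U $ l $ a * mpow (n - r) U $ b $ j)"
        by (subst sum.swap) (simp add: sum_distrib_left mult.assoc)
      then show ?thesis by (simp add: matrix_matrix_mult_def sum_distrib_right)
    qed
    show "(\<Sum>l\<in>UNIV. (if a = i then U $ b $ l else 0) * mpow n U $ l $ j +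
       U $ i $ l * (\<Sum>r<n. mpow r U $ l $ a * mpow (n - r) U $ b $ j)) =
      (\<Sum>r<Suc n. mpow r U $ i $ a * mpow (Suc n - r) U $ b $ j)"
      unfolding sum.distrib 1 2 by (subst sum.lessThan_Suc_shift) simp
  qed
qed

lemma has_ld_adjoint_entry:
  fixes i j :: "'n::finite"
  shows "has_ld (\<lambda>U. adjoint_matrix U $ i $ j) (\<lambda>a b U. - (adjoint_matrix U $ i $ a * (if b = j then 1 else 0)))"
  by (rule has_ld_cong[OF has_ld_cnj[OF has_ld_entry[of j i]]]) (auto simp: adjoint_matrix_def)

text \<open>The adjoint behaves like the inverse: its derivative is minus itself times
  \<open>E_ab\<close>. The matrix unit now stands behind the differentiated factor, so
  \<open>r\<close> runs from 1 to \<open>n\<close>.\<close>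

lemma has_ld_mpow_adjoint:
  fixes i j :: "'n::finite"
  shows "has_ld (\<lambda>U. mpow n (adjoint_matrix U) $ i $ j)
    (\<lambda>a b U. - (\<Sum>r=1..n. mpow r (adjoint_matrix U) $ i $ a * mpow (n - r) (adjoint_matrix U) $ b $ j))"
proof (induction n arbitrary: i j)
  case 0
  then show ?case by (simp add: has_ld_mat_1)
next
  case (Suc n)
  let ?W = "adjoint_matrix :: complex^'n^'n \<Rightarrow> _"
  have "has_ld (\<lambda>U. \<Sum>l\<in>UNIV. ?W U $ i $ l * mpow n (?W U) $ l $ j)
    (\<lambda>a b U. \<Sum>l\<in>UNIV. - (?W U $ i $ a * (if b = l then 1 else 0)) * mpow n (?W U) $ l $ j +
       ?W U $ i $ l * - (\<Sum>r=1..n. mpow r (?W U) $ l $ a * mpow (n - r) (?W U) $ b $ j))"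
    by (intro has_ld_sum has_ld_mult has_ld_adjoint_entry Suc)
  then show ?case
  proof (rule has_ld_cong)
    fix U :: "complex^'n^'n"
    show "(\<Sum>l\<in>UNIV. ?W U $ i $ l * mpow n (?W U) $ l $ j) = mpow (Suc n) (?W U) $ i $ j"
      by (simp add: matrix_matrix_mult_def)
    fix a b :: 'n
    have 1: "(\<Sum>l\<in>UNIV. - (?W U $ i $ a * (if b = l then 1 else 0)) * mpow n (?W U) $ l $ j) =
       - (mpow 1 (?W U) $ i $ a * mpow (Suc n - 1) (?W U) $ b $ j)"
    proof -
      have "- (?W U $ i $ a * (if b = l then 1 else 0)) * mpow n (?W U) $ l $ j =
         (if b = l then - (?W U $ i $ a * mpow n (?W U) $ b $ j) else 0)" for l by simp
      then show ?thesis by simp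
    qed
    have 2: "(\<Sum>l\<in>UNIV. ?W U $ i $ l * - (\<Sum>r=1..n. mpow r (?W U) $ l $ a * mpow (n - r) (?W U) $ b $ j)) =
       - (\<Sum>r=1..n. mpow (Suc r) (?W U) $ i $ a * mpow (Suc n - Suc r) (?W U) $ b $ j)"
    proof -
      have "(\<Sum>l\<in>UNIV. ?W U $ i $ l * (\<Sum>r=1..n. mpow r (?W U) $ l $ a * mpow (n - r) (?W U) $ b $ j)) =
         (\<Sum>r=1..n. \<Sum>l\<in>UNIV. ?W U $ i $ l * mpow r (?W U) $ l $ a * mpow (n - r) (?W U) $ b $ j)"
        by (subst sum.swap) (simp add: sum_distrib_left mult.assoc)
      then show ?thesis by (simp add: matrix_matrix_mult_def sum_distrib_right sum_negf)
    qed
    have 3: "(\<Sum>r=1..Suc n. Q r) = Q 1 + (\<Sum>r=1..n. Q (Suc r))" for Q :: "nat \<Rightarrow> complex"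
      by (induction n) (simp_all add: add.assoc)
    show "(\<Sum>l\<in>UNIV. - (?W U $ i $ a * (if b = l then 1 else 0)) * mpow n (?W U) $ l $ j +
       ?W U $ i $ l * - (\<Sum>r=1..n. mpow r (?W U) $ l $ a * mpow (n - r) (?W U) $ b $ j)) =
      - (\<Sum>r=1..Suc n. mpow r (?W U) $ i $ a * mpow (Suc n - r) (?W U) $ b $ j)"
      unfolding sum.distrib 1 2 3 by simp
  qed
qed

definition dzpow :: "int \<Rightarrow> 'n \<Rightarrow> 'n \<Rightarrow> 'n \<Rightarrow> 'n \<Rightarrow> complex^'n^'n \<Rightarrow> complex" where
  "dzpow k i j a b U = (if k \<ge> 0 then \<Sum>r<nat k. mpow r U $ i $ a * mpow (nat k - r) U $ b $ j
     else - (\<Sum>r=1..nat (- k). mpow r (adjoint_matrix U) $ i $ a * mpow (nat (- k) - r) (adjoint_matrix U) $ b $ j))"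

lemma has_ld_zpow: "has_ld (\<lambda>U. zpow k U $ i $ j) (dzpow k i j)"
proof (cases "k \<ge> 0")
  case True
  have "has_ld (\<lambda>U. zpow k U $ i $ j) (\<lambda>a b U. dzpow k i j a b U)"
    by (rule has_ld_cong[OF has_ld_mpow[of "nat k" i j]]) (simp_all add: zpow_def dzpow_def True)
  then show ?thesis .
next
  case False
  have "has_ld (\<lambda>U. zpow k U $ i $ j) (\<lambda>a b U. dzpow k i j a b U)"
    by (rule has_ld_cong[OF has_ld_mpow_adjoint[of "nat (- k)" i j]]) (simp_all only: zpow_def dzpow_def False if_False)
  then show ?thesis .
qed

text \<open>By cyclicity of the trace, all positions of the matrix unit contribute equally.\<close>

lemma dzpow_trace: "(\<Sum>i\<in>UNIV. dzpow k i i a b U) = of_int k * zpow k U $ b $ a"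
proof -
  have *: "(\<Sum>i\<in>UNIV. mpow r V $ i $ a * mpow (n - r) V $ b $ i) = mpow n V $ b $ a" if "r \<le> n" for r n V
  proof -
    have "mpow n V = mpow (n - r) V ** mpow r V" using mpow_add[of "n - r" r V] that by simp
    then show ?thesis by (simp add: matrix_matrix_mult_def mult.commute)
  qed
  show ?thesis
  proof (cases "k \<ge> 0")
    case True
    have "(\<Sum>i\<in>UNIV. dzpow k i i a b U) = (\<Sum>r<nat k. \<Sum>i\<in>UNIV. mpow r U $ i $ a * mpow (nat k - r) U $ b $ i)"
      using True by (simp add: dzpow_def sum.swap[of _ "{..<nat k}"])
    also have "\<dots> = (\<Sum>r<nat k. mpow (nat k) U $ b $ a)" by (intro sum.cong refl *) simp
    finally show ?thesis using True by (simp add: zpow_def)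
  next
    case False
    let ?W = "adjoint_matrix U"
    have "(\<Sum>i\<in>UNIV. dzpow k i i a b U) = - (\<Sum>r=1..nat (- k). \<Sum>i\<in>UNIV. mpow r ?W $ i $ a * mpow (nat (- k) - r) ?W $ b $ i)"
      using False by (simp add: dzpow_def sum.swap[of _ "{Suc 0..nat (- k)}"] sum_negf)
    also have "\<dots> = - (\<Sum>r=1..nat (- k). mpow (nat (- k)) ?W $ b $ a)"
      by (intro arg_cong[where f = uminus] sum.cong refl *) simp
    finally show ?thesis using False by (simp add: zpow_def)
  qed
qed

text \<open>When the entry and the direction have the same indices \<open>a\<close>,
  \<open>b\<close>, summation splits each term into a product of two traces.\<close>

lemma dzpow_double_trace: "(\<Sum>a\<in>UNIV. \<Sum>b\<in>UNIV. dzpow k a b a b U) = loopsum (ptrace U) k"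
proof -
  have tr: "(\<Sum>a\<in>UNIV. \<Sum>b\<in>UNIV. A $ a $ a * B $ b $ b) = trace A * trace B" for A B :: "complex^'n^'n"
    by (simp add: trace_def sum_product)
  show ?thesis
  proof (cases "k > 0")
    case True
    have "(\<Sum>a\<in>UNIV. \<Sum>b\<in>UNIV. dzpow k a b a b U) =
       (\<Sum>a\<in>UNIV. \<Sum>r<nat k. \<Sum>b\<in>UNIV. mpow r U $ a $ a * mpow (nat k - r) U $ b $ b)"
      using True by (simp add: dzpow_def sum.swap[of _ "{..<nat k}"])
    also have "\<dots> = (\<Sum>r<nat k. \<Sum>a\<in>UNIV. \<Sum>b\<in>UNIV. mpow r U $ a $ a * mpow (nat k - r) U $ b $ b)"
      by (rule sum.swap)
    also have "\<dots> = (\<Sum>r<nat k. ptrace U (int r) * ptrace U (k - int r))"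
      unfolding tr by (intro sum.cong refl) (auto simp: ptrace_def zpow_def nat_diff_distrib)
    finally show ?thesis using True by (simp add: loopsum_def)
  next
    case False
    let ?W = "adjoint_matrix U"
    show ?thesis
    proof (cases "k = 0")
      case True
      then show ?thesis by (simp add: dzpow_def loopsum_def)
    next
      case k: False
      have "(\<Sum>a\<in>UNIV. \<Sum>b\<in>UNIV. dzpow k a b a b U) =
         - (\<Sum>a\<in>UNIV. \<Sum>r=1..nat (- k). \<Sum>b\<in>UNIV. mpow r ?W $ a $ a * mpow (nat (- k) - r) ?W $ b $ b)"
        using False k by (simp add: dzpow_def sum.swap[of _ "{Suc 0..nat (- k)}"] sum_negf)
      also have "\<dots> = - (\<Sum>r=1..nat (- k). \<Sum>a\<in>UNIV. \<Sum>b\<in>UNIV. mpow r ?W $ a $ a * mpow (nat (- k) - r) ?W $ b $ b)"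
        by (subst sum.swap) (rule refl)
      also have "\<dots> = - (\<Sum>r=1..nat (- k). ptrace U (- int r) * ptrace U (k + int r))"
      proof (intro arg_cong[where f = uminus] sum.cong refl)
        fix r assume r: "r \<in> {1..nat (- k)}"
        have "nat (- (k + int r)) = nat (- k) - r" using r by auto
        moreover have "zpow (k + int r) U = mpow (nat (- (k + int r))) ?W"
          using r False by (cases "k + int r = 0") (auto simp: zpow_def)
        moreover have "zpow (- int r) U = mpow r ?W" using r by (auto simp: zpow_def)
        ultimately show "(\<Sum>a\<in>UNIV. \<Sum>b\<in>UNIV. mpow r ?W $ a $ a * mpow (nat (- k) - r) ?W $ b $ b) =
          ptrace U (- int r) * ptrace U (k + int r)" unfolding tr ptrace_def by simp
      qed
      finally show ?thesis using False by (simp add: loopsum_def)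
    qed
  qed
qed

lemma has_ld_ptrace: "has_ld (\<lambda>U. ptrace U k) (\<lambda>a b U. of_int k * zpow k U $ b $ a)"
proof -
  have "has_ld (\<lambda>U. \<Sum>i\<in>UNIV. zpow k U $ i $ i) (\<lambda>a b U. \<Sum>i\<in>UNIV. dzpow k i i a b U)"
    by (intro has_ld_sum has_ld_zpow)
  then show ?thesis by (rule has_ld_cong) (simp_all add: ptrace_def trace_def dzpow_trace)
qed

lemma zpow_add:
  assumes U: "U \<in> unitary_group" shows "zpow (k + l) U = zpow k U ** zpow l U"
proof -
  let ?W = "adjoint_matrix U"
  have UW: "U ** ?W = mat 1" "?W ** U = mat 1" using U by (auto simp: unitary_group_iff)
  have comm: "mpow n V ** V = V ** mpow n V" for n and V :: "complex^'n^'n"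
    using mpow_add[of n 1 V] mpow_add[of 1 n V] by (simp add: add.commute)
  have cancel: "mpow (Suc n) V ** V' = mpow n V" if "V ** V' = mat 1" for n and V V' :: "complex^'n^'n"
    by (simp add: comm[symmetric] matrix_mul_assoc[symmetric] that)
  have up: "zpow (k + 1) U = zpow k U ** U" for k
  proof (cases "k \<ge> 0")
    case True
    then show ?thesis by (simp add: zpow_def nat_add_distrib comm)
  next
    case False
    then have n: "nat (- k) = Suc (nat (- k - 1))" by simp
    show ?thesis
    proof (cases "k = -1")
      case True
      then show ?thesis by (simp add: zpow_def UW)
    next
      case k: False
      have "zpow (k + 1) U = mpow (nat (- k - 1)) ?W" using False k by (simp add: zpow_def)
      also have "\<dots> = mpow (nat (- k)) ?W ** U" unfolding n by (rule cancel[OF UW(2), symmetric])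
      finally show ?thesis using False by (simp add: zpow_def)
    qed
  qed
  have down: "zpow (k - 1) U = zpow k U ** ?W" for k
    using up[of "k - 1"] by (simp add: matrix_mul_assoc[symmetric] UW)
  show ?thesis
  proof (induction l rule: int_induct[where k = 0])
    case base
    then show ?case by (simp add: zpow_def)
  next
    case (step1 i)
    then show ?case using up[of "k + i"] up[of i] by (simp add: add.assoc[symmetric] matrix_mul_assoc)
  next
    case (step2 i)
    then show ?case using down[of "k + i"] down[of i] by (simp add: add_diff_eq matrix_mul_assoc)
  qed
qed

section \<open>Integration against Haar measure\<close>

lemma haar_space: "haar_prob_measure M \<Longrightarrow> space M = unitary_group"
  by (metis haar_prob_measure_def sets_eq_imp_space_eq space_borel space_restrict_space Int_UNIV_right)

lemma haar_measurable:
  assumes "haar_prob_measure M" "continuous_on UNIV F"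
  shows "F \<in> borel_measurable M"
proof -
  have "F \<in> borel_measurable (restrict_space borel unitary_group)"
    by (rule measurable_restrict_space1) (use borel_measurable_continuous_onI assms(2) in blast)
  moreover have sets: "sets M = sets (restrict_space borel unitary_group)" using assms(1) by (simp add: haar_prob_measure_def)
  ultimately show ?thesis unfolding measurable_cong_sets[OF sets refl] by blast
qed

lemma haar_integrable:
  fixes F :: "complex^'n^'n \<Rightarrow> complex"
  assumes "haar_prob_measure M" "continuous_on UNIV F"
  shows "integrable M F"
proof -
  interpret prob_space M using assms(1) by (simp add: haar_prob_measure_def)
  obtain B where "\<And>U. U \<in> unitary_group \<Longrightarrow> norm (F U) \<le> B" using bounded_on_unitary[OF assms(2)] by blast
  then have "AE U in M. norm (F U) \<le> B" by (intro AE_I2) (simp add: haar_space[OF assms(1)])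
  then show ?thesis using haar_measurable[OF assms] by (rule integrable_const_bound)
qed

lemma haar_translate:
  fixes F :: "complex^'n^'n \<Rightarrow> complex"
  assumes M: "haar_prob_measure M" and F: "continuous_on UNIV F" and V: "V \<in> unitary_group"
  shows "(LINT U|M. F (V ** U)) = (LINT U|M. F U)"
proof -
  have sets: "sets M = sets (restrict_space borel unitary_group)" using M by (simp add: haar_prob_measure_def)
  have "(\<lambda>U. V ** U) \<in> measurable (borel :: (complex^'n^'n) measure) borel"
    by (intro borel_measurable_continuous_onI continuous_matrix_mult continuous_on_const continuous_on_id)
  then have "(\<lambda>U. V ** U) \<in> measurable (restrict_space borel unitary_group) (restrict_space borel unitary_group)"
    using V by (intro measurable_restrict_space2 measurable_restrict_space1)
      (auto simp: space_restrict_space intro: unitary_group_mult)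
  then have m: "(\<lambda>U. V ** U) \<in> measurable M M" using measurable_cong_sets[OF sets sets] by blast
  have "(LINT U|distr M M (\<lambda>U. V ** U). F U) = (LINT U|M. F (V ** U))"
    by (rule integral_distr[OF m haar_measurable[OF M F]])
  moreover have "distr M M (\<lambda>U. V ** U) = M" using M V by (simp add: haar_prob_measure_def)
  ultimately show ?thesis by simp
qed

text \<open>By invariance the difference \<open>F (reflection v t ** U) - F U\<close> integrates to
  zero. Only the integrated remainder is left, so the integral of the derivative is bounded by
  \<open>C * t\<close> for all small positive \<open>t\<close>.\<close>

lemma haar_derivative_diag:
  fixes F :: "complex^'n^'n \<Rightarrow> complex"
  assumes M: "haar_prob_measure M" and F: "has_ld F D" and v: "(\<Sum>a\<in>UNIV. v a * cnj (v a)) = 1"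
  shows "(\<Sum>a\<in>UNIV. \<Sum>b\<in>UNIV. v a * cnj (v b) * (LINT U|M. D a b U)) = 0"
proof -
  interpret prob_space M using M by (simp add: haar_prob_measure_def)
  let ?S = "\<lambda>U. \<Sum>a\<in>UNIV. \<Sum>b\<in>UNIV. v a * cnj (v b) * D a b U"
  have cF: "continuous_on UNIV F" and cD: "\<And>a b. continuous_on UNIV (D a b)" using F by (auto simp: has_ld_def)
  have iD: "integrable M (D a b)" for a b by (rule haar_integrable[OF M cD])
  have cS: "continuous_on UNIV ?S" using cD by (intro continuous_intros)
  have eq: "(LINT U|M. ?S U) = (\<Sum>a\<in>UNIV. \<Sum>b\<in>UNIV. v a * cnj (v b) * (LINT U|M. D a b U))"
    using iD by simp
  obtain C where C: "\<And>U t. U \<in> unitary_group \<Longrightarrow> \<bar>t\<bar> \<le> 1 \<Longrightarrow>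
      norm (F (reflection v t ** U) - F U - \<i> * t * ?S U) \<le> C * t\<^sup>2"
    using F v unfolding has_ld_def by blast
  have bound: "norm (LINT U|M. ?S U) \<le> C * t" if t: "0 < t" "t \<le> 1" for t
  proof -
    have cT: "continuous_on UNIV (\<lambda>U. F (reflection v t ** U))"
      by (intro continuous_on_compose2[OF cF] continuous_matrix_mult continuous_on_const continuous_on_id) auto
    have tr: "(LINT U|M. F (reflection v t ** U)) = (LINT U|M. F U)"
      by (rule haar_translate[OF M cF reflection_unitary[OF v]])
    have i: "integrable M (\<lambda>U. F (reflection v t ** U))" "integrable M F" "integrable M (\<lambda>U. \<i> * t * ?S U)"
      by (intro haar_integrable[OF M] cT cF continuous_on_mult continuous_on_const cS)+
    have "(LINT U|M. F (reflection v t ** U) - F U - \<i> * t * ?S U) = - (\<i> * t * (LINT U|M. ?S U))"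
      using i tr by (simp add: Bochner_Integration.integral_diff)
    moreover have "norm (LINT U|M. F (reflection v t ** U) - F U - \<i> * t * ?S U) \<le> C * t\<^sup>2"
    proof -
      have "norm (LINT U|M. F (reflection v t ** U) - F U - \<i> * t * ?S U) \<le>
          (LINT U|M. norm (F (reflection v t ** U) - F U - \<i> * t * ?S U))"
        by (rule integral_norm_bound)
      also have "\<dots> \<le> (LINT U|M. C * t\<^sup>2)"
        using i t C by (intro integral_mono integrable_norm Bochner_Integration.integrable_diff) (auto simp: haar_space[OF M])
      finally show ?thesis by (simp add: prob_space)
    qed
    ultimately have "t * norm (LINT U|M. ?S U) \<le> t * (C * t)"
      using t by (simp add: norm_mult power2_eq_square mult_ac)
    then show ?thesis using t by simp
  qed
  have "norm (LINT U|M. ?S U) \<le> 0"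
  proof (rule tendsto_lowerbound)
    show "((\<lambda>t. C * t) \<longlongrightarrow> 0) (at_right 0)" by (auto intro!: tendsto_eq_intros)
    show "\<forall>\<^sub>F t in at_right 0. norm (LINT U|M. ?S U) \<le> C * t"
      unfolding eventually_at_right_field using bound by (intro exI[of _ 1]) auto
  qed simp
  then show ?thesis using eq by simp
qed

text \<open>Scaling removes the restriction to unit vectors; testing on
  \<open>e_a + \<omega> e_b\<close> with four values of \<open>\<omega>\<close> then isolates one
  entry.\<close>

lemma hermitian_form_zero:
  fixes J :: "'n::finite \<Rightarrow> 'n \<Rightarrow> complex"
  assumes unit: "\<And>v. (\<Sum>a\<in>UNIV. v a * cnj (v a)) = 1 \<Longrightarrow> (\<Sum>a\<in>UNIV. \<Sum>b\<in>UNIV. v a * cnj (v b) * J a b) = 0"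
  shows "J a b = 0"
proof -
  have all: "(\<Sum>a\<in>UNIV. \<Sum>b\<in>UNIV. v a * cnj (v b) * J a b) = 0" for v :: "'n \<Rightarrow> complex"
  proof (cases "\<forall>a. v a = 0")
    case True
    then show ?thesis by simp
  next
    case False
    define s where "s = (\<Sum>a\<in>UNIV. (norm (v a))\<^sup>2)"
    have vv: "(\<Sum>a\<in>UNIV. v a * cnj (v a)) = complex_of_real s"
      unfolding s_def of_real_sum by (intro sum.cong refl) (rule complex_norm_square[symmetric])
    obtain a0 where "v a0 \<noteq> 0" using False by blast
    then have "s > 0" unfolding s_def by (intro sum_pos2[of UNIV a0]) auto
    define w where "w a = v a / complex_of_real (sqrt s)" for a
    have ss: "complex_of_real (sqrt s) * complex_of_real (sqrt s) = complex_of_real s"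
      using \<open>s > 0\<close> by (simp flip: of_real_mult)
    have "(\<Sum>a\<in>UNIV. w a * cnj (w a)) = (\<Sum>a\<in>UNIV. v a * cnj (v a)) / complex_of_real s"
      by (simp add: w_def ss sum_divide_distrib)
    then have "(\<Sum>a\<in>UNIV. \<Sum>b\<in>UNIV. w a * cnj (w b) * J a b) = 0" using vv \<open>s > 0\<close> by (intro unit) simp
    moreover have "(\<Sum>a\<in>UNIV. \<Sum>b\<in>UNIV. w a * cnj (w b) * J a b) = (\<Sum>a\<in>UNIV. \<Sum>b\<in>UNIV. v a * cnj (v b) * J a b) / complex_of_real s"
      by (simp add: w_def ss sum_divide_distrib)
    ultimately show ?thesis using \<open>s > 0\<close> by simp
  qed
  have expand: "J a a + cnj \<omega> * J a b + \<omega> * J b a + \<omega> * cnj \<omega> * J b b = 0" for \<omega>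
  proof -
    let ?v = "\<lambda>c. (if c = a then 1 else 0) + (if c = b then \<omega> else 0)"
    have *: "(\<Sum>d\<in>UNIV. ?v c * cnj (?v d) * J c d) = ?v c * (J c a + cnj \<omega> * J c b)" for c
    proof -
      have "(\<Sum>d\<in>UNIV. ?v c * cnj (?v d) * J c d) = ?v c * (\<Sum>d\<in>UNIV. (if d = a then J c a else 0) + (if d = b then cnj \<omega> * J c b else 0))"
        unfolding sum_distrib_left by (intro sum.cong refl) (auto simp: algebra_simps)
      then show ?thesis by (simp add: sum.distrib)
    qed
    have "(\<Sum>c\<in>UNIV. ?v c * (J c a + cnj \<omega> * J c b)) =
      (\<Sum>c\<in>UNIV. (if c = a then J a a + cnj \<omega> * J a b else 0) + (if c = b then \<omega> * (J b a + cnj \<omega> * J b b) else 0))"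
      by (intro sum.cong refl) (auto simp: algebra_simps)
    also have "\<dots> = J a a + cnj \<omega> * J a b + \<omega> * (J b a + cnj \<omega> * J b b)" by (simp add: sum.distrib)
    finally show ?thesis using all[of ?v] unfolding * by (simp add: algebra_simps)
  qed
  define E where "E \<omega> = J a a + cnj \<omega> * J a b + \<omega> * J b a + \<omega> * cnj \<omega> * J b b" for \<omega>
  \<comment> \<open>A sum over the fourth roots of unity: with weight \<open>\<omega>\<close>, the
    term with \<open>cnj \<omega>\<close> adds up to \<open>4 * J a b\<close> and the other three
    cancel.\<close>
  have "4 * J a b = E 1 - E (- 1) + \<i> * E \<i> - \<i> * E (- \<i>)" by (simp add: E_def algebra_simps)
  moreover have "E \<omega> = 0" for \<omega> unfolding E_def by (rule expand)
  ultimately show ?thesis by simp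
qed

lemma haar_derivative:
  assumes "haar_prob_measure M" "has_ld F D"
  shows "(LINT U|M. D a b U) = 0"
  by (rule hermitian_form_zero[of "\<lambda>a b. LINT U|M. D a b U"]) (rule haar_derivative_diag[OF assms])

lemma has_ld_continuous: "has_ld F D \<Longrightarrow> continuous_on UNIV F" "has_ld F D \<Longrightarrow> continuous_on UNIV (D a b)"
  by (auto simp: has_ld_def)

text \<open>The function \<open>(U^k)_ab\<close> times the traces is differentiated along
  \<open>E_ab\<close>, and the results are summed over \<open>a\<close> and \<open>b\<close>. The
  first factor yields the loop sum; the derivative of a trace is \<open>\<kappa> s\<close> times an
  entry of a power, which merges with the first factor into a trace of exponent
  \<open>k + \<kappa> s\<close>.\<close>

lemma loop_equation:
  fixes M :: "(complex^'n^'n) measure" and \<kappa> :: "nat \<Rightarrow> int"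
  assumes M: "haar_prob_measure M" and I: "finite I"
  shows "(LINT U|M. loopsum (ptrace U) k * (\<Prod>t\<in>I. ptrace U (\<kappa> t)) +
     (\<Sum>s\<in>I. of_int (\<kappa> s) * ptrace U (k + \<kappa> s) * (\<Prod>t\<in>I - {s}. ptrace U (\<kappa> t)))) = 0"
proof -
  let ?P = "\<lambda>J (U :: complex^'n^'n). \<Prod>t\<in>J. ptrace U (\<kappa> t)"
  define D where "D a b U = dzpow k a b a b U * ?P I U +
     zpow k U $ a $ b * (\<Sum>s\<in>I. (of_int (\<kappa> s) * zpow (\<kappa> s) U $ b $ a) * ?P (I - {s}) U)" for a b and U :: "complex^'n^'n"
  have ld: "has_ld (\<lambda>U. zpow k U $ i $ j * ?P I U) (\<lambda>a b U. dzpow k i j a b U * ?P I U +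
     zpow k U $ i $ j * (\<Sum>s\<in>I. (of_int (\<kappa> s) * zpow (\<kappa> s) U $ b $ a) * ?P (I - {s}) U))" for i j :: 'n
    by (intro has_ld_mult has_ld_zpow has_ld_prod I has_ld_ptrace)
  have D0: "(LINT U|M. D a b U) = 0" and Di: "integrable M (D a b)" for a b
    unfolding D_def using haar_derivative[OF M ld[of a b], of a b] haar_integrable[OF M has_ld_continuous(2)[OF ld[of a b]], of a b]
    by auto
  have "(LINT U|M. (\<Sum>a\<in>UNIV. \<Sum>b\<in>UNIV. D a b U)) = 0" using Di D0 by simp
  moreover have "(\<Sum>a\<in>UNIV. \<Sum>b\<in>UNIV. D a b U) = loopsum (ptrace U) k * ?P I U +
     (\<Sum>s\<in>I. of_int (\<kappa> s) * ptrace U (k + \<kappa> s) * ?P (I - {s}) U)" if U: "U \<in> space M" for U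
  proof -
    have "U \<in> unitary_group" using U haar_space[OF M] by simp
    have tr: "(\<Sum>a\<in>UNIV. \<Sum>b\<in>UNIV. zpow k U $ a $ b * zpow l U $ b $ a) = ptrace U (k + l)" for l
      unfolding ptrace_def zpow_add[OF \<open>U \<in> unitary_group\<close>] by (simp add: trace_def matrix_matrix_mult_def)
    have "(\<Sum>a\<in>UNIV. \<Sum>b\<in>UNIV. D a b U) = (\<Sum>a\<in>UNIV. \<Sum>b\<in>UNIV. dzpow k a b a b U) * ?P I U +
       (\<Sum>a\<in>UNIV. \<Sum>b\<in>UNIV. \<Sum>s\<in>I. of_int (\<kappa> s) * (zpow k U $ a $ b * zpow (\<kappa> s) U $ b $ a) * ?P (I - {s}) U)"
      unfolding D_def by (simp add: sum.distrib sum_distrib_right sum_distrib_left mult_ac)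
    also have "(\<Sum>a\<in>UNIV. \<Sum>b\<in>UNIV. \<Sum>s\<in>I. of_int (\<kappa> s) * (zpow k U $ a $ b * zpow (\<kappa> s) U $ b $ a) * ?P (I - {s}) U) =
       (\<Sum>s\<in>I. \<Sum>a\<in>UNIV. \<Sum>b\<in>UNIV. of_int (\<kappa> s) * (zpow k U $ a $ b * zpow (\<kappa> s) U $ b $ a) * ?P (I - {s}) U)"
      by (simp only: sum.swap[of _ I])
    also have "\<dots> = (\<Sum>s\<in>I. of_int (\<kappa> s) * ptrace U (k + \<kappa> s) * ?P (I - {s}) U)"
      unfolding tr[symmetric] by (simp add: sum_distrib_left sum_distrib_right)
    finally show ?thesis by (simp add: dzpow_double_trace)
  qed
  ultimately show ?thesis by (simp cong: Bochner_Integration.integral_cong)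
qed

lemma continuous_ptrace: "continuous_on UNIV (\<lambda>U :: complex^'n^'n. ptrace U k)"
  by (rule has_ld_continuous(1)[OF has_ld_ptrace])

lemma continuous_loopsum: "continuous_on UNIV (\<lambda>U :: complex^'n^'n. loopsum (ptrace U) k)"
  unfolding loopsum_def by (cases "k > 0") (auto intro!: continuous_intros continuous_ptrace)

lemma continuous_pprod: "continuous_on UNIV (\<lambda>U :: complex^'n^'n. pprod (ptrace U) ks)"
  unfolding pprod_def by (intro continuous_intros continuous_ptrace)

lemma haar_casimir:
  fixes M :: "(complex^'n^'n) measure"
  assumes M: "haar_prob_measure M"
  shows "(LINT U|M. casimir (ptrace U) ks) = 0"
proof -
  have i: "integrable M (\<lambda>U. loopsum (ptrace U) (ks ! s) * (\<Prod>t\<in>{..<length ks} - {s}. ptrace U (ks ! t)) +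
      (\<Sum>t\<in>{..<length ks} - {s}. of_int (ks ! t) * ptrace U (ks ! s + ks ! t) *
        (\<Prod>u\<in>{..<length ks} - {s} - {t}. ptrace U (ks ! u))))" for s
    by (intro haar_integrable[OF M] continuous_intros continuous_loopsum continuous_ptrace)
  show ?thesis unfolding casimir_def
    by (subst Bochner_Integration.integral_sum) (use i loop_equation[OF M] in auto)
qed

section \<open>Diagonalisation of unitary matrices\<close>

definition cinner :: "complex^'n \<Rightarrow> complex^'n \<Rightarrow> complex" where
  "cinner v w = (\<Sum>i\<in>UNIV. v $ i * cnj (w $ i))"

lemma cinner_scale_left: "cinner (c *s v) w = c * cinner v w"
  by (simp add: cinner_def sum_distrib_left mult.assoc)

lemma cinner_scale_right: "cinner v (c *s w) = cnj c * cinner v w"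
  by (simp add: cinner_def sum_distrib_left mult_ac)

lemma cinner_add_left: "cinner (u + v) w = cinner u w + cinner v w"
  by (simp add: cinner_def distrib_right sum.distrib)

lemma cinner_0_left [simp]: "cinner 0 w = 0" by (simp add: cinner_def)

lemma cinner_commute: "cinner w v = cnj (cinner v w)"
  by (simp add: cinner_def mult.commute)

lemma cinner_self: "cinner v v = complex_of_real (\<Sum>i\<in>UNIV. (norm (v $ i))\<^sup>2)"
  unfolding cinner_def of_real_sum by (intro sum.cong refl) (rule complex_norm_square[symmetric])

lemma cinner_self_nz:
  assumes "v \<noteq> 0" shows "(\<Sum>i\<in>UNIV. (norm (v $ i))\<^sup>2) > 0"
proof -
  obtain i where "v $ i \<noteq> 0" using assms by (auto simp: vec_eq_iff)
  then show ?thesis by (intro sum_pos2[of UNIV i]) auto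
qed

lemma cinner_adjoint: "cinner (A *v v) w = cinner v (adjoint_matrix A *v w)"
proof -
  have "cinner (A *v v) w = (\<Sum>i\<in>UNIV. \<Sum>j\<in>UNIV. A $ i $ j * v $ j * cnj (w $ i))"
    by (simp add: cinner_def matrix_vector_mult_def sum_distrib_right)
  also have "\<dots> = (\<Sum>j\<in>UNIV. \<Sum>i\<in>UNIV. A $ i $ j * v $ j * cnj (w $ i))" by (rule sum.swap)
  also have "\<dots> = cinner v (adjoint_matrix A *v w)"
    by (simp add: cinner_def matrix_vector_mult_def adjoint_matrix_def sum_distrib_left mult_ac)
  finally show ?thesis .
qed

lemma cinner_unitary: "U \<in> unitary_group \<Longrightarrow> cinner (U *v v) (U *v w) = cinner v w"
  by (simp add: cinner_adjoint matrix_vector_mul_assoc unitary_group_iff)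

text \<open>The vector \<open>p(A) w\<close>, computed by the Horner scheme.\<close>

definition pev :: "complex^'n^'n \<Rightarrow> complex^'n \<Rightarrow> complex poly \<Rightarrow> complex^'n" where
  "pev A w p = fold_coeffs (\<lambda>a v. a *s w + A *v v) p 0"

lemma pev_0 [simp]: "pev A w 0 = 0" by (simp add: pev_def)

lemma pev_pCons: "pev A w (pCons a p) = a *s w + A *v pev A w p"
proof (cases "p = 0 \<and> a = 0")
  case True
  then show ?thesis by (simp add: vec_eq_iff)
next
  case False
  then show ?thesis unfolding pev_def by (cases "p = 0") (auto simp: fold_coeffs_pCons_not_0_0_eq fold_coeffs_pCons_coeff_not_0_eq)
qed

lemma pev_add: "pev A w (p + q) = pev A w p + pev A w q"
  by (induction p q rule: poly_induct2)
    (simp_all add: pev_pCons matrix_vector_right_distrib vector_sadd_rdistrib)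

lemma matrix_vector_smult: "A *v (c *s v) = c *s (A *v v :: complex^'n)"
  by (simp add: vec_eq_iff matrix_vector_mult_def sum_distrib_left mult.left_commute)

lemma pev_smult: "pev A w (smult c p) = c *s pev A w p"
  by (induction p) (simp_all add: pev_pCons matrix_vector_smult vector_add_ldistrib vector_smult_assoc)

lemma pev_sum: "pev A w (\<Sum>s\<in>S. f s) = (\<Sum>s\<in>S. pev A w (f s))"
  by (induction S rule: infinite_finite_induct) (simp_all add: pev_add)

lemma pev_linear_factor: "pev A w ([:- c, 1:] * p) = A *v pev A w p - c *s pev A w p"
proof -
  have "[:- c, 1:] * p = pCons 0 p + smult (- c) p" by simp
  then show ?thesis by (simp only: pev_add pev_smult pev_pCons) (simp add: vec_eq_iff)
qed

text \<open>More iterates of \<open>w\<close> than the real dimension are linearly dependent over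
  the reals, and the real coefficients form a complex polynomial. If two iterates coincide, a
  difference of two monomials serves instead.\<close>

lemma ex_annihilator:
  fixes A :: "complex^'n^'n"
  shows "\<exists>p. p \<noteq> 0 \<and> pev A w p = 0"
proof -
  define u where "u i = pev A w (monom 1 i)" for i :: nat
  let ?n = "Suc (DIM(complex^'n))"
  show ?thesis
  proof (cases "inj_on u {..<?n}")
    case False
    then obtain i j where ij: "u i = u j" "i \<noteq> j" by (auto simp: inj_on_def)
    have "pev A w (monom 1 i + smult (- 1) (monom 1 j)) = 0"
      unfolding pev_add pev_smult using ij(1) by (simp add: u_def vec_eq_iff)
    moreover have "coeff (monom 1 i + smult (- 1) (monom 1 j)) i \<noteq> (0::complex)" using ij(2) by simp
    then have "monom 1 i + smult (- 1) (monom 1 j) \<noteq> (0 :: complex poly)" by (metis coeff_0)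
    ultimately show ?thesis by blast
  next
    case True
    have "dependent (u ` {..<?n})"
      by (rule dependent_biggerset) (use card_image[OF True] in auto)
    then obtain c v where c: "(\<Sum>v\<in>u ` {..<?n}. c v *\<^sub>R v) = 0" "v \<in> u ` {..<?n}" "c v \<noteq> 0"
      using dependent_finite[of "u ` {..<?n}"] by auto
    then obtain i where i: "i < ?n" "v = u i" by auto
    define p where "p = (\<Sum>i<?n. smult (complex_of_real (c (u i))) (monom 1 i))"
    have "pev A w p = (\<Sum>i<?n. complex_of_real (c (u i)) *s u i)"
      unfolding p_def pev_sum pev_smult u_def ..
    also have "\<dots> = (\<Sum>i<?n. c (u i) *\<^sub>R u i)"
      by (intro sum.cong refl) (simp add: vec_eq_iff, simp add: scaleR_conv_of_real)
    also have "\<dots> = 0" using c(1) by (simp only: sum.reindex[OF True] comp_def)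
    finally have "pev A w p = 0" .
    moreover have "coeff p i = complex_of_real (c (u i))"
    proof -
      have "coeff p i = (\<Sum>j<?n. if j = i then complex_of_real (c (u j)) else 0)"
        unfolding p_def coeff_sum by (intro sum.cong refl) auto
      then show ?thesis using i by simp
    qed
    then have "p \<noteq> 0" using c(3) i by auto
    ultimately show ?thesis by blast
  qed
qed

text \<open>Linear factors are removed from an annihilating polynomial until its value at
  \<open>w\<close> is nonzero; this value is an eigenvector for the root removed last. All values
  stay in the invariant subspace \<open>W\<close>.\<close>

lemma ex_eigenvector:
  fixes A :: "complex^'n^'n"
  assumes W: "\<And>v. v \<in> W \<Longrightarrow> A *v v \<in> W" "\<And>v w. v \<in> W \<Longrightarrow> w \<in> W \<Longrightarrow> v + w \<in> W" "\<And>c v. v \<in> W \<Longrightarrow> c *s v \<in> W"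
    and w: "w \<in> W" "w \<noteq> 0"
  shows "\<exists>v\<in>W. \<exists>c. v \<noteq> 0 \<and> A *v v = c *s v"
proof -
  have zero: "0 \<in> W" using W(3)[OF w(1), of 0] by simp
  have pevW: "pev A w p \<in> W" for p
    by (induction p) (auto simp: pev_pCons zero intro!: W w)
  have "\<exists>v\<in>W. \<exists>c. v \<noteq> 0 \<and> A *v v = c *s v" if "p \<noteq> 0" "pev A w p = 0" for p
    using that
  proof (induction p rule: measure_induct_rule[where f = degree])
    case (less p)
    show ?case
    proof (cases "degree p = 0")
      case True
      then obtain c where p: "p = [:c:]" by (rule degree_eq_zeroE)
      then have "c *s w = 0" "c \<noteq> 0" using less.prems by (auto simp: pev_pCons)
      then show ?thesis using w by (auto simp: vec_eq_iff)
    next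
      case False
      then have "\<not> Fundamental_Theorem_Algebra.constant (poly p)" by (simp add: constant_degree)
      then obtain z where "poly p z = 0" using fundamental_theorem_of_algebra by blast
      then have "[:- z, 1:] dvd p" by (simp only: poly_eq_0_iff_dvd)
      then obtain q where q: "p = [:- z, 1:] * q" by (rule dvdE)
      then have q0: "q \<noteq> 0" using less.prems by auto
      have deg: "degree q < degree p" unfolding q using q0 by (subst degree_mult_eq) auto
      show ?thesis
      proof (cases "pev A w q = 0")
        case True
        then show ?thesis using less.IH[OF deg q0] by blast
      next
        case False
        have "A *v pev A w q = z *s pev A w q" using less.prems(2) unfolding q pev_linear_factor by simp
        then show ?thesis using False pevW by blast
      qed
    qed
  qed
  then show ?thesis using ex_annihilator[of A w] by blast
qed

text \<open>Eigenvectors are added one at a time, inside the orthogonal complement of those already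
  found. It is invariant because \<open>U\<close> preserves the inner product and the eigenvalues
  are nonzero.\<close>

lemma ex_orthonormal_eigenvectors:
  fixes U :: "complex^'n^'n"
  assumes U: "U \<in> unitary_group"
  shows "\<exists>q x. (\<forall>a b. cinner (q a) (q b) = (if a = b then 1 else 0)) \<and> (\<forall>a::'n. U *v q a = x a *s q a)"
proof -
  have "\<exists>q x. (\<forall>a\<in>J. \<forall>b\<in>J. cinner (q a) (q b) = (if a = b then 1 else 0)) \<and> (\<forall>a\<in>J. U *v q a = x a *s q a)"
    if "finite J" for J :: "'n set"
    using that
  proof (induction J rule: finite_induct)
    case empty
    then show ?case by simp
  next
    case (insert j J)
    then obtain q :: "'n \<Rightarrow> complex^'n" and x where
      q: "\<And>a b. a \<in> J \<Longrightarrow> b \<in> J \<Longrightarrow> cinner (q a) (q b) = (if a = b then 1 else 0)"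
      and x: "\<And>a. a \<in> J \<Longrightarrow> U *v q a = x a *s q a" by blast
    define W where "W = {w. \<forall>a\<in>J. cinner w (q a) = 0}"
    \<comment> \<open>The complement is the kernel of this matrix. Its row \<open>j\<close> is zero,
      as \<open>j\<close> is not yet in \<open>J\<close>, so the matrix is singular and a nonzero
      kernel vector exists.\<close>
    define A where "A = (\<chi> a i. if a \<in> J then cnj (q a $ i) else 0)"
    have "row j A = 0" using insert(2) by (simp add: A_def row_def vec_eq_iff)
    then have "det A = 0" by (rule det_zero_row)
    then have "\<not> invertible A" by (simp add: invertible_det_nz)
    then have "\<not> (\<exists>B. B ** A = mat 1)" using invertible_left_inverse by blast
    then obtain w where w: "A *v w = 0" "w \<noteq> 0" unfolding matrix_left_invertible_ker by blast
    have "cinner w (q a) = 0" if "a \<in> J" for a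
    proof -
      have "(A *v w) $ a = 0" using w(1) by simp
      then show ?thesis using that by (simp add: A_def cinner_def matrix_vector_mult_def mult.commute)
    qed
    then have wW: "w \<in> W" by (simp add: W_def)
    have UW: "U *v v \<in> W" if v: "v \<in> W" for v
      unfolding W_def
    proof (intro CollectI ballI)
      fix a assume a: "a \<in> J"
      have "x a \<noteq> 0"
      proof
        assume "x a = 0"
        then have "cinner (U *v q a) (U *v q a) = 0" using x[OF a] by (simp add: cinner_scale_left)
        then show False using q[OF a a] by (simp add: cinner_unitary[OF U])
      qed
      have "cnj (x a) * cinner (U *v v) (q a) = cinner (U *v v) (U *v q a)" by (simp add: x[OF a] cinner_scale_right)
      also have "\<dots> = cinner v (q a)" by (rule cinner_unitary[OF U])
      also have "\<dots> = 0" using v a by (simp add: W_def)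
      finally show "cinner (U *v v) (q a) = 0" using \<open>x a \<noteq> 0\<close> by simp
    qed
    obtain v c where v: "v \<in> W" "v \<noteq> 0" "U *v v = c *s v"
      using ex_eigenvector[OF UW _ _ wW w(2)] by (auto simp: W_def cinner_add_left cinner_scale_left)
    define s where "s = (\<Sum>i\<in>UNIV. (norm (v $ i))\<^sup>2)"
    have s: "s > 0" unfolding s_def by (rule cinner_self_nz[OF v(2)])
    define e where "e = complex_of_real (1 / sqrt s) *s v"
    have "cinner e e = complex_of_real (1 / sqrt s * (1 / sqrt s) * s)"
      unfolding e_def cinner_scale_left cinner_scale_right by (simp only: cinner_self s_def[symmetric] complex_cnj_complex_of_real of_real_mult mult_ac)
    also have "1 / sqrt s * (1 / sqrt s) * s = 1" using s by simp
    finally have ee: "cinner e e = 1" by simp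
    have eq: "cinner e (q a) = 0" "cinner (q a) e = 0" if "a \<in> J" for a
      using v(1) that cinner_commute[of "q a" v] by (simp_all add: e_def cinner_scale_left cinner_scale_right W_def)
    have Ue: "U *v e = c *s e"
      using v(3) by (simp add: e_def matrix_vector_smult vector_smult_assoc mult.commute)
    show ?case
      using q x ee eq Ue insert(2) by (intro exI[of _ "q(j := e)"] exI[of _ "x(j := c)"]) auto
  qed
  from this[of UNIV] show ?thesis by simp
qed

lemma unitary_diagonalization:
  fixes U :: "complex^'n^'n"
  assumes U: "U \<in> unitary_group"
  obtains Q x where "Q \<in> unitary_group" "U = Q ** (\<chi> a b. if a = b then x a else 0) ** adjoint_matrix Q"
    "\<And>a. x a * cnj (x a) = 1"
proof -
  obtain q x where q: "\<And>a b. cinner (q a) (q b) = (if a = b then 1 else 0)" and x: "\<And>a::'n. U *v q a = x a *s q a"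
    using ex_orthonormal_eigenvectors[OF U] by blast
  define Q where "Q = (\<chi> i a. q a $ i)"
  let ?D = "(\<chi> a b. if a = b then x a else 0) :: complex^'n^'n"
  have QQ: "adjoint_matrix Q ** Q = mat 1"
  proof -
    have "(adjoint_matrix Q ** Q) $ a $ b = cinner (q b) (q a)" for a b
      by (simp add: Q_def adjoint_matrix_def matrix_matrix_mult_def cinner_def mult.commute)
    then show ?thesis by (auto simp: vec_eq_iff q mat_def)
  qed
  then have QQ': "Q ** adjoint_matrix Q = mat 1" using matrix_left_right_inverse by blast
  have "U ** Q = Q ** ?D"
  proof -
    have "(U ** Q) $ i $ a = (Q ** ?D) $ i $ a" for i a
    proof -
      have "(U ** Q) $ i $ a = (U *v q a) $ i" by (simp add: Q_def matrix_matrix_mult_def matrix_vector_mult_def)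
      also have "\<dots> = q a $ i * x a" by (simp add: x mult.commute)
      also have "\<dots> = (Q ** ?D) $ i $ a"
        by (simp add: Q_def matrix_matrix_mult_def if_distrib[of "\<lambda>z. _ * z"] cong: if_cong)
      finally show ?thesis .
    qed
    then show ?thesis by (simp add: vec_eq_iff)
  qed
  then have "U ** Q ** adjoint_matrix Q = Q ** ?D ** adjoint_matrix Q" by simp
  then have eq: "U = Q ** ?D ** adjoint_matrix Q" by (simp add: matrix_mul_assoc[symmetric] QQ')
  have "x a * cnj (x a) = 1" for a
    using cinner_unitary[OF U, of "q a" "q a"] by (simp add: x cinner_scale_left cinner_scale_right q mult.commute)
  with eq QQ QQ' show thesis by (intro that[of Q x]) (auto simp: unitary_group_iff)
qed

lemma mpow_conj:
  assumes "P ** Q = mat 1" "Q ** P = mat 1"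
  shows "mpow k (P ** B ** Q) = P ** mpow k B ** Q"
proof (induction k)
  case (Suc k)
  have "P ** B ** Q ** (P ** mpow k B ** Q) = P ** B ** (Q ** P) ** mpow k B ** Q"
    by (simp add: matrix_mul_assoc)
  then show ?case using Suc assms by (simp add: matrix_mul_assoc)
qed (simp add: assms)

lemma mpow_diag: "mpow k (\<chi> a b. if a = b then x a else 0) = (\<chi> a b. if a = b then x a ^ k else 0)"
  by (induction k) (auto simp: vec_eq_iff mat_def matrix_matrix_mult_def if_distrib[of "\<lambda>z. _ * z"] if_distrib[of "\<lambda>z. z * _"] cong: if_cong)

lemma trace_conj:
  fixes P Q B :: "complex^'n^'n"
  assumes "Q ** P = mat 1"
  shows "trace (P ** B ** Q) = trace B"
  using assms by (metis matrix_mul_assoc matrix_mul_lid trace_mul_sym)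

lemma ptrace_diag:
  assumes Q: "Q \<in> unitary_group" and U: "U = Q ** (\<chi> a b. if a = b then x a else 0) ** adjoint_matrix Q"
    and x: "\<And>a. x a * cnj (x a) = 1"
  shows "ptrace U k = (\<Sum>a\<in>UNIV. x a powi k)"
proof -
  note QQ = Q[unfolded unitary_group_iff]
  have inv: "cnj (x a) = inverse (x a)" for a using x[of a] by (metis inverse_unique)
  have "adjoint_matrix U = Q ** (\<chi> a b. if a = b then inverse (x a) else 0) ** adjoint_matrix Q"
  proof -
    have "adjoint_matrix (adjoint_matrix Q) = Q" by (simp add: adjoint_matrix_def vec_eq_iff)
    moreover have "adjoint_matrix (\<chi> a b. if a = b then x a else 0) = (\<chi> a b. if a = b then inverse (x a) else 0)"
      by (auto simp: adjoint_matrix_def vec_eq_iff inv)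
    ultimately show ?thesis by (simp add: U adjoint_matrix_mult matrix_mul_assoc)
  qed
  moreover have "trace (mpow n (Q ** (\<chi> a b. if a = b then y a else 0) ** adjoint_matrix Q)) = (\<Sum>a\<in>UNIV. y a ^ n)" for n y
    using QQ by (simp add: mpow_conj trace_conj mpow_diag) (simp add: trace_def)
  ultimately show ?thesis by (simp add: ptrace_def zpow_def U power_int_def power_inverse)
qed

subsection \<open>Secular coefficients\<close>

definition lift_matrix :: "complex^'n^'n \<Rightarrow> complex poly^'n^'n" where
  "lift_matrix A = (\<chi> i j. [:A $ i $ j:])"

lemma lift_matrix_mult: "lift_matrix (A ** B) = lift_matrix A ** lift_matrix B"
proof -
  have "[:\<Sum>k\<in>S. f k:] = (\<Sum>k\<in>S. [:f k:])" for S and f :: "'a \<Rightarrow> complex"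
  proof (induction S rule: infinite_finite_induct)
    case (insert k S)
    have "[:f k + sum f S:] = [:f k:] + [:sum f S:]" by simp
    then show ?case using insert(1,2) by (simp add: insert(3)[symmetric])
  qed auto
  then show ?thesis by (simp add: lift_matrix_def matrix_matrix_mult_def vec_eq_iff mult.commute)
qed

lemma lift_matrix_1: "lift_matrix (mat 1) = mat 1"
  by (simp add: lift_matrix_def mat_def vec_eq_iff one_pCons)

lemma mat_poly_commute: "A ** mat z = mat z ** (A :: complex poly^'n^'n)"
  by (simp add: vec_eq_iff mat_def matrix_matrix_mult_def if_distrib[of "\<lambda>z. _ * z"] if_distrib[of "\<lambda>z. z * _"] mult.commute cong: if_cong)

lemma matrix_mult_rdistrib: "(A + B) ** C = A ** C + B ** (C :: 'a::semiring_1^'n^'n)"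
  by (simp add: vec_eq_iff matrix_matrix_mult_def distrib_right sum.distrib)

lemma char_det_diag:
  fixes U Q :: "complex^'n^'n"
  assumes Q: "Q \<in> unitary_group" and U: "U = Q ** (\<chi> a b. if a = b then x a else 0) ** adjoint_matrix Q"
  shows "det (mat [:0, 1:] + (\<chi> i j. [:U $ i $ j:])) = (\<Prod>a\<in>UNIV. [:x a, 1:])"
proof -
  let ?D = "(\<chi> a b. if a = b then x a else 0) :: complex^'n^'n" and ?z = "mat [:0, 1:] :: complex poly^'n^'n"
  let ?Q = "lift_matrix Q" and ?R = "lift_matrix (adjoint_matrix Q)"
  have QR: "?Q ** ?R = mat 1" using Q by (simp add: unitary_group_iff lift_matrix_mult[symmetric] lift_matrix_1)
  have "?z + lift_matrix U = ?Q ** (?z + lift_matrix ?D) ** ?R"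
  proof -
    have "?Q ** ?z ** ?R = ?z ** (?Q ** ?R)" by (simp only: mat_poly_commute[of ?Q] matrix_mul_assoc)
    then have "?Q ** ?z ** ?R = ?z" by (simp add: QR)
    then show ?thesis
      by (simp add: U lift_matrix_mult matrix_add_ldistrib matrix_mult_rdistrib)
  qed
  then have "det (?z + lift_matrix U) = det (?z + lift_matrix ?D) * (det ?Q * det ?R)" by (simp add: det_mul mult_ac)
  also have "det ?Q * det ?R = 1" using QR by (metis det_I det_mul)
  also have "det (?z + lift_matrix ?D) = (\<Prod>a\<in>UNIV. (?z + lift_matrix ?D) $ a $ a)"
    by (rule det_diagonal) (simp add: mat_def lift_matrix_def)
  finally show ?thesis by (simp add: lift_matrix_def mat_def)
qed

lemma erec_zero: "N < r \<Longrightarrow> erec x N r = 0"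
proof (induction x N r rule: erec.induct)
  case (3 x N r)
  then show ?case by simp
qed auto

lemma coeff_prod_linear:
  "coeff (\<Prod>i<N. [:x i, 1:]) k = (if k \<le> N then erec x N (N - k) else (0::complex))"
proof (induction N arbitrary: k)
  case 0
  then show ?case by (cases k) auto
next
  case (Suc N)
  have "coeff (\<Prod>i<Suc N. [:x i, 1:]) k =
      x N * coeff (\<Prod>i<N. [:x i, 1:]) k + (case k of 0 \<Rightarrow> 0 | Suc j \<Rightarrow> coeff (\<Prod>i<N. [:x i, 1:]) j)"
    by (simp add: coeff_pCons mult.commute[of _ "[:x N, 1:]"] split: nat.split)
  also have "\<dots> = (if k \<le> Suc N then erec x (Suc N) (Suc N - k) else 0)"
  proof (cases k)
    case 0
    then show ?thesis by (simp add: Suc erec_zero)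
  next
    case (Suc j)
    show ?thesis
    proof (cases "j < N")
      case True
      then have "N - j = Suc (N - Suc j)" by simp
      then show ?thesis using True by (simp add: Suc Suc.IH)
    next
      case False
      then show ?thesis by (auto simp: Suc Suc.IH)
    qed
  qed
  finally show ?case .
qed

subsection \<open>Traces of symmetric powers\<close>

lemma finite_msets_size: "finite {\<gamma> :: 'n::finite multiset. size \<gamma> = j}"
proof -
  have "{\<gamma> :: 'n multiset. size \<gamma> = j} \<subseteq> mset ` {xs. set xs \<subseteq> UNIV \<and> length xs = j}"
  proof
    fix \<gamma> :: "'n multiset" assume "\<gamma> \<in> {\<gamma>. size \<gamma> = j}"
    moreover obtain xs where "mset xs = \<gamma>" using ex_mset by blast
    ultimately show "\<gamma> \<in> mset ` {xs. set xs \<subseteq> UNIV \<and> length xs = j}" by auto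
  qed
  then show ?thesis by (rule finite_subset) (rule finite_imageI, rule finite_lists_length_eq, rule finite)
qed

text \<open>The entry for a given enumeration \<open>xs\<close> of the column multiset. Its
  invariance under reordering removes the choice operator of \<open>sym_power_entry\<close> from all
  computations.\<close>

definition sym_list_entry :: "complex^'n^'n \<Rightarrow> 'n multiset \<Rightarrow> 'n list \<Rightarrow> complex" where
  "sym_list_entry A \<beta> xs = (\<Sum>ys\<in>permutations_of_multiset \<beta>. \<Prod>i<length xs. A $ (ys ! i) $ (xs ! i))"

lemma sym_list_entry_cong:
  assumes eq: "mset xs = mset xs'" and sz: "size \<beta> = length xs"
  shows "sym_list_entry A \<beta> xs = sym_list_entry A \<beta> xs'"
proof -
  have len: "length xs' = length xs" using eq by (metis size_mset)
  obtain p where p: "p permutes {..<length xs'}" "permute_list p xs' = xs"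
    using mset_eq_permutation[OF eq] by blast
  let ?j = "length xs"
  have p': "p permutes {..<?j}" using p(1) len by simp
  have lenp: "length ys = ?j" if "ys \<in> permutations_of_multiset \<beta>" for ys
    using that sz by (metis permutations_of_multisetD size_mset)
  have bij: "bij_betw (permute_list p) (permutations_of_multiset \<beta>) (permutations_of_multiset \<beta>)"
  proof (rule bij_betw_byWitness[where f' = "permute_list (inv p)"])
    have i: "inv p permutes {..<?j}" using p' by (rule permutes_inv)
    show "\<forall>ys\<in>permutations_of_multiset \<beta>. permute_list (inv p) (permute_list p ys) = ys"
    proof
      fix ys assume "ys \<in> permutations_of_multiset \<beta>"
      then have l: "length ys = ?j" by (rule lenp)
      have "permute_list (inv p) (permute_list p ys) = permute_list (p \<circ> inv p) ys"
        by (rule permute_list_compose[symmetric]) (use i l in simp)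
      then show "permute_list (inv p) (permute_list p ys) = ys"
        using permutes_inv_o(1)[OF p'] by simp
    qed
    show "\<forall>ys\<in>permutations_of_multiset \<beta>. permute_list p (permute_list (inv p) ys) = ys"
    proof
      fix ys assume "ys \<in> permutations_of_multiset \<beta>"
      then have l: "length ys = ?j" by (rule lenp)
      have "permute_list p (permute_list (inv p) ys) = permute_list (inv p \<circ> p) ys"
        by (rule permute_list_compose[symmetric]) (use p' l in simp)
      then show "permute_list p (permute_list (inv p) ys) = ys"
        using permutes_inv_o(2)[OF p'] by simp
    qed
    show "permute_list p ` permutations_of_multiset \<beta> \<subseteq> permutations_of_multiset \<beta>"
    proof (rule image_subsetI)
      fix ys assume ys: "ys \<in> permutations_of_multiset \<beta>"
      have "mset (permute_list p ys) = mset ys" by (rule mset_permute_list) (use lenp[OF ys] p' in simp)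
      then show "permute_list p ys \<in> permutations_of_multiset \<beta>" using ys by (simp add: permutations_of_multiset_def)
    qed
    show "permute_list (inv p) ` permutations_of_multiset \<beta> \<subseteq> permutations_of_multiset \<beta>"
    proof (rule image_subsetI)
      fix ys assume ys: "ys \<in> permutations_of_multiset \<beta>"
      have "mset (permute_list (inv p) ys) = mset ys" by (rule mset_permute_list) (use lenp[OF ys] i in simp)
      then show "permute_list (inv p) ys \<in> permutations_of_multiset \<beta>" using ys by (simp add: permutations_of_multiset_def)
    qed
  qed
  have "sym_list_entry A \<beta> xs = (\<Sum>ys\<in>permutations_of_multiset \<beta>. \<Prod>i<?j. A $ (permute_list p ys ! i) $ (xs ! i))"
    unfolding sym_list_entry_def by (rule sum.reindex_bij_betw[OF bij, symmetric])
  also have "\<dots> = (\<Sum>ys\<in>permutations_of_multiset \<beta>. \<Prod>i<?j. A $ (ys ! i) $ (xs' ! i))"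
  proof (rule sum.cong[OF refl])
    fix ys assume ys: "ys \<in> permutations_of_multiset \<beta>"
    have "(\<Prod>i<?j. A $ (permute_list p ys ! i) $ (xs ! i)) = (\<Prod>i<?j. A $ (ys ! p i) $ (xs' ! p i))"
    proof (rule prod.cong[OF refl])
      fix i assume "i \<in> {..<?j}"
      then show "A $ (permute_list p ys ! i) $ (xs ! i) = A $ (ys ! p i) $ (xs' ! p i)"
        using permute_list_nth[of p ys i] permute_list_nth[OF p(1), of i] p(2) p' lenp[OF ys] len by simp
    qed
    also have "\<dots> = (\<Prod>i<?j. A $ (ys ! i) $ (xs' ! i))"
      using prod.permute[OF p', of "\<lambda>i. A $ (ys ! i) $ (xs' ! i)"] by (simp add: comp_def)
    finally show "(\<Prod>i<?j. A $ (permute_list p ys ! i) $ (xs ! i)) = (\<Prod>i<?j. A $ (ys ! i) $ (xs' ! i))" .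
  qed
  finally show ?thesis by (simp add: sym_list_entry_def len)
qed

lemma sym_power_entry_list:
  assumes "mset xs = \<alpha>" "size \<beta> = size \<alpha>"
  shows "sym_power_entry A \<beta> \<alpha> = sym_list_entry A \<beta> xs"
proof -
  let ?xs = "SOME xs. mset xs = \<alpha>"
  have "mset ?xs = \<alpha>" by (rule someI[of "\<lambda>xs. mset xs = \<alpha>", OF assms(1)])
  moreover have "size \<alpha> = length ?xs" using calculation by (metis size_mset)
  ultimately have "sym_power_entry A \<beta> \<alpha> = sym_list_entry A \<beta> ?xs"
    by (simp add: sym_power_entry_def sym_list_entry_def)
  also have "\<dots> = sym_list_entry A \<beta> xs"
    by (rule sym_list_entry_cong) (use \<open>mset ?xs = \<alpha>\<close> \<open>size \<alpha> = length ?xs\<close> assms in auto)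
  finally show ?thesis .
qed

lemma sum_lists_length:
  fixes g :: "'n::finite list \<Rightarrow> 'a::comm_monoid_add"
  shows "(\<Sum>zs | length zs = j. g zs) = (\<Sum>\<gamma> | size \<gamma> = j. \<Sum>zs\<in>permutations_of_multiset \<gamma>. g zs)"
proof -
  have "{zs :: 'n list. length zs = j} = (\<Union>\<gamma>\<in>{\<gamma>. size \<gamma> = j}. permutations_of_multiset \<gamma>)"
    by (auto simp: permutations_of_multiset_def)
  moreover have "(\<Sum>zs\<in>(\<Union>\<gamma>\<in>{\<gamma>. size \<gamma> = j}. permutations_of_multiset \<gamma>). g zs) =
      (\<Sum>\<gamma> | size \<gamma> = j. \<Sum>zs\<in>permutations_of_multiset \<gamma>. g zs)"
  proof (rule sum.UNION_disjoint)
    show "finite {\<gamma> :: 'n multiset. size \<gamma> = j}" by (rule finite_msets_size)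
    show "\<forall>\<gamma>\<in>{\<gamma>. size \<gamma> = j}. finite (permutations_of_multiset (\<gamma> :: 'n multiset))" by simp
  qed (auto simp: permutations_of_multiset_def)
  ultimately show ?thesis by (simp only:)
qed

lemma prod_sum_lists:
  fixes f :: "nat \<Rightarrow> 'n::finite \<Rightarrow> complex"
  shows "(\<Prod>i<j. \<Sum>k\<in>UNIV. f i k) = (\<Sum>zs | length zs = j. \<Prod>i<j. f i (zs ! i))"
proof -
  have "(\<Prod>i<j. \<Sum>k\<in>UNIV. f i k) = (\<Sum>g\<in>PiE {..<j} (\<lambda>_. UNIV). \<Prod>i<j. f i (g i))"
    by (rule prod_sum_PiE) auto
  also have "\<dots> = (\<Sum>zs | length zs = j. \<Prod>i<j. f i (zs ! i))"
    by (rule sum.reindex_bij_witness[where i = "\<lambda>zs. restrict (\<lambda>i. zs ! i) {..<j}" and j = "\<lambda>g. map g [0..<j]"])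
      (auto simp: PiE_def extensional_def restrict_def fun_eq_iff intro!: nth_equalityI prod.cong)
  finally show ?thesis .
qed

lemma sym_list_entry_mult:
  "sym_list_entry (A ** B) \<beta> xs =
     (\<Sum>zs | length zs = length xs. sym_list_entry A \<beta> zs * (\<Prod>i<length xs. B $ (zs ! i) $ (xs ! i)))"
proof -
  let ?j = "length xs"
  have "sym_list_entry (A ** B) \<beta> xs =
      (\<Sum>ys\<in>permutations_of_multiset \<beta>. \<Sum>zs | length zs = ?j. \<Prod>i<?j. A $ (ys ! i) $ (zs ! i) * B $ (zs ! i) $ (xs ! i))"
    unfolding sym_list_entry_def matrix_matrix_mult_def by (simp add: prod_sum_lists)
  also have "\<dots> = (\<Sum>zs | length zs = ?j. \<Sum>ys\<in>permutations_of_multiset \<beta>. \<Prod>i<?j. A $ (ys ! i) $ (zs ! i) * B $ (zs ! i) $ (xs ! i))"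
    by (rule sum.swap)
  also have "\<dots> = (\<Sum>zs | length zs = ?j. sym_list_entry A \<beta> zs * (\<Prod>i<?j. B $ (zs ! i) $ (xs ! i)))"
    unfolding sym_list_entry_def by (intro sum.cong refl) (simp add: prod.distrib sum_distrib_right)
  finally show ?thesis .
qed

text \<open>Expanding the product sums over lists of intermediate indices, which are grouped by
  their multisets. Multiplicativity makes the trace invariant under conjugation, so that only
  diagonal matrices have to be evaluated.\<close>

lemma sym_power_entry_mult:
  assumes "size \<beta> = j" "size \<alpha> = j"
  shows "sym_power_entry (A ** B) \<beta> \<alpha> = (\<Sum>\<gamma> | size \<gamma> = j. sym_power_entry A \<beta> \<gamma> * sym_power_entry B \<gamma> \<alpha>)"
proof -
  obtain xs where xs: "mset xs = \<alpha>" using ex_mset by blast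
  have len: "length xs = j" using xs assms(2) by (metis size_mset)
  have "sym_power_entry (A ** B) \<beta> \<alpha> = sym_list_entry (A ** B) \<beta> xs"
    by (rule sym_power_entry_list[OF xs]) (use assms in simp)
  also have "\<dots> = (\<Sum>\<gamma> | size \<gamma> = j. \<Sum>zs\<in>permutations_of_multiset \<gamma>. sym_list_entry A \<beta> zs * (\<Prod>i<j. B $ (zs ! i) $ (xs ! i)))"
    unfolding sym_list_entry_mult len by (rule sum_lists_length)
  also have "\<dots> = (\<Sum>\<gamma> | size \<gamma> = j. sym_power_entry A \<beta> \<gamma> * sym_power_entry B \<gamma> \<alpha>)"
  proof (rule sum.cong[OF refl])
    fix \<gamma> :: "'a multiset" assume "\<gamma> \<in> {\<gamma>. size \<gamma> = j}"
    then have g: "size \<gamma> = j" by simp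
    have "sym_list_entry A \<beta> zs = sym_power_entry A \<beta> \<gamma>" if "zs \<in> permutations_of_multiset \<gamma>" for zs
      using that assms g by (intro sym_power_entry_list[symmetric]) (auto simp: permutations_of_multiset_def)
    moreover have "sym_power_entry B \<gamma> \<alpha> = (\<Sum>zs\<in>permutations_of_multiset \<gamma>. \<Prod>i<j. B $ (zs ! i) $ (xs ! i))"
      using sym_power_entry_list[OF xs, of \<gamma> B] assms g len by (simp add: sym_list_entry_def)
    ultimately show "(\<Sum>zs\<in>permutations_of_multiset \<gamma>. sym_list_entry A \<beta> zs * (\<Prod>i<j. B $ (zs ! i) $ (xs ! i))) =
        sym_power_entry A \<beta> \<gamma> * sym_power_entry B \<gamma> \<alpha>"
      by (simp add: sum_distrib_left)
  qed
  finally show ?thesis .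
qed

lemma trace_sym_power_commute:
  fixes A B :: "complex^'n^'n"
  shows "trace_sym_power j (A ** B) = trace_sym_power j (B ** A)"
proof -
  have *: "trace_sym_power j (C ** D) = (\<Sum>\<alpha> | size \<alpha> = j. \<Sum>\<gamma> | size \<gamma> = j. sym_power_entry C \<alpha> \<gamma> * sym_power_entry D \<gamma> \<alpha>)"
    for C D :: "complex^'n^'n"
    unfolding trace_sym_power_def by (intro sum.cong refl sym_power_entry_mult) auto
  show ?thesis unfolding *[of B A] by (subst sum.swap) (simp add: * mult.commute)
qed

text \<open>For a diagonal matrix an ordering of the multiset contributes only if it agrees with the
  chosen enumeration at every position.\<close>

lemma trace_sym_power_diag:
  "trace_sym_power j (\<chi> a b. if a = b then x a else 0) = (\<Sum>\<alpha> | size \<alpha> = j. \<Prod>a\<in>#\<alpha>. x a)"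
  unfolding trace_sym_power_def
proof (rule sum.cong[OF refl])
  fix \<alpha> :: "'a multiset" assume "\<alpha> \<in> {\<alpha>. size \<alpha> = j}"
  let ?D = "(\<chi> a b. if a = b then x a else 0) :: complex^'a^'a"
  obtain xs where xs: "mset xs = \<alpha>" using ex_mset by blast
  have "sym_power_entry ?D \<alpha> \<alpha> = (\<Sum>ys\<in>permutations_of_multiset \<alpha>. \<Prod>i<length xs. ?D $ (ys ! i) $ (xs ! i))"
    using sym_power_entry_list[OF xs refl] by (simp add: sym_list_entry_def)
  also have "\<dots> = (\<Sum>ys\<in>{xs}. \<Prod>i<length xs. ?D $ (ys ! i) $ (xs ! i))"
  proof (rule sum.mono_neutral_right)
    show "{xs} \<subseteq> permutations_of_multiset \<alpha>" using xs by (simp add: permutations_of_multiset_def)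
    show "\<forall>ys\<in>permutations_of_multiset \<alpha> - {xs}. (\<Prod>i<length xs. ?D $ (ys ! i) $ (xs ! i)) = 0"
    proof
      fix ys assume ys: "ys \<in> permutations_of_multiset \<alpha> - {xs}"
      then have "mset ys = mset xs" using xs by (simp add: permutations_of_multiset_def)
      then have "length ys = length xs" by (rule mset_eq_length)
      then obtain i where "i < length xs" "ys ! i \<noteq> xs ! i" using ys nth_equalityI[of ys xs] by auto
      then show "(\<Prod>i<length xs. ?D $ (ys ! i) $ (xs ! i)) = 0" by (intro prod_zero) auto
    qed
  qed simp
  also have "\<dots> = (\<Prod>i<length xs. x (xs ! i))" by simp
  also have "\<dots> = prod_list (map x xs)" by (simp add: prod.list_conv_set_nth atLeast0LessThan)
  also have "\<dots> = (\<Prod>a\<in>#\<alpha>. x a)" by (simp add: xs[symmetric] prod_mset_prod_list[symmetric])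
  finally show "sym_power_entry ?D \<alpha> \<alpha> = (\<Prod>a\<in>#\<alpha>. x a)" .
qed

lemma msets_Suc:
  "{M. set_mset M \<subseteq> {..<Suc N} \<and> size M = Suc r} =
   {M. set_mset M \<subseteq> {..<N} \<and> size M = Suc r} \<union> add_mset N ` {M. set_mset M \<subseteq> {..<Suc N} \<and> size M = r}"
proof (rule equalityI; rule subsetI)
  fix M assume M: "M \<in> {M. set_mset M \<subseteq> {..<Suc N} \<and> size M = Suc r}"
  show "M \<in> {M. set_mset M \<subseteq> {..<N} \<and> size M = Suc r} \<union> add_mset N ` {M. set_mset M \<subseteq> {..<Suc N} \<and> size M = r}"
  proof (cases "N \<in># M")
    case True
    then obtain M' where "M = add_mset N M'" by (meson multi_member_split)
    then show ?thesis using M by auto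
  next
    case False
    then show ?thesis using M by (auto simp: less_Suc_eq lessThan_def)
  qed
qed auto

text \<open>Finiteness is part of the induction because the recursion splits the sum over a disjoint
  union.\<close>

lemma sum_msets_hrec:
  fixes x :: "nat \<Rightarrow> 'a::comm_ring_1"
  shows "finite {M. set_mset M \<subseteq> {..<N} \<and> size M = r} \<and> (\<Sum>M | set_mset M \<subseteq> {..<N} \<and> size M = r. \<Prod>i\<in>#M. x i) = hrec x N r"
proof (induction x N r rule: hrec.induct)
  case (1 x r)
  have "{M. set_mset M \<subseteq> {..<0::nat} \<and> size M = r} = (if r = 0 then {{#}} else {})" by auto
  then show ?case by simp
next
  case (2 x N)
  have "{M. set_mset M \<subseteq> {..<Suc N} \<and> size M = 0} = {{#}}" by auto
  then show ?case by simp
next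
  case (3 x N r)
  let ?A = "{M. set_mset M \<subseteq> {..<N} \<and> size M = Suc r}" and ?B = "{M. set_mset M \<subseteq> {..<Suc N} \<and> size M = r}"
  have fin: "finite ?A" "finite ?B" using 3 by auto
  have "(\<Sum>M\<in>?A \<union> add_mset N ` ?B. \<Prod>i\<in>#M. x i) = (\<Sum>M\<in>?A. \<Prod>i\<in>#M. x i) + (\<Sum>M\<in>add_mset N ` ?B. \<Prod>i\<in>#M. x i)"
    using fin by (intro sum.union_disjoint) auto
  also have "(\<Sum>M\<in>add_mset N ` ?B. \<Prod>i\<in>#M. x i) = x N * (\<Sum>M\<in>?B. \<Prod>i\<in>#M. x i)"
    by (subst sum.reindex) (auto simp: sum_distrib_left inj_on_def)
  finally show ?case using 3 fin unfolding msets_Suc by simp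
qed

text \<open>One list of eigenvalues serves all the quantities involved. It is indexed by numbers to
  match the variables of the Laurent polynomials, and nothing relates the lists of different
  matrices.\<close>

lemma unitary_eigenvalues:
  fixes U :: "complex^'n^'n"
  assumes U: "U \<in> unitary_group"
  shows "\<exists>x. (\<forall>i<CARD('n). x i \<noteq> 0 \<and> cnj (x i) = inverse (x i)) \<and>
    (\<forall>k. ptrace U k = (\<Sum>i<CARD('n). x i powi k)) \<and>
    (\<forall>j. secular_coeff j U = erec x CARD('n) j) \<and> (\<forall>j. trace_sym_power j U = hrec x CARD('n) j)"
proof -
  let ?N = "CARD('n)"
  obtain Q y where Q: "Q \<in> unitary_group" and eq: "U = Q ** (\<chi> a b. if a = b then y a else 0) ** adjoint_matrix Q"
    and y: "\<And>a. y a * cnj (y a) = 1" using unitary_diagonalization[OF U] by blast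
  obtain f :: "nat \<Rightarrow> 'n" where f: "bij_betw f {..<?N} UNIV"
    using ex_bij_betw_nat_finite[of "UNIV :: 'n set"] by (auto simp: atLeast0LessThan)
  define x where "x i = y (f i)" for i
  have 1: "x i \<noteq> 0 \<and> cnj (x i) = inverse (x i)" for i
    using y[of "f i"] unfolding x_def by (metis inverse_unique mult_zero_left zero_neq_one)
  have 2: "ptrace U k = (\<Sum>i<?N. x i powi k)" for k
    unfolding ptrace_diag[OF Q eq y] x_def by (rule sum.reindex_bij_betw[OF f, symmetric])
  have 3: "secular_coeff j U = erec x ?N j" for j
  proof -
    have "det (mat [:0, 1:] + (\<chi> i j. [:U $ i $ j:])) = (\<Prod>i<?N. [:x i, 1:])"
      unfolding char_det_diag[OF Q eq] x_def by (rule prod.reindex_bij_betw[OF f, symmetric])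
    then show ?thesis by (simp add: secular_coeff_def coeff_prod_linear erec_zero)
  qed
  have 4: "trace_sym_power j U = hrec x ?N j" for j
  proof -
    have "trace_sym_power j U = trace_sym_power j (adjoint_matrix Q ** (Q ** (\<chi> a b. if a = b then y a else 0)))"
      unfolding eq by (rule trace_sym_power_commute)
    also have "adjoint_matrix Q ** (Q ** (\<chi> a b. if a = b then y a else 0)) = (\<chi> a b. if a = b then y a else 0)"
      using Q by (simp add: unitary_group_iff matrix_mul_assoc)
    also have "trace_sym_power j (\<chi> a b. if a = b then y a else 0) = (\<Sum>\<alpha> | size \<alpha> = j. \<Prod>a\<in>#\<alpha>. y a)"
      by (rule trace_sym_power_diag)
    also have "\<dots> = (\<Sum>M | set_mset M \<subseteq> {..<?N} \<and> size M = j. \<Prod>i\<in>#M. x i)"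
    proof (rule sum.reindex_bij_witness[where j = "image_mset (the_inv_into {..<?N} f)" and i = "image_mset f"])
      have inj: "inj_on f {..<?N}" and img: "f ` {..<?N} = UNIV" using f by (auto simp: bij_betw_def)
      have fi: "f (the_inv_into {..<?N} f a) = a" for a using f_the_inv_into_f[OF inj] img by auto
      have fm: "the_inv_into {..<?N} f a < ?N" for a using the_inv_into_into[OF inj, of a "{..<?N}"] img by auto
      fix \<alpha> :: "'n multiset" assume a: "\<alpha> \<in> {\<alpha>. size \<alpha> = j}"
      show "image_mset f (image_mset (the_inv_into {..<?N} f) \<alpha>) = \<alpha>" by (simp add: multiset.map_comp comp_def fi)
      show "image_mset (the_inv_into {..<?N} f) \<alpha> \<in> {M. set_mset M \<subseteq> {..<?N} \<and> size M = j}"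
        using a fm by auto
      show "(\<Prod>i\<in>#image_mset (the_inv_into {..<?N} f) \<alpha>. x i) = (\<Prod>a\<in>#\<alpha>. y a)"
        by (simp add: multiset.map_comp comp_def x_def fi)
    next
      have inj: "inj_on f {..<?N}" using f by (auto simp: bij_betw_def)
      fix M assume M: "M \<in> {M. set_mset M \<subseteq> {..<?N} \<and> size M = j}"
      show "image_mset f M \<in> {\<alpha>. size \<alpha> = j}" using M by simp
      have "image_mset (the_inv_into {..<?N} f \<circ> f) M = image_mset id M"
        using M by (intro image_mset_cong) (auto simp: the_inv_into_f_f[OF inj])
      then show "image_mset (the_inv_into {..<?N} f) (image_mset f M) = M" by (simp add: multiset.map_comp)
    qed
    finally show ?thesis using sum_msets_hrec[of ?N j x] by simp
  qed
  show ?thesis using 1 2 3 4 by blast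
qed

section \<open>The moments\<close>

lemma cnj_hrec: "cnj (hrec x N r) = hrec (\<lambda>i. cnj (x i)) N r"
  by (induction x N r rule: hrec.induct) simp_all

lemma cnj_erec: "cnj (erec x N r) = erec (\<lambda>i. cnj (x i)) N r"
  by (induction x N r rule: erec.induct) simp_all

lemma leval_loopsum:
  assumes "\<And>i. i < N \<Longrightarrow> x i \<noteq> 0"
  shows "leval x N (loopsum p k) = loopsum (\<lambda>k. leval x N (p k)) k"
  by (simp add: loopsum_def leval_sum leval_mult assms leval_uminus)

lemma leval_pprod:
  assumes "\<And>i. i < N \<Longrightarrow> x i \<noteq> 0"
  shows "leval x N (pprod p ks) = pprod (\<lambda>k. leval x N (p k)) ks"
  by (simp add: pprod_def leval_prod assms)

lemma leval_casimir:
  assumes "\<And>i. i < N \<Longrightarrow> x i \<noteq> 0"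
  shows "leval x N (casimir p ks) = casimir (\<lambda>k. leval x N (p k)) ks"
  by (simp add: casimir_def leval_sum leval_mult leval_prod leval_add leval_loopsum assms)

text \<open>Evaluation at the eigenvalues followed by integration is a functional to which
  \<open>symmetric_functional\<close> applies. The choice \<open>x\<close> may be irregular in
  \<open>U\<close>; integrability holds because products of power sums evaluate to products of
  traces, which are continuous.\<close>

theorem haar_integral_pspan:
  fixes M :: "(complex^'n^'n) measure"
  assumes M: "haar_prob_measure M" and f: "f \<in> pspan CARD('n)"
    and x: "\<And>U i. U \<in> unitary_group \<Longrightarrow> i < CARD('n) \<Longrightarrow> x U i \<noteq> 0"
    and px: "\<And>U k. U \<in> unitary_group \<Longrightarrow> ptrace U k = (\<Sum>i<CARD('n). x U i powi k)"
  shows "(LINT U|M. leval (x U) CARD('n) f) * lcoeff (vdm CARD('n)) (staircase CARD('n)) =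
    lcoeff (f * vdm CARD('n)) (staircase CARD('n))"
proof -
  let ?N = "CARD('n)"
  interpret prob_space M using M by (simp add: haar_prob_measure_def)
  have sp: "space M = unitary_group" by (rule haar_space[OF M])
  have lp: "(\<lambda>k. leval (x U) ?N (psum ?N k)) = ptrace U" if "U \<in> unitary_group" for U
    using px[OF that] by (auto simp: leval_psum)
  have int: "integrable M (\<lambda>U. leval (x U) ?N g)" if "g \<in> pspan ?N" for g
    using that
  proof induction
    case (pprod ks)
    have "integrable M (\<lambda>U. pprod (ptrace U) ks)" by (rule haar_integrable[OF M continuous_pprod])
    moreover have "leval (x U) ?N (pprod (psum ?N) ks) = pprod (ptrace U) ks" if "U \<in> space M" for U
      using that x lp by (simp add: sp leval_pprod)
    ultimately show ?case by (simp cong: Bochner_Integration.integrable_cong)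
  next
    case (add g h)
    then show ?case by (simp add: leval_add)
  next
    case (scale g c)
    have "integrable M (\<lambda>U. c * leval (x U) ?N g)" using scale by simp
    moreover have "leval (x U) ?N (cst c * g) = c * leval (x U) ?N g" if "U \<in> space M" for U
      using that x by (simp add: sp leval_mult leval_cst)
    ultimately show ?case by (simp cong: Bochner_Integration.integrable_cong)
  qed
  show ?thesis
  proof (rule symmetric_functional[where L = "\<lambda>f. LINT U|M. leval (x U) ?N f", OF _ _ _ _ f])
    show "(LINT U|M. leval (x U) ?N (g + h)) = (LINT U|M. leval (x U) ?N g) + (LINT U|M. leval (x U) ?N h)"
      if "g \<in> pspan ?N" "h \<in> pspan ?N" for g h
      using int that by (simp add: leval_add)
    show "(LINT U|M. leval (x U) ?N (cst c * g)) = c * (LINT U|M. leval (x U) ?N g)" if "g \<in> pspan ?N" for g c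
    proof -
      have "(LINT U|M. leval (x U) ?N (cst c * g)) = (LINT U|M. c * leval (x U) ?N g)"
        by (intro Bochner_Integration.integral_cong refl) (use x in \<open>simp add: sp leval_mult leval_cst\<close>)
      then show ?thesis by simp
    qed
    show "(LINT U|M. leval (x U) ?N 1) = 1" by (simp add: prob_space)
    show "(LINT U|M. leval (x U) ?N (casimir (psum ?N) ks)) = 0" for ks
    proof -
      have "(LINT U|M. leval (x U) ?N (casimir (psum ?N) ks)) = (LINT U|M. casimir (ptrace U) ks)"
        by (intro Bochner_Integration.integral_cong refl) (use x lp in \<open>simp add: sp leval_casimir\<close>)
      then show ?thesis using haar_casimir[OF M] by simp
    qed
  qed
qed

lemma prod_list_partition:
  fixes F :: "nat \<Rightarrow> 'a::comm_monoid_mult"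
  shows "prod_list (map F (partition_of_mults l a)) = (\<Prod>j=1..l. F j ^ a j)"
proof (induction l)
  case 0
  then show ?case by (simp add: partition_of_mults_def)
next
  case (Suc l)
  have "partition_of_mults (Suc l) a = replicate (a (Suc l)) (Suc l) @ partition_of_mults l a"
    by (simp add: partition_of_mults_def)
  then show ?case using Suc by (simp add: prod_list_replicate mult.commute)
qed

lemma prod_nth_partition:
  fixes F :: "nat \<Rightarrow> 'a::comm_monoid_mult"
  assumes "\<mu> = partition_of_mults l a"
  shows "(\<Prod>i<length \<mu>. F (\<mu> ! i)) = (\<Prod>j=1..l. F j ^ a j)"
  using prod_list_partition[of F l a] by (simp add: assms[symmetric] prod.list_conv_set_nth atLeast0LessThan)

lemma row_sums_iff: "row_sums (length \<mu>) n A = \<mu> \<longleftrightarrow> (\<forall>i<length \<mu>. (\<Sum>j<n. A i j) = \<mu> ! i)"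
  unfolding row_sums_def list_eq_iff_nth_eq by simp

lemma col_sums_iff: "col_sums m (length \<nu>) A = \<nu> \<longleftrightarrow> (\<forall>j<length \<nu>. (\<Sum>i<m. A i j) = \<nu> ! j)"
  unfolding col_sums_def list_eq_iff_nth_eq by simp

theorem proposition4p1:
  fixes haar :: "(complex^'n^'n) measure"
    and l :: nat and a b :: "nat \<Rightarrow> nat" and \<mu> \<nu> :: "nat list"
  assumes haar: "haar_prob_measure haar"
    and mu: "\<mu> = partition_of_mults l a"
    and nu: "\<nu> = partition_of_mults l b"
  shows "(LINT U|haar. (\<Prod>j=1..l. secular_coeff j U ^ a j * cnj (secular_coeff j U ^ b j))) =
           of_nat (card {A \<in> nat_matrices (length \<mu>) (length \<nu>).
             row_sums (length \<mu>) (length \<nu>) A = \<mu> \<and> col_sums (length \<mu>) (length \<nu>) A = \<nu> \<and>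
             longest_SE (length \<mu>) (length \<nu>) A \<le> CARD('n)}) \<and>
         (LINT U|haar. (\<Prod>j=1..l. trace_sym_power j U ^ a j * cnj (trace_sym_power j U ^ b j))) =
           of_nat (card {A \<in> nat_matrices (length \<mu>) (length \<nu>).
             row_sums (length \<mu>) (length \<nu>) A = \<mu> \<and> col_sums (length \<mu>) (length \<nu>) A = \<nu> \<and>
             longest_ne (length \<mu>) (length \<nu>) A \<le> CARD('n)})"
proof -
  let ?N = "CARD('n)" and ?m = "length \<mu>" and ?n = "length \<nu>"
  let ?v = "lcoeff (vdm ?N) (staircase ?N)"
  have sp: "space haar = unitary_group" by (rule haar_space[OF haar])
  define P where "P U z \<longleftrightarrow> (\<forall>i<?N. z i \<noteq> 0 \<and> cnj (z i) = inverse (z i)) \<and> (\<forall>k. ptrace U k = (\<Sum>i<?N. z i powi k)) \<and>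
      (\<forall>j. secular_coeff j U = erec z ?N j) \<and> (\<forall>j. trace_sym_power j U = hrec z ?N j)" for U :: "complex^'n^'n" and z
  define x where "x U = (SOME z. P U z)" for U
  have P: "P U (x U)" if "U \<in> unitary_group" for U
    unfolding x_def using unitary_eigenvalues[OF that] by (intro someI_ex[of "P U"]) (simp only: P_def)
  have x: "x U i \<noteq> 0 \<and> cnj (x U i) = inverse (x U i)" if "U \<in> unitary_group" "i < ?N" for U i
    using P[OF that(1)] that(2) unfolding P_def by blast
  have px: "ptrace U k = (\<Sum>i<?N. x U i powi k)" and ex: "secular_coeff k' U = erec (x U) ?N k'"
    and hx: "trace_sym_power k' U = hrec (x U) ?N k'" if "U \<in> unitary_group" for U k k'
    using P[OF that] unfolding P_def by blast+
  have x0: "x U i \<noteq> 0" if "U \<in> unitary_group" "i < ?N" for U i using x[OF that] by simp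
  \<comment> \<open>Both integrals are instances: \<open>S\<close> is the function of the matrix,
    \<open>G\<close> its formal counterpart with \<open>bar\<close> for conjugation, and
    \<open>C\<close> the number supplied by the pairing of Pieri coefficients.\<close>
  have moment: "(LINT U|haar. (\<Prod>j=1..l. S j U ^ a j * cnj (S j U ^ b j))) = of_nat C"
    if S: "\<And>U j. U \<in> unitary_group \<Longrightarrow> S j U = leval (x U) ?N (G j)"
      "\<And>U j. U \<in> unitary_group \<Longrightarrow> cnj (S j U) = leval (x U) ?N (bar (G j))"
      and G: "(\<Prod>i<?m. G (\<mu> ! i)) \<in> pspan ?N" "bar (\<Prod>i<?n. G (\<nu> ! i)) \<in> pspan ?N"
      and C: "lcoeff ((\<Prod>i<?m. G (\<mu> ! i)) * bar (\<Prod>i<?n. G (\<nu> ! i)) * vdm ?N) (staircase ?N) = of_nat C * ?v"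
    for S :: "nat \<Rightarrow> complex^'n^'n \<Rightarrow> complex" and G C
  proof -
    let ?f = "(\<Prod>i<?m. G (\<mu> ! i)) * bar (\<Prod>i<?n. G (\<nu> ! i))"
    have "(\<Prod>j=1..l. S j U ^ a j * cnj (S j U ^ b j)) = leval (x U) ?N ?f" if U: "U \<in> unitary_group" for U
    proof -
      have "leval (x U) ?N ?f = (\<Prod>i<?m. S (\<mu> ! i) U) * (\<Prod>i<?n. cnj (S (\<nu> ! i) U))"
        using x0[OF U] unfolding S(2)[OF U] unfolding S(1)[OF U] by (simp add: leval_mult leval_prod bar_prod)
      also have "\<dots> = (\<Prod>j=1..l. S j U ^ a j) * (\<Prod>j=1..l. cnj (S j U) ^ b j)"
        using prod_nth_partition[OF mu, of "\<lambda>j. S j U"] prod_nth_partition[OF nu, of "\<lambda>j. cnj (S j U)"] by simp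
      finally show ?thesis by (simp add: prod.distrib)
    qed
    then have "(LINT U|haar. (\<Prod>j=1..l. S j U ^ a j * cnj (S j U ^ b j))) = (LINT U|haar. leval (x U) ?N ?f)"
      by (intro Bochner_Integration.integral_cong refl) (simp add: sp)
    moreover have "(LINT U|haar. leval (x U) ?N ?f) * ?v = of_nat C * ?v"
      unfolding C[symmetric] by (rule haar_integral_pspan[OF haar pspan_mult[OF G] x0 px])
    ultimately show ?thesis using vdm_staircase[of ?N] by simp
  qed
  have "(LINT U|haar. (\<Prod>j=1..l. secular_coeff j U ^ a j * cnj (secular_coeff j U ^ b j))) =
     of_nat (card {A \<in> nat_matrices ?m ?n. row_sums ?m ?n A = \<mu> \<and> col_sums ?m ?n A = \<nu> \<and> longest_SE ?m ?n A \<le> ?N})"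
    unfolding row_sums_iff col_sums_iff card_matrices_SE'
  proof (rule moment[where G = "esum ?N"])
    fix U :: "complex^'n^'n" and j assume U: "U \<in> unitary_group"
    show "secular_coeff j U = leval (x U) ?N (esum ?N j)" using x0[OF U] by (simp add: leval_esum ex[OF U])
    show "cnj (secular_coeff j U) = leval (x U) ?N (bar (esum ?N j))"
      using x0[OF U] x[OF U] by (simp add: leval_esum ex[OF U] cnj_erec cong: erec_cong)
  qed (use pspan_eprod[of ?N _ ?m] pspan_eprod[of ?N _ ?n] pairing_esum in auto)
  moreover have "(LINT U|haar. (\<Prod>j=1..l. trace_sym_power j U ^ a j * cnj (trace_sym_power j U ^ b j))) =
     of_nat (card {A \<in> nat_matrices ?m ?n. row_sums ?m ?n A = \<mu> \<and> col_sums ?m ?n A = \<nu> \<and> longest_ne ?m ?n A \<le> ?N})"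
    unfolding row_sums_iff col_sums_iff card_matrices_ne
  proof (rule moment[where G = "hsum ?N"])
    fix U :: "complex^'n^'n" and j assume U: "U \<in> unitary_group"
    show "trace_sym_power j U = leval (x U) ?N (hsum ?N j)" using x0[OF U] by (simp add: leval_hsum hx[OF U])
    show "cnj (trace_sym_power j U) = leval (x U) ?N (bar (hsum ?N j))"
      using x0[OF U] x[OF U] by (simp add: leval_hsum hx[OF U] cnj_hrec cong: hrec_cong)
  qed (use pspan_hprod[of ?N _ ?m] pspan_hprod[of ?N _ ?n] pairing_hsum in auto)
  ultimately show ?thesis by blast
qed

end
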